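(* Let $\mathbb{K}$ be a field and let $\mathcal{A}$ be a totally free central arrangement of hyperplanes in an $\ell$-dimensional $\mathbb{K}$-vector space $V$, $\ell\ge 1$. Then any subarrangement of $\mathcal{A}$ (that is, any subset $\mathcal{B}\subseteq\mathcal{A}$, viewed as an arrangement in $V$) is totally free, and for any $H_0\in\mathcal{A}$ the restriction $\mathcal{A}''=\{H_0\cap H\mid H\in\mathcal{A}\setminus\{H_0\}\}$, an arrangement in the vector space $H_0$, is totally free.
   Context: A central arrangement in a finite-dimensional $\mathbb{K}$-vector space $V$ of dimension $\ell$ is a finite (possibly empty) collection of linear hyperplanes of $V$. Let $S=\mathrm{Sym}(V^* )\simeq\mathbb{K}[x_1,\ldots,x_\ell]$ for a basis $x_1,\ldots,x_\ell$ of $V^*$, and let $\mathrm{Der}_{\mathbb{K}}(S)=\bigoplus_{i=1}^{\ell}S\,\partial_{x_i}$ be the $S$-module of $\mathbb{K}$-linear derivations of $S$ to itself. For each $H\in\mathcal{A}$ fix $\alpha_H\in V^*$ with $\ker(\alpha_H)=H$. A multiplicity on $\mathcal{A}$ is a function $m:\mathcal{A}\to\mathbb{Z}_{>0}$; the pair $(\mathcal{A},m)$ is called a multiarrangement. Its logarithmic derivation module is $$D(\mathcal{A},m)=\{\theta\in\mathrm{Der}_{\mathbb{K}}(S)\mid \theta(\alpha_H)\in S\cdot\alpha_H^{m(H)}\text{ for all }H\in\mathcal{A}\}.$$ The multiarrangement $(\mathcal{A},m)$ is free if $D(\mathcal{A},m)$ is a free $S$-module. The arrangement $\mathcal{A}$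 is totally free if $(\mathcal{A},m)$ is free for every multiplicity $m:\mathcal{A}\to\mathbb{Z}_{>0}$. (If $\ell=1$, the restriction is the empty arrangement in the zero space, for which $S=\mathbb{K}$ and $D=0$, which is free of rank $0$.) *)

theory Defs
  imports Complex_Main "HOL-Library.Poly_Mapping"
begin

text \<open>Formal polynomials, not polynomial functions (the field may be finite). An exponent is a
  finitely supported map from variable indices to \<^typ>\<open>nat\<close>, and
  \<open>polys n\<close> is the subring \<open>K[x_0, ..., x_{n-1}]\<close>.\<close>

type_synonym 'k mpoly = "(nat \<Rightarrow>\<^sub>0 nat) \<Rightarrow>\<^sub>0 'k"

definition mconst :: "'k::field \<Rightarrow> 'k mpoly"
  where "mconst c = Poly_Mapping.single 0 c"

definition mvar :: "nat \<Rightarrow> 'k::field mpoly"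
  where "mvar i = Poly_Mapping.single (Poly_Mapping.single i 1) 1"

definition polys :: "nat \<Rightarrow> 'k::field mpoly set"
  where "polys n = {p. \<forall>t \<in> Poly_Mapping.keys p. Poly_Mapping.keys t \<subseteq> {..<n}}"

text \<open>The \<open>K\<close>-linear derivations of \<open>polys n\<close> to itself. They are represented by total functions
  that vanish outside \<open>polys n\<close>, so that equality of derivations is equality of functions and the
  pointwise module operations stay within the representation.\<close>

definition derivations :: "nat \<Rightarrow> ('k::field mpoly \<Rightarrow> 'k mpoly) set"
  where "derivations n = {\<theta>.
    (\<forall>p \<in> polys n. \<theta> p \<in> polys n) \<and>
    (\<forall>p. p \<notin> polys n \<longrightarrow> \<theta> p = 0) \<and>
    (\<forall>p \<in> polys n. \<forall>q \<in> polys n. \<theta> (p + q) = \<theta> p + \<theta> q) \<and>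
    (\<forall>c. \<forall>p \<in> polys n. \<theta> (mconst c * p) = mconst c * \<theta> p) \<and>
    (\<forall>p \<in> polys n. \<forall>q \<in> polys n. \<theta> (p * q) = p * \<theta> q + q * \<theta> p)}"

text \<open>Freeness of a module \<open>M\<close> of functions, with pointwise operations, over a subring \<open>R\<close>:
  there is a subset \<open>E\<close> of \<open>M\<close> such that every element of \<open>M\<close> is a finite \<open>R\<close>-linear combination
  of elements of \<open>E\<close> with unique coefficients.\<close>

definition free_module :: "'r::comm_ring_1 set \<Rightarrow> ('s \<Rightarrow> 'r) set \<Rightarrow> bool"
  where "free_module R M \<longleftrightarrow> (\<exists>E \<subseteq> M. \<forall>\<theta> \<in> M. \<exists>!c.
    (\<forall>e. c e \<in> R) \<and> finite {e. c e \<noteq> 0} \<and> {e. c e \<noteq> 0} \<subseteq> E \<and>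
    \<theta> = (\<lambda>p. \<Sum>e | c e \<noteq> 0. c e * e p))"

text \<open>Vector spaces are finite-dimensional subspaces \<open>V\<close> of an ambient space with scalar
  multiplication \<open>s\<close>, so that \<open>V\<close> and its hyperplanes are treated alike. A list \<open>bs\<close> is an ordered basis of \<open>V\<close>; the variables of
  \<open>polys (length bs)\<close> stand for the dual basis, which identifies this ring with \<open>Sym(V*)\<close>.
  Every basis of \<open>V*\<close> is dual to some \<open>bs\<close>.\<close>

definition ordered_basis ::
    "('k::field \<Rightarrow> 'v::ab_group_add \<Rightarrow> 'v)
      \<Rightarrow> 'v set \<Rightarrow> 'v list \<Rightarrow> bool"
  where "ordered_basis s V bs \<longleftrightarrow> distinct bs \<and> \<not> module.dependent s (set bs) \<and>
    module.span s (set bs) = V"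

definition hyperplane_of ::
    "('k::field \<Rightarrow> 'v::ab_group_add \<Rightarrow> 'v)
      \<Rightarrow> 'v set \<Rightarrow> 'v set \<Rightarrow> bool"
  where "hyperplane_of s V H \<longleftrightarrow> module.subspace s H \<and> H \<subseteq> V \<and>
    vector_space.dim s V = vector_space.dim s H + 1"

definition central_arrangement ::
    "('k::field \<Rightarrow> 'v::ab_group_add \<Rightarrow> 'v)
      \<Rightarrow> 'v set \<Rightarrow> 'v set set \<Rightarrow> bool"
  where "central_arrangement s V \<A> \<longleftrightarrow> finite \<A> \<and> (\<forall>H \<in> \<A>. hyperplane_of s V H)"

text \<open>Only the values on \<open>V\<close> are constrained.\<close>

definition linear_form_on ::
    "('k::field \<Rightarrow> 'v::ab_group_add \<Rightarrow> 'v)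
      \<Rightarrow> 'v set \<Rightarrow> ('v \<Rightarrow> 'k) \<Rightarrow> bool"
  where "linear_form_on s V \<alpha> \<longleftrightarrow>
    (\<forall>x \<in> V. \<forall>y \<in> V. \<alpha> (x + y) = \<alpha> x + \<alpha> y) \<and> (\<forall>c. \<forall>x \<in> V. \<alpha> (s c x) = c * \<alpha> x)"

text \<open>The fixed choice of \<open>\<alpha>\<^sub>H\<close>, which exists for every hyperplane \<open>H\<close> of \<open>V\<close>.\<close>

definition defining_form ::
    "('k::field \<Rightarrow> 'v::ab_group_add \<Rightarrow> 'v)
      \<Rightarrow> 'v set \<Rightarrow> 'v set \<Rightarrow> 'v \<Rightarrow> 'k"
  where "defining_form s V H = (SOME \<alpha>. linear_form_on s V \<alpha> \<and> {x \<in> V. \<alpha> x = 0} = H)"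

text \<open>The image in \<open>polys (length bs)\<close> of a linear form: its coefficient at the \<open>i\<close>-th dual basis
  vector is its value at \<open>bs ! i\<close>.\<close>

definition form_poly :: "'v list \<Rightarrow> ('v \<Rightarrow> 'k::field) \<Rightarrow> 'k mpoly"
  where "form_poly bs \<alpha> = (\<Sum>i<length bs. mconst (\<alpha> (bs ! i)) * mvar i)"

definition log_derivations ::
    "('k::field \<Rightarrow> 'v::ab_group_add \<Rightarrow> 'v)
      \<Rightarrow> 'v set \<Rightarrow> 'v list \<Rightarrow> 'v set set \<Rightarrow> ('v set \<Rightarrow> nat) \<Rightarrow> ('k mpoly \<Rightarrow> 'k mpoly) set"
  where "log_derivations s V bs \<A> m = {\<theta> \<in> derivations (length bs). \<forall>H \<in> \<A>.
    \<exists>q \<in> polys (length bs). \<theta> (form_poly bs (defining_form s V H)) =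
      q * form_poly bs (defining_form s V H) ^ m H}"

definition free_multiarrangement ::
    "('k::field \<Rightarrow> 'v::ab_group_add \<Rightarrow> 'v)
      \<Rightarrow> 'v set \<Rightarrow> 'v list \<Rightarrow> 'v set set \<Rightarrow> ('v set \<Rightarrow> nat) \<Rightarrow> bool"
  where "free_multiarrangement s V bs \<A> m \<longleftrightarrow>
    free_module (polys (length bs)) (log_derivations s V bs \<A> m)"

text \<open>A multiplicity is a function on all subsets of which only the values on \<open>\<A>\<close> matter.\<close>

definition totally_free ::
    "('k::field \<Rightarrow> 'v::ab_group_add \<Rightarrow> 'v)
      \<Rightarrow> 'v set \<Rightarrow> 'v list \<Rightarrow> 'v set set \<Rightarrow> bool"
  where "totally_free s V bs \<A> \<longleftrightarrow>
    (\<forall>m. (\<forall>H \<in> \<A>. m H > 0) \<longrightarrow> free_multiarrangement s V bs \<A> m)"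

definition restriction :: "'v set set \<Rightarrow> 'v set \<Rightarrow> 'v set set"
  where "restriction \<A> H0 = (\<lambda>H. H0 \<inter> H) ` (\<A> - {H0})"

end

theory Submission
  imports Defs "Jordan_Normal_Form.Determinant"
begin

text \<open>An arrangement is totally free if and only if it is a product of arrangements of rank at
  most two (Abe, Terao and Yoshinaga), and this condition visibly passes to subarrangements and
  restrictions. Here \<open>splits\<close> expresses the condition by a basis of the space, divided into
  blocks of at most two vectors, such that each hyperplane contains all basis vectors outside one
  block. The two implications are \<open>splits_if_totally_free\<close> and \<open>free_if_splits\<close>.

  A product of arrangements of rank at most two is free for all multiplicities because of the
  following step, \<open>block_basis_step\<close>, by which the multiplicity of one hyperplane with the form
  \<open>\<alpha>\<close> is raised by one. Only the two basis elements of one block are affected, and all their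
  values are binary forms. Modulo \<open>\<alpha>\<close>, a binary form is a constant multiple of a power of another
  form \<open>\<beta>\<close>. So one of the two elements can be used to make the value of the other one more
  divisible, and has then to be multiplied by \<open>\<alpha>\<close>.

  For the converse, it suffices to exclude circuits of length at least four, that is, minimal linear
  relations between at least four of the forms: then each form is, in terms of a maximal set
  of independent ones, a combination of at most two, and two such pairs are equal or disjoint. Suppose
  that there is such a relation, and let \<open>x\<close>, \<open>y\<close> and \<open>z\<close> be three of its
  forms. Give them multiplicities \<open>K\<close>, \<open>L\<close> and \<open>B\<close> larger than the number of all
  hyperplanes, such that \<open>K\<close> exceeds \<open>L\<close> and \<open>B\<close> by more than that number, and give multiplicity
  one to the remaining hyperplanes. The logarithmic module has a homogeneous basis whose degrees add up to
  at most the sum of all multiplicities (\<open>free_imp_homogeneous_basis\<close>). Hence only one element of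
  the basis is nonzero on \<open>x\<close>, and its value there is \<open>x ^ K\<close> up to a constant factor
  (\<open>single_basis_value\<close>). Inserting this element into the relation, and restricting to a plane
  on which all forms of the relation except \<open>x\<close>, \<open>y\<close> and \<open>z\<close> vanish, one finds that a
  power \<open>(c1 y + c2 z) ^ K\<close> of a linear form in two variables lies in the ideal of
  \<open>y ^ L\<close> and \<open>z ^ B\<close>. With suitable numbers this contradicts the binomial theorem, in every
  characteristic (\<open>no_long_circuit\<close>).

  Homogeneity is not part of the definition of freeness. That a basis can be made homogeneous is
  seen from its determinant, which divides the product of the powers \<open>\<alpha> H ^ m H\<close>, as in Saito's
  criterion, and is therefore homogeneous.

  All of this takes place in the ring of polynomials in infinitely many variables, where divisibility
  is the usual relation \<open>dvd\<close>. Linear forms are prime elements there.\<close>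

section \<open>Polynomials as sums of monomials\<close>

abbreviation coef :: "'k::field mpoly \<Rightarrow> (nat \<Rightarrow>\<^sub>0 nat) \<Rightarrow> 'k"
  where "coef \<equiv> Poly_Mapping.lookup"

abbreviation supp :: "'k::field mpoly \<Rightarrow> (nat \<Rightarrow>\<^sub>0 nat) set"
  where "supp \<equiv> Poly_Mapping.keys"

abbreviation expo :: "(nat \<Rightarrow>\<^sub>0 nat) \<Rightarrow> nat \<Rightarrow> nat"
  where "expo \<equiv> Poly_Mapping.lookup"

definition monom_poly :: "(nat \<Rightarrow>\<^sub>0 nat) \<Rightarrow> 'k::field mpoly"
  where "monom_poly t = Poly_Mapping.single t 1"

lemma mconst_0 [simp]: "mconst 0 = 0"
  by (simp add: mconst_def)

lemma mconst_1 [simp]: "mconst 1 = 1"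
  by (simp add: mconst_def)

lemma mconst_add: "mconst (a + b) = mconst a + mconst b"
  by (simp add: mconst_def single_add)

lemma mconst_mult: "mconst (a * b) = mconst a * mconst b"
  by (simp add: mconst_def mult_single)

lemma mconst_uminus: "mconst (- a) = - mconst a"
  by (simp add: mconst_def single_uminus)

lemma mconst_sum: "mconst (sum f A) = (\<Sum>i\<in>A. mconst (f i))"
  by (induction A rule: infinite_finite_induct) (simp_all add: mconst_add)

lemma mconst_power: "mconst (a ^ n) = mconst a ^ n"
  by (induction n) (simp_all add: mconst_mult)

lemma mconst_of_nat: "mconst (of_nat n) = of_nat n"
  by (induction n) (simp_all add: mconst_add)

lemma mconst_eq_0_iff [simp]: "mconst c = 0 \<longleftrightarrow> c = 0"
  unfolding mconst_def by (metis lookup_single_eq lookup_zero single_zero)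

lemma mconst_inverse: "c \<noteq> 0 \<Longrightarrow> mconst (1 / c) * mconst c = 1"
  by (simp flip: mconst_mult)

lemma coef_mconst: "coef (mconst c) t = (if t = 0 then c else 0)"
  by (auto simp: mconst_def lookup_single when_def)

lemma monom_poly_add: "monom_poly (s + t) = monom_poly s * monom_poly t"
  by (simp add: monom_poly_def mult_single)

lemma monom_poly_0 [simp]: "monom_poly 0 = 1"
  by (simp add: monom_poly_def)

lemma monom_poly_single: "monom_poly (Poly_Mapping.single i n) = mvar i ^ n"
proof (induction n)
  case (Suc n)
  have "Poly_Mapping.single i (Suc n) = Poly_Mapping.single i 1 + Poly_Mapping.single i n"
    by (simp flip: single_add)
  then show ?case
    using Suc by (simp add: monom_poly_add) (simp add: monom_poly_def mvar_def)
qed simp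

text \<open>Substitutions, derivations and homogeneous components are all determined by what they do on
  monomials; the following map extends a function on monomials linearly, and
  \<open>linear_ext_mult\<close> reduces the question what happens to products to the case of monomials.\<close>

definition linear_ext :: "((nat \<Rightarrow>\<^sub>0 nat) \<Rightarrow> 'k mpoly) \<Rightarrow> 'k::field mpoly \<Rightarrow> 'k mpoly"
  where "linear_ext g p = (\<Sum>t\<in>supp p. mconst (coef p t) * g t)"

lemma linear_ext_superset:
  assumes "finite F" "supp p \<subseteq> F"
  shows "linear_ext g p = (\<Sum>t\<in>F. mconst (coef p t) * g t)"
  unfolding linear_ext_def
  by (rule sum.mono_neutral_left) (use assms in \<open>auto simp: in_keys_iff\<close>)

lemma linear_ext_0 [simp]: "linear_ext g 0 = 0"
  by (simp add: linear_ext_def)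

lemma linear_ext_add: "linear_ext g (p + q) = linear_ext g p + linear_ext g q"
proof -
  let ?F = "supp p \<union> supp q"
  have "supp (p + q) \<subseteq> ?F" by (rule keys_add)
  then have "linear_ext g (p + q) = (\<Sum>t\<in>?F. mconst (coef (p + q) t) * g t)"
    by (intro linear_ext_superset) auto
  also have "\<dots> = (\<Sum>t\<in>?F. mconst (coef p t) * g t) + (\<Sum>t\<in>?F. mconst (coef q t) * g t)"
    by (simp add: lookup_add mconst_add ring_distribs sum.distrib)
  also have "(\<Sum>t\<in>?F. mconst (coef p t) * g t) = linear_ext g p"
    by (rule linear_ext_superset[symmetric]) auto
  also have "(\<Sum>t\<in>?F. mconst (coef q t) * g t) = linear_ext g q"
    by (rule linear_ext_superset[symmetric]) auto
  finally show ?thesis .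
qed

lemma linear_ext_sum: "linear_ext g (sum f A) = (\<Sum>i\<in>A. linear_ext g (f i))"
  by (induction A rule: infinite_finite_induct) (simp_all add: linear_ext_add)

lemma linear_ext_single: "linear_ext g (Poly_Mapping.single t c) = mconst c * g t"
  by (cases "c = 0") (simp_all add: linear_ext_def)

lemma linear_ext_monom_poly [simp]: "linear_ext g (monom_poly t) = g t"
  by (simp add: monom_poly_def linear_ext_single)

lemma mconst_mult_monom_poly: "mconst c * monom_poly t = Poly_Mapping.single t c"
  by (simp add: mconst_def monom_poly_def mult_single)

lemma poly_eq_linear_ext: "linear_ext monom_poly p = p"
proof (rule poly_mapping_eqI)
  fix s
  have "coef (linear_ext monom_poly p) s = (\<Sum>t\<in>supp p. if t = s then coef p t else 0)"
    by (simp add: linear_ext_def lookup_sum mconst_mult_monom_poly lookup_single when_def)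
  also have "\<dots> = coef p s"
    by (simp add: sum.delta not_in_keys_iff_lookup_eq_zero)
  finally show "coef (linear_ext monom_poly p) s = coef p s" .
qed

lemma linear_ext_mult:
  "linear_ext g (p * q) =
    (\<Sum>s\<in>supp p. \<Sum>t\<in>supp q. mconst (coef p s) * mconst (coef q t) * g (s + t))"
proof -
  have "p * q = linear_ext monom_poly p * linear_ext monom_poly q"
    by (simp add: poly_eq_linear_ext)
  also have "\<dots> = (\<Sum>s\<in>supp p. \<Sum>t\<in>supp q. Poly_Mapping.single (s + t) (coef p s * coef q t))"
    by (simp add: linear_ext_def sum_product mconst_mult_monom_poly mult_single)
  finally have "linear_ext g (p * q) = linear_ext g \<dots>"
    by simp
  then show ?thesis
    by (simp add: linear_ext_sum linear_ext_single mconst_mult)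
qed

lemma linear_ext_mconst_mult: "linear_ext g (mconst c * p) = mconst c * linear_ext g p"
proof (cases "c = 0")
  case False
  then show ?thesis
    unfolding linear_ext_mult by (simp add: mconst_def sum_distrib_left linear_ext_def mult.assoc)
qed simp

section \<open>The subrings of polynomials in finitely many variables\<close>

lemma polys_0 [simp]: "0 \<in> polys n"
  and polys_mconst [simp]: "mconst c \<in> polys n"
  by (auto simp: polys_def mconst_def split: if_splits)

lemma polys_1 [simp]: "1 \<in> polys n"
  using polys_mconst[of 1] by (simp del: polys_mconst)

lemma polys_mvar [simp]: "i < n \<Longrightarrow> mvar i \<in> polys n"
  by (auto simp: polys_def mvar_def)

lemma polys_add [simp]: "p \<in> polys n \<Longrightarrow> q \<in> polys n \<Longrightarrow> p + q \<in> polys n"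
  using keys_add[of p q] by (auto simp: polys_def)

lemma polys_mult [simp]:
  assumes "p \<in> polys n" "q \<in> polys n" shows "p * q \<in> polys n"
  unfolding polys_def
proof safe
  fix t i assume "t \<in> supp (p * q)" and i: "i \<in> Poly_Mapping.keys t"
  then obtain s u where "s \<in> supp p" "u \<in> supp q" "t = s + u"
    using keys_mult[of p q] by blast
  then show "i < n"
    using i assms keys_add[of s u] unfolding polys_def by blast
qed

lemma polys_uminus [simp]: "p \<in> polys n \<Longrightarrow> - p \<in> polys n"
  using polys_mult[OF polys_mconst[of "- 1" n], of p]
  by (simp only: mconst_uminus mconst_1 mult_minus1)

lemma polys_sum [simp]: "(\<And>i. i \<in> A \<Longrightarrow> f i \<in> polys n) \<Longrightarrow> sum f A \<in> polys n"
  by (induction A rule: infinite_finite_induct) simp_all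

lemma polys_prod [simp]: "(\<And>i. i \<in> A \<Longrightarrow> f i \<in> polys n) \<Longrightarrow> prod f A \<in> polys n"
  by (induction A rule: infinite_finite_induct) simp_all

lemma polys_power [simp]: "p \<in> polys n \<Longrightarrow> p ^ m \<in> polys n"
  by (induction m) simp_all

lemma monom_poly_induct [consumes 1, case_names one mvar]:
  assumes "Poly_Mapping.keys t \<subseteq> I"
    and "P 1" and "\<And>i p. i \<in> I \<Longrightarrow> P p \<Longrightarrow> P (mvar i * p)"
  shows "P (monom_poly t)"
  using assms(1)
proof (induction t rule: update_induct)
  case const
  show ?case by (simp add: assms(2))
next
  case (update t i k)
  have "Poly_Mapping.update i k t = Poly_Mapping.single i k + t"
    using update.hyps by (intro poly_mapping_eqI)
      (auto simp: lookup_update lookup_add lookup_single when_def not_in_keys_iff_lookup_eq_zero)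
  then have eq: "monom_poly (Poly_Mapping.update i k t) = mvar i ^ k * monom_poly t"
    by (simp add: monom_poly_add monom_poly_single)
  have "i \<in> I" "P (monom_poly t)"
    using update by (auto simp: keys_update)
  then have "P (mvar i ^ j * monom_poly t)" for j
    by (induction j) (simp_all add: assms(3) mult.assoc)
  then show ?case unfolding eq .
qed

lemma poly_induct_aux:
  assumes "\<And>t. t \<in> supp p \<Longrightarrow> Poly_Mapping.keys t \<subseteq> I"
    and "\<And>c. P (mconst c)" and "\<And>i. i \<in> I \<Longrightarrow> P (mvar i)"
    and add: "\<And>p q. p \<in> S \<Longrightarrow> q \<in> S \<Longrightarrow> P p \<Longrightarrow> P q \<Longrightarrow> P (p + q)"
    and mult: "\<And>p q. p \<in> S \<Longrightarrow> q \<in> S \<Longrightarrow> P p \<Longrightarrow> P q \<Longrightarrow> P (p * q)"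
    and S: "\<And>c. mconst c \<in> S" "\<And>i. i \<in> I \<Longrightarrow> mvar i \<in> S"
      "\<And>p q. p \<in> S \<Longrightarrow> q \<in> S \<Longrightarrow> p + q \<in> S" "\<And>p q. p \<in> S \<Longrightarrow> q \<in> S \<Longrightarrow> p * q \<in> S"
  shows "P p"
proof -
  have mono: "monom_poly t \<in> S \<and> P (monom_poly t)" if "Poly_Mapping.keys t \<subseteq> I" for t
    using that
  proof (induction rule: monom_poly_induct)
    case one
    show ?case using S(1)[of 1] assms(2)[of 1] by simp
  next
    case (mvar i p)
    then show ?case using S assms(3) mult by blast
  qed
  have "(\<Sum>t\<in>F. mconst (coef p t) * monom_poly t) \<in> S \<and>
      P (\<Sum>t\<in>F. mconst (coef p t) * monom_poly t)"
    if "finite F" "F \<subseteq> supp p" for F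
    using that
  proof (induction F)
    case empty
    show ?case using S(1)[of 0] assms(2)[of 0] by simp
  next
    case (insert t F)
    then show ?case using mono[of t] assms(1)[of t] assms(2) S mult add by simp
  qed
  from this[of "supp p"] show ?thesis
    by (simp add: poly_eq_linear_ext flip: linear_ext_def)
qed

lemma mpoly_induct [case_names mconst mvar add mult]:
  assumes "\<And>c. P (mconst c)" and "\<And>i. P (mvar i)"
    and "\<And>p q. P p \<Longrightarrow> P q \<Longrightarrow> P (p + q)" and "\<And>p q. P p \<Longrightarrow> P q \<Longrightarrow> P (p * q)"
  shows "P p"
  by (rule poly_induct_aux[of p UNIV P UNIV]) (use assms in auto)

lemma polys_induct [consumes 1, case_names mconst mvar add mult]:
  assumes p: "p \<in> polys n" and "\<And>c. P (mconst c)" and "\<And>i. i < n \<Longrightarrow> P (mvar i)"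
    and "\<And>p q. p \<in> polys n \<Longrightarrow> q \<in> polys n \<Longrightarrow> P p \<Longrightarrow> P q \<Longrightarrow> P (p + q)"
    and "\<And>p q. p \<in> polys n \<Longrightarrow> q \<in> polys n \<Longrightarrow> P p \<Longrightarrow> P q \<Longrightarrow> P (p * q)"
  shows "P p"
proof (rule poly_induct_aux[of p "{..<n}" P "polys n"])
  show "\<And>t. t \<in> supp p \<Longrightarrow> Poly_Mapping.keys t \<subseteq> {..<n}"
    using p by (simp add: polys_def)
qed (use assms(2-) in auto)

section \<open>Substitution\<close>

definition subst :: "(nat \<Rightarrow> 'k mpoly) \<Rightarrow> 'k::field mpoly \<Rightarrow> 'k mpoly"
  where "subst s = linear_ext (\<lambda>t. \<Prod>i\<in>Poly_Mapping.keys t. s i ^ expo t i)"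

lemma subst_mult: "subst s (p * q) = subst s p * subst s q"
proof -
  have "(\<Prod>i\<in>Poly_Mapping.keys (t + u). s i ^ expo (t + u) i) =
      (\<Prod>i\<in>Poly_Mapping.keys t. s i ^ expo t i) * (\<Prod>i\<in>Poly_Mapping.keys u. s i ^ expo u i)"
    (is "?l = _") for t u
  proof -
    let ?F = "Poly_Mapping.keys t \<union> Poly_Mapping.keys u"
    have "?l = (\<Prod>i\<in>?F. s i ^ expo (t + u) i)"
      by (rule prod.mono_neutral_left) (use keys_add[of t u] in \<open>auto simp: in_keys_iff\<close>)
    also have "\<dots> = (\<Prod>i\<in>?F. s i ^ expo t i) * (\<Prod>i\<in>?F. s i ^ expo u i)"
      by (simp add: lookup_add power_add prod.distrib)
    also have "(\<Prod>i\<in>?F. s i ^ expo t i) = (\<Prod>i\<in>Poly_Mapping.keys t. s i ^ expo t i)"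
      by (rule prod.mono_neutral_right) (auto simp: in_keys_iff)
    also have "(\<Prod>i\<in>?F. s i ^ expo u i) = (\<Prod>i\<in>Poly_Mapping.keys u. s i ^ expo u i)"
      by (rule prod.mono_neutral_right) (auto simp: in_keys_iff)
    finally show ?thesis .
  qed
  then show ?thesis
    unfolding subst_def linear_ext_mult by (simp add: linear_ext_def sum_product ac_simps)
qed

lemma subst_add: "subst s (p + q) = subst s p + subst s q"
  by (simp add: subst_def linear_ext_add)

lemma subst_mconst [simp]: "subst s (mconst c) = mconst c"
  by (simp add: subst_def mconst_def[of c] linear_ext_single)

lemma subst_0 [simp]: "subst s 0 = 0"
  by (simp add: subst_def)

lemma subst_1 [simp]: "subst s 1 = 1"
  using subst_mconst[of s 1] by (simp del: subst_mconst)

lemma subst_mvar [simp]: "subst s (mvar i) = s i"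
  by (simp add: subst_def mvar_def linear_ext_single)

lemma subst_sum: "subst s (sum f A) = (\<Sum>i\<in>A. subst s (f i))"
  by (simp add: subst_def linear_ext_sum)

lemma subst_power: "subst s (p ^ n) = subst s p ^ n"
  by (induction n) (simp_all add: subst_mult)

lemma subst_dvd: "p dvd q \<Longrightarrow> subst s p dvd subst s q"
  by (auto simp: dvd_def subst_mult)

text \<open>Setting the surplus variables to zero retracts the ring of all polynomials onto
  \<open>polys n\<close>. Hence quotients and coefficients that exist among all polynomials can be
  chosen in \<open>polys n\<close>.\<close>

definition retract :: "nat \<Rightarrow> 'k::field mpoly \<Rightarrow> 'k mpoly"
  where "retract n = subst (\<lambda>i. if i < n then mvar i else 0)"

lemma retract_in_polys [simp]: "retract n p \<in> polys n"
  unfolding retract_def by (induction p rule: mpoly_induct) (auto simp: subst_add subst_mult)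

lemma retract_polys [simp]: "p \<in> polys n \<Longrightarrow> retract n p = p"
  unfolding retract_def by (induction rule: polys_induct) (auto simp: subst_add subst_mult)

lemma retract_mult: "retract n (p * q) = retract n p * retract n q"
  by (simp add: retract_def subst_mult)

lemma retract_sum: "retract n (sum f A) = (\<Sum>i\<in>A. retract n (f i))"
  by (simp add: retract_def subst_sum)

lemma dvd_in_polys:
  assumes "p \<in> polys n" "q \<in> polys n" "p dvd q"
  shows "\<exists>r\<in>polys n. q = r * p"
proof -
  obtain r where "q = p * r" using assms(3) by (auto simp: dvd_def)
  then have "retract n q = retract n p * retract n r" by (simp add: retract_mult)
  then show ?thesis
    using assms by (intro bexI[of _ "retract n r"]) (auto simp: mult.commute)
qed

section \<open>Grading\<close>

definition tdeg :: "(nat \<Rightarrow>\<^sub>0 nat) \<Rightarrow> nat"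
  where "tdeg t = (\<Sum>i\<in>Poly_Mapping.keys t. expo t i)"

lemma tdeg_add: "tdeg (s + t) = tdeg s + tdeg t"
proof -
  let ?F = "Poly_Mapping.keys s \<union> Poly_Mapping.keys t"
  have *: "tdeg u = (\<Sum>i\<in>?F. expo u i)" if "Poly_Mapping.keys u \<subseteq> ?F" for u
    unfolding tdeg_def by (rule sum.mono_neutral_left) (use that in \<open>auto simp: in_keys_iff\<close>)
  show ?thesis
    by (subst *[OF keys_add], subst *[of s], simp, subst *[of t], simp)
      (simp add: lookup_add sum.distrib)
qed

lemma tdeg_eq_0_iff: "tdeg t = 0 \<longleftrightarrow> t = 0"
  by (auto simp: tdeg_def in_keys_iff intro!: poly_mapping_eqI)

definition homogeneous :: "nat \<Rightarrow> 'k::field mpoly \<Rightarrow> bool"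
  where "homogeneous d p \<longleftrightarrow> (\<forall>t\<in>supp p. tdeg t = d)"

definition hcomp :: "nat \<Rightarrow> 'k::field mpoly \<Rightarrow> 'k mpoly"
  where "hcomp d = linear_ext (\<lambda>t. if tdeg t = d then monom_poly t else 0)"

lemma hcomp_sum: "hcomp d (sum f A) = (\<Sum>i\<in>A. hcomp d (f i))"
  by (simp add: hcomp_def linear_ext_sum)

lemma hcomp_0 [simp]: "hcomp d 0 = 0"
  by (simp add: hcomp_def)

lemma hcomp_mconst_mult: "hcomp d (mconst c * p) = mconst c * hcomp d p"
  by (simp add: hcomp_def linear_ext_mconst_mult)

lemma coef_hcomp: "coef (hcomp d p) t = (if tdeg t = d then coef p t else 0)"
proof -
  have "coef (hcomp d p) t = (\<Sum>s\<in>supp p. if s = t then (if tdeg t = d then coef p t else 0) else 0)"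
    unfolding hcomp_def linear_ext_def lookup_sum
    by (intro sum.cong) (auto simp: mconst_mult_monom_poly lookup_single when_def)
  then show ?thesis
    by (simp add: not_in_keys_iff_lookup_eq_zero)
qed

lemma homogeneous_hcomp: "homogeneous d (hcomp d p)"
  by (auto simp: homogeneous_def in_keys_iff coef_hcomp split: if_splits)

lemma hcomp_homogeneous: "homogeneous d p \<Longrightarrow> hcomp e p = (if e = d then p else 0)"
  by (intro poly_mapping_eqI) (auto simp: homogeneous_def coef_hcomp in_keys_iff)

lemma hcomp_polys [simp]: "p \<in> polys n \<Longrightarrow> hcomp d p \<in> polys n"
  by (auto simp: polys_def in_keys_iff coef_hcomp split: if_splits)

lemma homogeneous_0 [simp]: "homogeneous d 0"
  by (simp add: homogeneous_def)

lemma homogeneous_add: "homogeneous d p \<Longrightarrow> homogeneous d q \<Longrightarrow> homogeneous d (p + q)"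
  using keys_add[of p q] by (auto simp: homogeneous_def)

lemma homogeneous_sum: "(\<And>i. i \<in> A \<Longrightarrow> homogeneous d (f i)) \<Longrightarrow> homogeneous d (sum f A)"
  by (induction A rule: infinite_finite_induct) (simp_all add: homogeneous_add)

lemma homogeneous_mult: "homogeneous d p \<Longrightarrow> homogeneous e q \<Longrightarrow> homogeneous (d + e) (p * q)"
  using keys_mult[of p q] by (fastforce simp: homogeneous_def tdeg_add)

lemma homogeneous_mconst [simp]: "homogeneous 0 (mconst c)"
  by (auto simp: homogeneous_def mconst_def tdeg_eq_0_iff split: if_splits)

lemma homogeneous_1 [simp]: "homogeneous 0 1"
  using homogeneous_mconst[of 1] by (simp del: homogeneous_mconst)

lemma homogeneous_mconst_mult: "homogeneous d p \<Longrightarrow> homogeneous d (mconst c * p)"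
  using homogeneous_mult[OF homogeneous_mconst] by fastforce

lemma homogeneous_mvar [simp]: "homogeneous 1 (mvar i)"
  by (simp add: homogeneous_def mvar_def tdeg_def)

lemma homogeneous_power: "homogeneous d p \<Longrightarrow> homogeneous (m * d) (p ^ m)"
  by (induction m) (auto dest: homogeneous_mult)

lemma homogeneous_prod:
  "(\<And>i. i \<in> A \<Longrightarrow> homogeneous (d i) (f i)) \<Longrightarrow> homogeneous (sum d A) (prod f A)"
  by (induction A rule: infinite_finite_induct) (simp_all add: homogeneous_mult)

lemma homogeneous_unique: "homogeneous d p \<Longrightarrow> homogeneous e p \<Longrightarrow> p \<noteq> 0 \<Longrightarrow> d = e"
  using hcomp_homogeneous[of d p e] hcomp_homogeneous[of e p e] by (auto split: if_splits)

lemma homogeneous_0_imp_mconst: "homogeneous 0 p \<Longrightarrow> p = mconst (coef p 0)"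
  by (intro poly_mapping_eqI) (auto simp: coef_mconst homogeneous_def tdeg_eq_0_iff in_keys_iff)

lemma hcomp_decomposition:
  obtains N where "\<And>M. N \<le> M \<Longrightarrow> p = (\<Sum>d<M. hcomp d p)" "\<And>d. N \<le> d \<Longrightarrow> hcomp d p = 0"
proof
  let ?N = "Suc (Max (insert 0 (tdeg ` supp p)))"
  have N: "tdeg t < ?N" if "t \<in> supp p" for t
    using that by (auto simp: less_Suc_eq_le intro: Max_ge)
  show "p = (\<Sum>d<M. hcomp d p)" if "?N \<le> M" for M
  proof (rule poly_mapping_eqI)
    fix t
    show "coef p t = coef (\<Sum>d<M. hcomp d p) t"
      using N[of t] that by (cases "t \<in> supp p") (auto simp: lookup_sum coef_hcomp in_keys_iff)
  qed
  show "hcomp d p = 0" if "?N \<le> d" for d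
    using N that by (intro poly_mapping_eqI) (force simp: coef_hcomp in_keys_iff)
qed

lemma hcomp_mult_homogeneous:
  assumes "homogeneous e f"
  shows "hcomp d (f * p) = (if e \<le> d then f * hcomp (d - e) p else 0)"
proof -
  obtain N where N: "\<And>M. N \<le> M \<Longrightarrow> p = (\<Sum>d<M. hcomp d p)"
    using hcomp_decomposition by blast
  define M where "M = max N (Suc d)"
  have "hcomp d (f * p) = hcomp d (\<Sum>j<M. f * hcomp j p)"
    by (subst N[of M]) (simp_all add: M_def sum_distrib_left)
  also have "\<dots> = (\<Sum>j<M. if d = e + j then f * hcomp j p else 0)"
    unfolding hcomp_sum
    by (intro sum.cong refl hcomp_homogeneous homogeneous_mult assms homogeneous_hcomp)
  also have "\<dots> = (\<Sum>j<M. if j = d - e then (if e \<le> d then f * hcomp (d - e) p else 0) else 0)"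
    by (intro sum.cong) auto
  also have "\<dots> = (if e \<le> d then f * hcomp (d - e) p else 0)"
    by (auto simp: M_def)
  finally show ?thesis .
qed

text \<open>The product of the lowest (highest) components of \<open>f\<close> and \<open>g\<close> is the
  lowest (highest) component of \<open>f * g\<close>; for a homogeneous product they coincide.\<close>

lemma homogeneous_factor:
  assumes "homogeneous d (f * g)" "f * g \<noteq> 0"
  obtains e where "homogeneous e f" "e \<le> d"
proof -
  let ?I = "\<lambda>p. {i. hcomp i p \<noteq> 0}"
  have fin: "finite (?I p)" and ne: "p \<noteq> 0 \<Longrightarrow> ?I p \<noteq> {}" for p :: "'a mpoly"
  proof -
    obtain N where N: "\<And>M. N \<le> M \<Longrightarrow> p = (\<Sum>d<M. hcomp d p)" "\<And>d. N \<le> d \<Longrightarrow> hcomp d p = 0"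
      using hcomp_decomposition by blast
    have "?I p \<subseteq> {..<N}" using N(2) by (auto simp: not_less[symmetric])
    then show "finite (?I p)" by (rule finite_subset) simp
    show "?I p \<noteq> {}" if "p \<noteq> 0"
    proof
      assume "?I p = {}"
      then have "(\<Sum>d<N. hcomp d p) = 0" by simp
      then show False using N(1)[of N] that by simp
    qed
  qed
  have mult: "hcomp k (f * g) = (\<Sum>i\<in>?I f. if i \<le> k then hcomp i f * hcomp (k - i) g else 0)" for k
  proof -
    obtain N where N: "\<And>M. N \<le> M \<Longrightarrow> f = (\<Sum>d<M. hcomp d f)" "\<And>d. N \<le> d \<Longrightarrow> hcomp d f = 0"
      using hcomp_decomposition by blast
    have f: "f = (\<Sum>i\<in>?I f. hcomp i f)"
      by (subst N(1)[of N], simp, rule sum.mono_neutral_right)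
        (use N(2) in \<open>auto simp: not_less[symmetric]\<close>)
    have "hcomp k (f * g) = hcomp k (\<Sum>i\<in>?I f. hcomp i f * g)"
      by (subst f) (simp add: sum_distrib_right)
    then show ?thesis
      by (simp add: hcomp_sum hcomp_mult_homogeneous[OF homogeneous_hcomp])
  qed
  have fg: "f \<noteq> 0" "g \<noteq> 0" using assms by auto
  define a b A B where "a = Min (?I f)" and "b = Min (?I g)"
    and "A = Max (?I f)" and "B = Max (?I g)"
  note defs = a_def b_def A_def B_def
  have in_I: "a \<in> ?I f" "b \<in> ?I g" "A \<in> ?I f" "B \<in> ?I g"
    unfolding defs using Min_in[OF fin ne[OF fg(1)]] Min_in[OF fin ne[OF fg(2)]]
      Max_in[OF fin ne[OF fg(1)]] Max_in[OF fin ne[OF fg(2)]] by simp_all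
  have le: "i \<in> ?I f \<Longrightarrow> a \<le> i \<and> i \<le> A" "i \<in> ?I g \<Longrightarrow> b \<le> i \<and> i \<le> B" for i
    unfolding defs using fin by auto
  have extreme: "a + b = d" if ab: "a \<in> ?I f" "b \<in> ?I g"
    and only: "\<And>i j. i \<in> ?I f \<Longrightarrow> j \<in> ?I g \<Longrightarrow> i + j = a + b \<Longrightarrow> i = a" for a b
  proof -
    have "hcomp (a + b) (f * g) = (\<Sum>i\<in>?I f. if i = a then hcomp a f * hcomp b g else 0)"
      unfolding mult
    proof (rule sum.cong[OF refl])
      fix i assume i: "i \<in> ?I f"
      have "hcomp (a + b - i) g = 0" if "i \<noteq> a" "i \<le> a + b"
        using only[OF i, of "a + b - i"] that by auto
      then show "(if i \<le> a + b then hcomp i f * hcomp (a + b - i) g else 0) =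
          (if i = a then hcomp a f * hcomp b g else 0)" by auto
    qed
    then have "hcomp (a + b) (f * g) \<noteq> 0" using fin ab by simp
    then show ?thesis using hcomp_homogeneous[OF assms(1)] by (auto split: if_splits)
  qed
  have "a + b = d" using in_I(1,2) by (rule extreme) (use le in fastforce)
  moreover have "A + B = d" using in_I(3,4) by (rule extreme) (use le in fastforce)
  moreover have "a \<le> A" "b \<le> B" using le in_I by blast+
  ultimately have "a = A" by linarith
  have "f = hcomp a f"
  proof (rule poly_mapping_eqI)
    fix t
    show "coef f t = coef (hcomp a f) t"
    proof (cases "hcomp (tdeg t) f = 0")
      case True
      then show ?thesis by (metis coef_hcomp lookup_zero)
    next
      case False
      then have "tdeg t = a" using le(1)[of "tdeg t"] \<open>a = A\<close> by auto
      then show ?thesis by (simp add: coef_hcomp)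
    qed
  qed
  then have "homogeneous a f" by (metis homogeneous_hcomp)
  then show thesis using that \<open>a + b = d\<close> by (metis le_add1)
qed

section \<open>Linear forms and their prime ideals\<close>

definition eval_form :: "nat \<Rightarrow> (nat \<Rightarrow> 'k) \<Rightarrow> (nat \<Rightarrow> 'k mpoly) \<Rightarrow> 'k::field mpoly"
  where "eval_form n a v = (\<Sum>i<n. mconst (a i) * v i)"

abbreviation lin_form :: "nat \<Rightarrow> (nat \<Rightarrow> 'k) \<Rightarrow> 'k::field mpoly"
  where "lin_form n a \<equiv> eval_form n a mvar"

definition pairing :: "nat \<Rightarrow> (nat \<Rightarrow> 'k::field) \<Rightarrow> (nat \<Rightarrow> 'k) \<Rightarrow> 'k"
  where "pairing n a w = (\<Sum>i<n. a i * w i)"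

lemma eval_form_0 [simp]: "eval_form n a (\<lambda>i. 0) = 0"
  by (simp add: eval_form_def)

lemma eval_form_cong:
  "(\<And>i. i < n \<Longrightarrow> a i = b i) \<Longrightarrow> (\<And>i. i < n \<Longrightarrow> v i = w i) \<Longrightarrow> eval_form n a v = eval_form n b w"
  by (simp add: eval_form_def)

lemma eval_form_add: "eval_form n a (\<lambda>i. v i + w i) = eval_form n a v + eval_form n a w"
  by (simp add: eval_form_def ring_distribs sum.distrib)

lemma eval_form_mult: "eval_form n a (\<lambda>i. p * v i) = p * eval_form n a v"
  by (simp add: eval_form_def sum_distrib_left ac_simps)

lemma eval_form_sum: "eval_form n a (\<lambda>i. \<Sum>j\<in>J. f j i) = (\<Sum>j\<in>J. eval_form n a (f j))"
  by (induction J rule: infinite_finite_induct) (simp_all add: eval_form_add)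

lemma eval_form_comb:
  "eval_form n a (\<lambda>i. \<Sum>j\<in>J. c j * f j i) = (\<Sum>j\<in>J. c j * eval_form n a (f j))"
  by (simp add: eval_form_sum eval_form_mult)

lemma eval_form_const:
  "eval_form n a (\<lambda>i. mconst (w i) * q) = mconst (pairing n a w) * q"
  by (simp add: eval_form_def pairing_def mconst_sum mconst_mult sum_distrib_right mult.assoc)

lemma eval_form_form_add:
  "eval_form n (\<lambda>i. a i + b i) v = eval_form n a v + eval_form n b v"
  by (simp add: eval_form_def mconst_add ring_distribs sum.distrib)

lemma eval_form_form_scale: "eval_form n (\<lambda>i. c * a i) v = mconst c * eval_form n a v"
  by (simp add: eval_form_def mconst_mult sum_distrib_left mult.assoc)

lemma eval_form_form_comb:
  "eval_form n (\<lambda>i. \<Sum>j\<in>J. c j * a j i) v = (\<Sum>j\<in>J. mconst (c j) * eval_form n (a j) v)"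
  by (simp add: eval_form_def mconst_sum mconst_mult sum_distrib_left sum_distrib_right mult.assoc)
    (rule sum.swap)

lemma eval_form_polys [simp]: "(\<And>i. i < n \<Longrightarrow> v i \<in> polys m) \<Longrightarrow> eval_form n a v \<in> polys m"
  by (auto simp: eval_form_def intro!: polys_sum)

lemma homogeneous_eval_form:
  "(\<And>i. i < n \<Longrightarrow> homogeneous d (v i)) \<Longrightarrow> homogeneous d (eval_form n a v)"
  by (auto simp: eval_form_def intro!: homogeneous_sum homogeneous_mconst_mult)

lemma hcomp_eval_form: "hcomp d (eval_form n a v) = eval_form n a (\<lambda>i. hcomp d (v i))"
  by (simp add: eval_form_def hcomp_sum hcomp_mconst_mult)

lemma subst_eval_form: "subst s (eval_form n a v) = eval_form n a (\<lambda>i. subst s (v i))"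
  by (simp add: eval_form_def subst_sum subst_mult)

lemma subst_lin_form: "subst s (lin_form n a) = eval_form n a s"
  by (simp add: subst_eval_form)

lemma subst_lin_form_const: "subst (\<lambda>i. mconst (w i)) (lin_form n a) = mconst (pairing n a w)"
  using eval_form_const[of n a w 1] by (simp add: subst_lin_form)

lemma lin_form_nonzero: "pairing n a w \<noteq> 0 \<Longrightarrow> lin_form n a \<noteq> 0"
  using subst_lin_form_const[of w n a] by (metis mconst_eq_0_iff subst_0)

text \<open>A linear form \<open>\<alpha>\<close> with \<open>\<alpha>(w) = 1\<close> is prime: the substitution \<open>x \<mapsto> x - \<alpha> w\<close> is a ring
  homomorphism that changes polynomials by multiples of \<open>\<alpha>\<close> and kills \<open>\<alpha>\<close>, so its kernel
  is the ideal of \<open>\<alpha>\<close>, and the ring of polynomials has no zero divisors.\<close>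

lemma lin_form_prime:
  fixes a :: "nat \<Rightarrow> 'k::field"
  assumes w0: "pairing n a w \<noteq> 0"
  shows "prime_elem (lin_form n a)"
proof -
  let ?\<alpha> = "lin_form n a"
  define s where "s = (\<lambda>i. mvar i - mconst (w i / pairing n a w) * ?\<alpha>)"
  have "pairing n a (\<lambda>i. w i / pairing n a w) = 1"
    using w0 by (simp add: pairing_def flip: sum_divide_distrib)
  then have "eval_form n a (\<lambda>i. - mconst (w i / pairing n a w) * ?\<alpha>) = - ?\<alpha>"
    using eval_form_mult[of n a "-1"] eval_form_const[of n a "\<lambda>i. w i / pairing n a w" ?\<alpha>]
    by simp
  then have kill: "subst s ?\<alpha> = 0"
    using eval_form_add[of n a mvar "\<lambda>i. - mconst (w i / pairing n a w) * ?\<alpha>"]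
    by (simp add: subst_lin_form s_def)
  have cong: "?\<alpha> dvd p - subst s p" for p
  proof (induction p rule: mpoly_induct)
    case (mvar i)
    show ?case by (simp add: s_def)
  next
    case (add p q)
    have "p + q - subst s (p + q) = (p - subst s p) + (q - subst s q)"
      by (simp add: subst_add)
    then show ?case using dvd_add[OF add] by (simp only:)
  next
    case (mult p q)
    have "p * q - subst s (p * q) = p * (q - subst s q) + (p - subst s p) * subst s q"
      by (simp add: subst_mult algebra_simps)
    then show ?case using mult by simp
  qed simp
  have dvd_iff: "?\<alpha> dvd p \<longleftrightarrow> subst s p = 0" for p
  proof
    assume "?\<alpha> dvd p"
    then show "subst s p = 0" using subst_dvd[of ?\<alpha> p s] kill by simp
  next
    assume "subst s p = 0"
    then show "?\<alpha> dvd p" using cong[of p] by simp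
  qed
  show ?thesis
    unfolding prime_elem_def using lin_form_nonzero[OF w0] by (auto simp: dvd_iff subst_mult)
qed

lemma lin_form_not_dvd:
  assumes "pairing n a w = 0" "pairing n b w \<noteq> 0"
  shows "\<not> lin_form n a dvd lin_form n b"
proof
  assume "lin_form n a dvd lin_form n b"
  then show False
    using subst_dvd[of _ _ "\<lambda>i. mconst (w i)"] assms by (fastforce simp: subst_lin_form_const)
qed

section \<open>Divisors of products of prime powers\<close>

lemma prime_elem_not_dvd_prod:
  assumes "prime_elem p" "\<And>i. i \<in> I \<Longrightarrow> \<not> p dvd f i" shows "\<not> p dvd prod f I"
  using assms(2)
proof (induction I rule: infinite_finite_induct)
  case (insert i I)
  then show ?case using assms(1) by (auto dest: prime_elem_dvd_multD)
qed (use assms(1) in \<open>simp_all add: prime_elem_def\<close>)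

lemma dvd_cancel_prime_power:
  fixes p :: "'r::idom"
  assumes p: "prime_elem p" "\<not> p dvd u" and "u dvd p ^ N * W"
  shows "u dvd W"
  using assms(3)
proof (induction N)
  case (Suc N)
  then obtain h where h: "p ^ Suc N * W = u * h" by (auto simp: dvd_def)
  then have "p dvd u * h" by (metis dvd_triv_left mult.assoc power_Suc)
  then obtain h' where "h = p * h'" using p by (metis dvd_def prime_elem_dvd_multD)
  then have "p ^ N * W = u * h'" using h p by (auto simp: prime_elem_def ac_simps)
  then show ?case using Suc.IH by simp
qed simp

text \<open>The exponent of \<open>p\<close> in \<open>u\<close> is at most \<open>m\<close>, by the second divisibility.\<close>

lemma dvd_lower_prime_exponent:
  fixes p :: "'r::idom"
  assumes p: "prime_elem p" and "u dvd p ^ N * W" "u dvd p ^ m * G" "\<not> p dvd G"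
  shows "u dvd p ^ m * W"
  using assms(2,3)
proof (induction N arbitrary: u m)
  case (Suc N)
  show ?case
  proof (cases "p dvd u")
    case True
    then obtain u' where u: "u = p * u'" by (auto simp: dvd_def)
    show ?thesis
    proof (cases m)
      case 0
      then show ?thesis using Suc.prems True assms(4) by (auto dest: dvd_trans)
    next
      case m: (Suc m')
      have "u' dvd p ^ N * W" "u' dvd p ^ m' * G"
        using Suc.prems p unfolding u m by (auto simp: prime_elem_def mult.assoc)
      then have "u' dvd p ^ m' * W" by (rule Suc.IH)
      then show ?thesis unfolding u m by (simp add: mult.assoc)
    qed
  next
    case False
    then show ?thesis using dvd_cancel_prime_power[OF p False Suc.prems(1)] by simp
  qed
qed simp

lemma dvd_lower_prime_exponents:
  fixes \<alpha> :: "'h \<Rightarrow> 'r::idom"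
  assumes "finite F" and "u dvd (\<Prod>H\<in>F. \<alpha> H ^ N H) * W"
    and "\<And>H. H \<in> F \<Longrightarrow> prime_elem (\<alpha> H)"
    and "\<And>H. H \<in> F \<Longrightarrow> \<exists>G. u dvd \<alpha> H ^ m H * G \<and> \<not> \<alpha> H dvd G"
  shows "u dvd (\<Prod>H\<in>F. \<alpha> H ^ m H) * W"
  using assms
proof (induction F arbitrary: W)
  case (insert H F)
  obtain G where "u dvd \<alpha> H ^ m H * G" "\<not> \<alpha> H dvd G" using insert.prems by blast
  moreover have "u dvd \<alpha> H ^ N H * ((\<Prod>H\<in>F. \<alpha> H ^ N H) * W)"
    using insert by (simp add: mult.assoc)
  ultimately have "u dvd \<alpha> H ^ m H * ((\<Prod>H\<in>F. \<alpha> H ^ N H) * W)"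
    using insert.prems(2) by (blast intro: dvd_lower_prime_exponent)
  then have "u dvd (\<Prod>H\<in>F. \<alpha> H ^ N H) * (\<alpha> H ^ m H * W)"
    by (simp add: ac_simps)
  then have "u dvd (\<Prod>H\<in>F. \<alpha> H ^ m H) * (\<alpha> H ^ m H * W)"
    by (rule insert.IH) (use insert.prems in auto)
  then show ?case using insert by (simp add: ac_simps)
qed simp

section \<open>Derivations as vectors of polynomials\<close>

definition poly_vecs :: "nat \<Rightarrow> (nat \<Rightarrow> 'k::field mpoly) set"
  where "poly_vecs n = {v. (\<forall>i. v i \<in> polys n) \<and> (\<forall>i\<ge>n. v i = 0)}"

text \<open>If the variable does not occur in \<open>t\<close>, the truncated difference of the exponents is harmless,
  as its coefficient vanishes.\<close>

definition partial_monom :: "nat \<Rightarrow> (nat \<Rightarrow>\<^sub>0 nat) \<Rightarrow> 'k::field mpoly"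
  where "partial_monom i t = of_nat (expo t i) * monom_poly (t - Poly_Mapping.single i 1)"

definition der_of :: "nat \<Rightarrow> (nat \<Rightarrow> 'k mpoly) \<Rightarrow> 'k::field mpoly \<Rightarrow> 'k mpoly"
  where "der_of n v p =
    (if p \<in> polys n then linear_ext (\<lambda>t. \<Sum>i<n. partial_monom i t * v i) p else 0)"

lemma partial_monom_add:
  "partial_monom i (s + t) = monom_poly s * partial_monom i t + monom_poly t * partial_monom i s"
proof -
  have *: "of_nat (expo s i) * monom_poly (s + t - Poly_Mapping.single i 1) =
      monom_poly t * partial_monom i s" for s t
  proof (cases "expo s i = 0")
    case False
    then have "s + t - Poly_Mapping.single i 1 = t + (s - Poly_Mapping.single i 1)"
      by (intro poly_mapping_eqI) (auto simp: lookup_add lookup_minus lookup_single when_def)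
    then show ?thesis by (simp add: partial_monom_def monom_poly_add)
  qed (simp add: partial_monom_def)
  have "partial_monom i (s + t) = of_nat (expo s i) * monom_poly (s + t - Poly_Mapping.single i 1)
      + of_nat (expo t i) * monom_poly (t + s - Poly_Mapping.single i 1)"
    by (simp only: partial_monom_def lookup_add of_nat_add ring_distribs add.commute[of t s])
  then show ?thesis by (simp only: *) (simp only: add.commute)
qed

lemma monom_poly_in_polys_iff: "monom_poly t \<in> polys n \<longleftrightarrow> Poly_Mapping.keys t \<subseteq> {..<n}"
  by (simp add: polys_def monom_poly_def)

lemma der_of_derivation:
  assumes "v \<in> poly_vecs n" shows "der_of n v \<in> derivations n"
proof -
  have v: "v i \<in> polys n" for i using assms by (simp add: poly_vecs_def)
  let ?D = "linear_ext (\<lambda>t. \<Sum>i<n. partial_monom i t * v i)"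
  have 1: "?D p \<in> polys n" if "p \<in> polys n" for p
    unfolding linear_ext_def
  proof (intro polys_sum polys_mult polys_mconst v)
    fix t i assume t: "t \<in> supp p"
    have "Poly_Mapping.keys (t - Poly_Mapping.single i 1) \<subseteq> Poly_Mapping.keys t"
      by (auto simp: in_keys_iff lookup_minus)
    moreover have "Poly_Mapping.keys t \<subseteq> {..<n}" using that t by (simp add: polys_def)
    ultimately show "partial_monom i t \<in> polys n"
      unfolding partial_monom_def
      by (intro polys_mult) (auto simp: monom_poly_in_polys_iff simp flip: mconst_of_nat)
  qed
  have leibniz: "?D (p * q) = p * ?D q + q * ?D p" for p q
  proof -
    have "?D (p * q) = linear_ext monom_poly p * ?D q + linear_ext monom_poly q * ?D p"
    proof -
      let ?g = "\<lambda>t. \<Sum>i<n. partial_monom i t * v i"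
      have "?g (s + t) = monom_poly s * ?g t + monom_poly t * ?g s" for s t
        by (simp add: partial_monom_add ring_distribs sum.distrib sum_distrib_left ac_simps)
      then have "?D (p * q) =
          (\<Sum>s\<in>supp p. \<Sum>t\<in>supp q. (mconst (coef p s) * monom_poly s) * (mconst (coef q t) * ?g t)
            + (mconst (coef q t) * monom_poly t) * (mconst (coef p s) * ?g s))"
        unfolding linear_ext_mult by (simp add: ring_distribs ac_simps)
      also have "\<dots> = (\<Sum>s\<in>supp p. \<Sum>t\<in>supp q. (mconst (coef p s) * monom_poly s) * (mconst (coef q t) * ?g t))
          + (\<Sum>t\<in>supp q. \<Sum>s\<in>supp p. (mconst (coef q t) * monom_poly t) * (mconst (coef p s) * ?g s))"
        by (simp only: sum.distrib) (simp only: sum.swap[of _ "supp q" "supp p"])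
      finally show ?thesis by (simp only: linear_ext_def sum_product)
    qed
    then show ?thesis by (simp only: poly_eq_linear_ext)
  qed
  show ?thesis
    unfolding derivations_def
    by (auto simp: der_of_def linear_ext_add linear_ext_mconst_mult 1 intro: leibniz)
qed

lemma der_of_mvar:
  assumes "i < n" shows "der_of n v (mvar i) = v i"
proof -
  have "partial_monom j (Poly_Mapping.single i 1) * v j = (if j = i then v i else 0)" for j
    by (simp add: partial_monom_def lookup_single when_def)
  then show ?thesis
    using assms by (simp add: der_of_def)
      (simp add: mvar_def linear_ext_single flip: One_nat_def)
qed

lemma derivation_mconst:
  assumes "\<theta> \<in> derivations n" shows "\<theta> (mconst c) = 0"
proof -
  have "\<theta> (1 * 1) = 1 * \<theta> 1 + 1 * \<theta> 1"
    using assms polys_1[of n] unfolding derivations_def by blast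
  then have "\<theta> 1 + \<theta> 1 = \<theta> 1" by (simp only: mult_1)
  then have "\<theta> 1 = 0" by (simp only: add_cancel_left_right)
  moreover have "\<theta> (mconst c * 1) = mconst c * \<theta> 1"
    using assms polys_1[of n] unfolding derivations_def by blast
  ultimately show ?thesis by simp
qed

lemma derivation_eqI:
  assumes "\<theta> \<in> derivations n" "\<eta> \<in> derivations n" "\<And>i. i < n \<Longrightarrow> \<theta> (mvar i) = \<eta> (mvar i)"
  shows "\<theta> = \<eta>"
proof
  fix p
  show "\<theta> p = \<eta> p"
  proof (cases "p \<in> polys n")
    case True
    then show ?thesis
    proof (induction rule: polys_induct)
      case (mconst c)
      then show ?case using assms by (simp add: derivation_mconst)
    next
      case (mult p q)
      then show ?case using assms(1,2) unfolding derivations_def by simp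
    next
      case (add p q)
      then show ?case using assms(1,2) unfolding derivations_def by simp
    qed (use assms in simp)
  next
    case False
    then show ?thesis using assms(1,2) by (simp add: derivations_def)
  qed
qed

definition vec_of :: "nat \<Rightarrow> ('k mpoly \<Rightarrow> 'k mpoly) \<Rightarrow> nat \<Rightarrow> 'k::field mpoly"
  where "vec_of n \<theta> = (\<lambda>i. if i < n then \<theta> (mvar i) else 0)"

lemma vec_of_in_poly_vecs: "\<theta> \<in> derivations n \<Longrightarrow> vec_of n \<theta> \<in> poly_vecs n"
  by (auto simp: vec_of_def poly_vecs_def derivations_def)

lemma vec_of_der_of: "v \<in> poly_vecs n \<Longrightarrow> vec_of n (der_of n v) = v"
  by (auto simp: vec_of_def poly_vecs_def der_of_mvar)

lemma der_of_vec_of: "\<theta> \<in> derivations n \<Longrightarrow> der_of n (vec_of n \<theta>) = \<theta>"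
  by (rule derivation_eqI[of _ n]) (simp_all add: der_of_derivation vec_of_in_poly_vecs der_of_mvar, simp add: vec_of_def)

lemma der_of_comb:
  "der_of n (\<lambda>i. \<Sum>j\<in>J. c j * f j i) p = (\<Sum>j\<in>J. c j * der_of n (f j) p)"
proof -
  let ?h = "\<lambda>j i t. mconst (coef p t) * (partial_monom i t * (c j * f j i))"
  have "(\<Sum>t\<in>supp p. \<Sum>i<n. \<Sum>j\<in>J. ?h j i t) = (\<Sum>j\<in>J. \<Sum>t\<in>supp p. \<Sum>i<n. ?h j i t)"
    by (simp only: sum.swap[of _ "{..<n}" J] sum.swap[of _ "supp p" J])
  then show ?thesis
    by (simp add: der_of_def linear_ext_def sum_distrib_left ac_simps)
qed

lemma derivation_eval_form:
  assumes "\<theta> \<in> derivations n" shows "\<theta> (lin_form n a) = eval_form n a (vec_of n \<theta>)"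
proof -
  have 0: "\<theta> 0 = 0" using derivation_mconst[OF assms, of 0] by simp
  have "\<theta> (\<Sum>i\<in>I. mconst (a i) * mvar i) = (\<Sum>i\<in>I. mconst (a i) * \<theta> (mvar i))"
    if "finite I" "I \<subseteq> {..<n}" for I
    using that
  proof (induction I)
    case (insert i I)
    have "mconst (a i) * mvar i \<in> polys n" "(\<Sum>i\<in>I. mconst (a i) * mvar i) \<in> polys n" "mvar i \<in> polys n"
      using insert.prems by (auto intro!: polys_sum)
    then have "\<theta> (mconst (a i) * mvar i + (\<Sum>i\<in>I. mconst (a i) * mvar i)) =
        mconst (a i) * \<theta> (mvar i) + \<theta> (\<Sum>i\<in>I. mconst (a i) * mvar i)"
      using assms unfolding derivations_def by force
    then show ?case using insert by simp
  qed (simp add: 0)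
  then show ?thesis by (simp add: eval_form_def vec_of_def)
qed

text \<open>The logarithmic derivations of the multiarrangement of the hyperplanes with equations
  \<open>a H\<close>, as vectors of their values at the variables.\<close>

definition log_vecs :: "nat \<Rightarrow> 'h set \<Rightarrow> ('h \<Rightarrow> nat \<Rightarrow> 'k) \<Rightarrow> ('h \<Rightarrow> nat)
    \<Rightarrow> (nat \<Rightarrow> 'k::field mpoly) set"
  where "log_vecs n A a m =
    {v \<in> poly_vecs n. \<forall>H\<in>A. lin_form n (a H) ^ m H dvd eval_form n (a H) v}"

lemma log_derivations_eq:
  "log_derivations s V bs \<A> m = der_of (length bs) `
    log_vecs (length bs) \<A> (\<lambda>H i. defining_form s V H (bs ! i)) m"
proof -
  let ?n = "length bs" and ?a = "\<lambda>H i. defining_form s V H (bs ! i)"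
  have fp: "form_poly bs (defining_form s V H) = lin_form ?n (?a H)" for H
    by (simp add: form_poly_def eval_form_def)
  have iff: "(\<exists>q\<in>polys ?n. \<theta> (lin_form ?n (?a H)) = q * lin_form ?n (?a H) ^ m H) \<longleftrightarrow>
      lin_form ?n (?a H) ^ m H dvd eval_form ?n (?a H) (vec_of ?n \<theta>)"
    if "\<theta> \<in> derivations ?n" for \<theta> H
  proof
    assume "lin_form ?n (?a H) ^ m H dvd eval_form ?n (?a H) (vec_of ?n \<theta>)"
    then show "\<exists>q\<in>polys ?n. \<theta> (lin_form ?n (?a H)) = q * lin_form ?n (?a H) ^ m H"
      unfolding derivation_eval_form[OF that]
      by (intro dvd_in_polys)
        (use vec_of_in_poly_vecs[OF that] in \<open>auto simp: poly_vecs_def\<close>)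
  qed (auto simp: derivation_eval_form[OF that])
  show ?thesis
  proof (intro equalityI subsetI)
    fix \<theta> assume "\<theta> \<in> log_derivations s V bs \<A> m"
    then have "\<theta> \<in> derivations ?n" "vec_of ?n \<theta> \<in> log_vecs ?n \<A> ?a m"
      by (auto simp: log_derivations_def log_vecs_def vec_of_in_poly_vecs iff fp)
    then show "\<theta> \<in> der_of ?n ` log_vecs ?n \<A> ?a m"
      by (metis der_of_vec_of image_eqI)
  next
    fix \<theta> assume "\<theta> \<in> der_of ?n ` log_vecs ?n \<A> ?a m"
    then obtain v where v: "\<theta> = der_of ?n v" "v \<in> log_vecs ?n \<A> ?a m" by blast
    then have "v \<in> poly_vecs ?n" by (simp add: log_vecs_def)
    then show "\<theta> \<in> log_derivations s V bs \<A> m"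
      using v der_of_derivation[of v ?n] vec_of_der_of[of v ?n]
      by (auto simp: log_derivations_def log_vecs_def iff fp)
  qed
qed

section \<open>Determinants of matrices given by functions\<close>

lemma matrix_sum_assoc:
  "(\<Sum>k\<in>K. (\<Sum>l\<in>L. c l * T l k) * B k) = (\<Sum>l\<in>L. c l * (\<Sum>k\<in>K. T l k * B k :: 'r::comm_ring_1))"
  unfolding sum_distrib_left sum_distrib_right mult.assoc by (rule sum.swap)

definition fdet :: "nat \<Rightarrow> (nat \<Rightarrow> nat \<Rightarrow> 'r) \<Rightarrow> 'r::comm_ring_1"
  where "fdet n T = det (mat n n (\<lambda>(j, i). T j i))"

lemma fdet_cong: "(\<And>j i. j < n \<Longrightarrow> i < n \<Longrightarrow> S j i = T j i) \<Longrightarrow> fdet n S = fdet n T"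
  unfolding fdet_def by (rule arg_cong[where f = det], rule eq_matI) auto

lemma fdet_leibniz:
  "fdet n T = (\<Sum>p | p permutes {0..<n}. of_int (sign p) * (\<Prod>j\<in>{0..<n}. T j (p j)))"
proof -
  have "T j (p j) = mat n n (\<lambda>(j, i). T j i) $$ (j, p j)" if "p permutes {0..<n}" "j < n" for p j
    using that permutes_in_image[OF that(1), of j] by simp
  then show ?thesis
    unfolding fdet_def by (subst det_def'[of _ n]) (auto intro!: sum.cong prod.cong)
qed

lemma fdet_mult: "fdet n (\<lambda>j i. \<Sum>k<n. S j k * T k i) = fdet n S * fdet n T"
proof -
  have "mat n n (\<lambda>(j, i). \<Sum>k<n. S j k * T k i) =
      mat n n (\<lambda>(j, i). S j i) * mat n n (\<lambda>(j, i). T j i)"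
    by (rule eq_matI) (auto simp: scalar_prod_def lessThan_atLeast0)
  then show ?thesis
    unfolding fdet_def by (simp add: det_mult[of _ n])
qed

lemma fdet_scalar: "fdet n (\<lambda>j i. if j = i then c else 0) = c ^ n"
proof -
  have "mat n n (\<lambda>(j, i). if j = i then c else 0) = c \<cdot>\<^sub>m 1\<^sub>m n"
    by (rule eq_matI) auto
  then show ?thesis unfolding fdet_def by simp
qed

lemma fdet_rows_mult: "fdet n (\<lambda>j i. c j * T j i) = (\<Prod>j\<in>{0..<n}. c j) * fdet n T"
  unfolding fdet_leibniz sum_distrib_left by (rule sum.cong) (simp_all add: prod.distrib ac_simps)

lemma fdet_adjugate:
  obtains B where "\<And>j i. j < n \<Longrightarrow> i < n \<Longrightarrow>
      (\<Sum>k<n. T j k * B k i) = (if j = i then fdet n T else 0)"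
    and "\<And>j i. j < n \<Longrightarrow> i < n \<Longrightarrow>
      (\<Sum>k<n. B j k * T k i) = (if j = i then fdet n T else 0)"
proof -
  define M where "M = mat n n (\<lambda>(j, i). T j i)"
  have M: "M \<in> carrier_mat n n" by (simp add: M_def)
  note adj = adj_mat[OF M]
  define B where "B = (\<lambda>j i. adj_mat M $$ (j, i))"
  show thesis
  proof (rule that[of B])
    fix j i assume ji: "j < n" "i < n"
    have "(M * adj_mat M) $$ (j, i) = (\<Sum>k<n. T j k * B k i)"
      using ji adj(1) by (simp add: M_def B_def scalar_prod_def lessThan_atLeast0)
    then show "(\<Sum>k<n. T j k * B k i) = (if j = i then fdet n T else 0)"
      using ji unfolding adj(2) by (auto simp: fdet_def M_def)
    have "(adj_mat M * M) $$ (j, i) = (\<Sum>k<n. B j k * T k i)"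
      using ji adj(1) by (simp add: M_def B_def scalar_prod_def lessThan_atLeast0)
    then show "(\<Sum>k<n. B j k * T k i) = (if j = i then fdet n T else 0)"
      using ji unfolding adj(3) by (auto simp: fdet_def M_def)
  qed
qed

lemma fdet_row_sums:
  assumes "finite S"
  shows "fdet n (\<lambda>j i. \<Sum>s\<in>S. a j s i) =
    (\<Sum>f | (\<forall>j\<in>{0..<n}. f j \<in> S) \<and> (\<forall>j. j \<notin> {0..<n} \<longrightarrow> f j = j). fdet n (\<lambda>j. a j (f j)))"
proof -
  let ?a = "\<lambda>j s. vec n (a j s)"
  have "mat n n (\<lambda>(j, i). \<Sum>s\<in>S. a j s i) = mat\<^sub>r n n (\<lambda>j. finsum_vec TYPE('a) n (?a j) S)"
    by (rule eq_matI) (auto simp: index_finsum_vec assms)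
  moreover have "mat n n (\<lambda>(j, i). a j (f j) i) = mat\<^sub>r n n (\<lambda>j. ?a j (f j))" for f
    by (rule eq_matI) auto
  ultimately show ?thesis
    unfolding fdet_def using det_linear_rows_sum[OF assms, of ?a n] by simp
qed

text \<open>A product \<open>A \<Theta>\<close> of rectangular matrices that is a nonzero multiple of the identity
  matrix needs \<open>\<Theta>\<close> to have nonzero entries in pairwise different rows, one in each column:
  the determinant of the product is a combination of the products of such entries. The lemma serves
  for comparing ranks as well as for finding basis elements of large degree.\<close>

lemma nonzero_transversal:
  fixes A \<Theta> :: "nat \<Rightarrow> nat \<Rightarrow> 'r::idom"
  assumes prod: "\<And>s t. s < r \<Longrightarrow> t < r \<Longrightarrow> (\<Sum>i<n. A s i * \<Theta> i t) = (if s = t then Q else 0)"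
    and "Q \<noteq> 0"
  obtains f where "inj_on f {..<r}" "\<And>t. t < r \<Longrightarrow> f t < n" "\<And>t. t < r \<Longrightarrow> \<Theta> (f t) t \<noteq> 0"
proof -
  have "Q ^ r = fdet r (\<lambda>t s. if t = s then Q else 0)" by (simp add: fdet_scalar)
  also have "\<dots> = fdet r (\<lambda>t s. \<Sum>i<n. \<Theta> i t * A s i)"
    by (rule fdet_cong) (simp add: prod mult.commute)
  also have "\<dots> = (\<Sum>f | (\<forall>t\<in>{0..<r}. f t \<in> {..<n}) \<and> (\<forall>t. t \<notin> {0..<r} \<longrightarrow> f t = t).
      fdet r (\<lambda>t s. \<Theta> (f t) t * A s (f t)))"
    by (rule fdet_row_sums) simp
  finally have "(\<Sum>f | (\<forall>t\<in>{0..<r}. f t \<in> {..<n}) \<and> (\<forall>t. t \<notin> {0..<r} \<longrightarrow> f t = t).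
      fdet r (\<lambda>t s. \<Theta> (f t) t * A s (f t))) \<noteq> 0"
    using \<open>Q \<noteq> 0\<close> by (metis power_not_zero)
  then obtain f where f: "\<And>t. t < r \<Longrightarrow> f t < n"
    and ne: "fdet r (\<lambda>t s. \<Theta> (f t) t * A s (f t)) \<noteq> 0"
    by (elim sum.not_neutral_contains_not_neutral) (rule that; simp)
  have ne': "(\<Prod>t\<in>{0..<r}. \<Theta> (f t) t) \<noteq> 0" "fdet r (\<lambda>t s. A s (f t)) \<noteq> 0"
    using ne unfolding fdet_rows_mult by auto
  show thesis
  proof
    show "inj_on f {..<r}"
    proof (rule inj_onI, rule ccontr)
      fix t u assume tu: "t \<in> {..<r}" "u \<in> {..<r}" "f t = f u" "t \<noteq> u"
      have "fdet r (\<lambda>t s. A s (f t)) = 0"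
        unfolding fdet_def
        by (rule det_identical_rows[of _ r t u]) (use tu in \<open>auto intro!: eq_vecI\<close>)
      with ne'(2) show False by simp
    qed
    show "\<Theta> (f t) t \<noteq> 0" if "t < r" for t
      using ne'(1) that by auto
  qed (rule f)
qed

section \<open>Bases of modules of vectors\<close>

text \<open>Coefficients range over all polynomials here. By retraction to \<open>polys n\<close>, this is
  equivalent to coefficients in \<open>polys n\<close> as long as all vectors have entries in \<open>polys n\<close>.\<close>

definition vec_basis :: "nat \<Rightarrow> (nat \<Rightarrow> 'r) set \<Rightarrow> (nat \<Rightarrow> nat \<Rightarrow> 'r::idom) \<Rightarrow> bool"
  where "vec_basis n M \<theta> \<longleftrightarrow> (\<forall>j<n. \<theta> j \<in> M) \<and>
    (\<forall>v\<in>M. \<exists>c. v = (\<lambda>i. \<Sum>j<n. c j * \<theta> j i)) \<and>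
    (\<forall>c. (\<forall>i. (\<Sum>j<n. c j * \<theta> j i) = 0) \<longrightarrow> (\<forall>j<n. c j = 0))"

lemma free_module_if_vec_basis:
  assumes "vec_basis n M \<theta>" "M \<subseteq> poly_vecs n"
  shows "free_module (polys n) (der_of n ` M)"
proof -
  have \<theta>: "\<And>j. j < n \<Longrightarrow> \<theta> j \<in> M" "\<And>v. v \<in> M \<Longrightarrow> \<exists>c. v = (\<lambda>i. \<Sum>j<n. c j * \<theta> j i)"
    "\<And>c j. (\<And>i. (\<Sum>j<n. c j * \<theta> j i) = 0) \<Longrightarrow> j < n \<Longrightarrow> c j = 0"
    using assms(1) by (auto simp: vec_basis_def)
  have \<theta>': "\<theta> j \<in> poly_vecs n" if "j < n" for j using \<theta>(1)[OF that] assms(2) by blast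
  let ?D = "\<lambda>j. der_of n (\<theta> j)"
  define E where "E = ?D ` {..<n}"
  have unique: "c j = c' j"
    if eq: "\<And>i. (\<Sum>j<n. c j * \<theta> j i) = (\<Sum>j<n. c' j * \<theta> j i)" and "j < n" for c c' j
  proof -
    have "(\<Sum>j<n. (c j - c' j) * \<theta> j i) = 0" for i
      using eq[of i] by (simp add: left_diff_distrib sum_subtractf)
    from \<theta>(3)[OF this \<open>j < n\<close>] show ?thesis by simp
  qed
  have inj: "inj_on ?D {..<n}"
  proof (rule inj_onI)
    fix j k assume jk: "j \<in> {..<n}" "k \<in> {..<n}" "?D j = ?D k"
    then have "\<theta> j = \<theta> k" using \<theta>' by (metis vec_of_der_of lessThan_iff)
    then have "(\<Sum>l<n. (if l = j then 1 else 0) * \<theta> l i) =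
        (\<Sum>l<n. (if l = k then 1 else 0) * \<theta> l i)" for i
      using jk by (simp add: if_distrib[of "\<lambda>x. x * _"] cong: if_cong)
    from unique[OF this, of j] jk show "j = k" by (auto split: if_splits)
  qed
  have sum_E: "(\<Sum>e | c e \<noteq> 0. c e * e p) = (\<Sum>j<n. c (?D j) * ?D j p)"
    if "{e. c e \<noteq> 0} \<subseteq> E" for c p
  proof -
    have "(\<Sum>e | c e \<noteq> 0. c e * e p) = (\<Sum>e\<in>E. c e * e p)"
      by (rule sum.mono_neutral_left) (use that in \<open>auto simp: E_def\<close>)
    then show ?thesis unfolding E_def by (simp add: sum.reindex[OF inj] o_def)
  qed
  show ?thesis
    unfolding free_module_def
  proof (intro exI[of _ E] conjI ballI)
    show "E \<subseteq> der_of n ` M" using \<theta>(1) by (auto simp: E_def)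
    fix \<eta> assume "\<eta> \<in> der_of n ` M"
    then obtain v where v: "v \<in> M" and \<eta>: "\<eta> = der_of n v" by blast
    obtain c0 where c0: "v = (\<lambda>i. \<Sum>j<n. c0 j * \<theta> j i)" using \<theta>(2)[OF v] by blast
    have "v i = (\<Sum>j<n. retract n (c0 j) * \<theta> j i)" for i
    proof -
      have "v i \<in> polys n" using v assms(2) by (auto simp: poly_vecs_def)
      then have "v i = retract n (v i)" by simp
      also have "\<dots> = (\<Sum>j<n. retract n (c0 j) * retract n (\<theta> j i))"
        by (simp add: c0 retract_sum retract_mult)
      also have "\<dots> = (\<Sum>j<n. retract n (c0 j) * \<theta> j i)"
        using \<theta>' by (intro sum.cong) (auto simp: poly_vecs_def)
      finally show ?thesis .
    qed
    then have "v = (\<lambda>i. \<Sum>j<n. retract n (c0 j) * \<theta> j i)" by (rule ext)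
    then obtain c where c: "v = (\<lambda>i. \<Sum>j<n. c j * \<theta> j i)" "\<And>j. c j \<in> polys n"
      by (rule that[of "\<lambda>j. retract n (c0 j)"]) simp
    define C where "C = (\<lambda>e. if e \<in> E then c (the_inv_into {..<n} ?D e) else 0)"
    have C: "C (?D j) = c j" if "j < n" for j
      using that by (simp add: C_def E_def the_inv_into_f_f[OF inj])
    show "\<exists>!C. (\<forall>e. C e \<in> polys n) \<and> finite {e. C e \<noteq> 0} \<and> {e. C e \<noteq> 0} \<subseteq> E \<and>
        \<eta> = (\<lambda>p. \<Sum>e | C e \<noteq> 0. C e * e p)"
    proof (rule ex1I[of _ C])
      have "{e. C e \<noteq> 0} \<subseteq> E" by (auto simp: C_def)
      moreover from this have "finite {e. C e \<noteq> 0}"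
        by (rule finite_subset) (simp add: E_def)
      moreover have "\<eta> p = (\<Sum>e | C e \<noteq> 0. C e * e p)" for p
        unfolding sum_E[OF \<open>{e. C e \<noteq> 0} \<subseteq> E\<close>] by (simp add: \<eta> c(1) der_of_comb C)
      ultimately show "(\<forall>e. C e \<in> polys n) \<and> finite {e. C e \<noteq> 0} \<and> {e. C e \<noteq> 0} \<subseteq> E \<and>
          \<eta> = (\<lambda>p. \<Sum>e | C e \<noteq> 0. C e * e p)"
        using c(2) by (auto simp: C_def)
    next
      fix C' assume C': "(\<forall>e. C' e \<in> polys n) \<and> finite {e. C' e \<noteq> 0} \<and> {e. C' e \<noteq> 0} \<subseteq> E \<and>
        \<eta> = (\<lambda>p. \<Sum>e | C' e \<noteq> 0. C' e * e p)"
      then have \<eta>': "\<eta> p = (\<Sum>j<n. C' (?D j) * ?D j p)" for p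
        using sum_E by simp
      have "(\<Sum>j<n. c j * \<theta> j i) = (\<Sum>j<n. C' (?D j) * \<theta> j i)" for i
      proof (cases "i < n")
        case True
        then show ?thesis using \<eta>'[of "mvar i"] c(1) \<eta> by (simp add: der_of_mvar)
      next
        case False
        then show ?thesis using \<theta>' by (simp add: poly_vecs_def)
      qed
      then have *: "c j = C' (?D j)" if "j < n" for j by (rule unique) (rule that)
      show "C' = C"
      proof
        fix e
        show "C' e = C e"
        proof (cases "e \<in> E")
          case True
          then obtain j where "j < n" "e = ?D j" by (auto simp: E_def)
          then show ?thesis using * C by simp
        next
          case False
          then show ?thesis using C' by (auto simp: C_def)
        qed
      qed
    qed
  qed
qed

text \<open>Conversely, a basis has exactly \<open>n\<close> elements if the module contains \<open>Q\<close> times every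
  unit vector: expressing these multiples by the basis, and \<open>Q\<close> times the basis by them, gives
  matrices whose products in both orders are \<open>Q\<close> times the identity.\<close>

lemma vec_basis_if_free_module:
  fixes M :: "(nat \<Rightarrow> 'k::field mpoly) set"
  assumes M: "M \<subseteq> poly_vecs n"
    and scale: "\<And>p v. p \<in> polys n \<Longrightarrow> v \<in> M \<Longrightarrow> (\<lambda>i. p * v i) \<in> M"
    and Q: "Q \<in> polys n" "Q \<noteq> 0" "\<And>i. i < n \<Longrightarrow> (\<lambda>j. if j = i then Q else 0) \<in> M"
    and free: "free_module (polys n) (der_of n ` M)"
  obtains \<theta> where "vec_basis n M \<theta>"
proof -
  obtain E where E: "E \<subseteq> der_of n ` M" and ex1: "\<forall>\<theta> \<in> der_of n ` M.
      \<exists>!c. (\<forall>e. c e \<in> polys n) \<and> finite {e. c e \<noteq> 0} \<and> {e. c e \<noteq> 0} \<subseteq> E \<and>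
        \<theta> = (\<lambda>p. \<Sum>e | c e \<noteq> 0. c e * e p)"
    using free unfolding free_module_def by (elim exE conjE) (rule that)
  define V where "V = (vec_of n :: _ \<Rightarrow> nat \<Rightarrow> 'k mpoly)"
  have V: "V e \<in> M" "der_of n (V e) = e" if "e \<in> E" for e
    using E that M by (auto simp: V_def vec_of_der_of subset_iff)
  have V0: "V e i = 0" if "i \<ge> n" for e i
    using that by (simp add: V_def vec_of_def)
  define expr where "expr v c \<longleftrightarrow> (\<forall>e. c e \<in> polys n) \<and> finite {e. c e \<noteq> 0} \<and>
      {e. c e \<noteq> 0} \<subseteq> E \<and> v = (\<lambda>i. \<Sum>e | c e \<noteq> 0. c e * V e i)" for v c
  have expr_iff: "expr v c \<longleftrightarrow> (\<forall>e. c e \<in> polys n) \<and> finite {e. c e \<noteq> 0} \<and> {e. c e \<noteq> 0} \<subseteq> E \<and>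
        der_of n v = (\<lambda>p. \<Sum>e | c e \<noteq> 0. c e * e p)" if "v \<in> M" for v c
  proof -
    have "v = (\<lambda>i. \<Sum>e | c e \<noteq> 0. c e * V e i) \<longleftrightarrow> der_of n v = (\<lambda>p. \<Sum>e | c e \<noteq> 0. c e * e p)"
      if sub: "{e. c e \<noteq> 0} \<subseteq> E"
    proof
      assume v: "v = (\<lambda>i. \<Sum>e | c e \<noteq> 0. c e * V e i)"
      have "der_of n v p = (\<Sum>e | c e \<noteq> 0. c e * der_of n (V e) p)" for p
        by (simp only: v der_of_comb)
      then show "der_of n v = (\<lambda>p. \<Sum>e | c e \<noteq> 0. c e * e p)"
        using V(2) sub by (simp add: fun_eq_iff) (auto intro!: sum.cong)
    next
      assume D: "der_of n v = (\<lambda>p. \<Sum>e | c e \<noteq> 0. c e * e p)"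
      have "v = vec_of n (der_of n v)" using \<open>v \<in> M\<close> M by (metis subsetD vec_of_der_of)
      then show "v = (\<lambda>i. \<Sum>e | c e \<noteq> 0. c e * V e i)"
        unfolding D V_def vec_of_def by (auto simp: fun_eq_iff)
    qed
    then show ?thesis unfolding expr_def by blast
  qed
  have ex1_expr: "\<exists>!c. expr v c" if "v \<in> M" for v
    unfolding expr_iff[OF that] by (rule bspec[OF ex1 imageI[OF that]])
  then have ex_expr: "\<exists>c. expr v c" and expr_unique: "expr v c \<Longrightarrow> expr v c' \<Longrightarrow> c = c'"
    if "v \<in> M" for v c c'
    using that by blast+
  define U where "U i = (\<lambda>j. if j = i then Q else 0)" for i :: nat
  have "\<exists>c. expr (U i) c" if "i < n" for i
    unfolding U_def by (rule ex_expr[OF Q(3)[OF that]])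
  then obtain C where C: "\<And>i. i < n \<Longrightarrow> expr (U i) (C i)" by metis
  define F where "F = (\<Union>i<n. {e. C i e \<noteq> 0})"
  have F: "finite F" "F \<subseteq> E" using C by (auto simp: F_def expr_def)
  have expand_U: "U i j = (\<Sum>e\<in>F. C i e * V e j)" if "i < n" for i j
  proof -
    have "U i j = (\<Sum>e | C i e \<noteq> 0. C i e * V e j)"
      using C[OF that] by (simp add: expr_def fun_eq_iff)
    also have "\<dots> = (\<Sum>e\<in>F. C i e * V e j)"
      by (rule sum.mono_neutral_left) (use that F in \<open>auto simp: F_def\<close>)
    finally show ?thesis .
  qed
  have EF: "(\<Sum>i<n. V e i * C i l) = (if l = e then Q else 0)" if e: "e \<in> E" for e l
  proof -
    let ?c = "\<lambda>l. \<Sum>i<n. V e i * C i l"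
    have Ve: "V e i \<in> polys n" for i using V(1)[OF e] M by (auto simp: poly_vecs_def)
    have c1: "expr (\<lambda>i. Q * V e i) (\<lambda>l. if l = e then Q else 0)"
      using e Q by (auto simp: expr_def)
    have c2: "expr (\<lambda>i. Q * V e i) ?c"
    proof -
      have "?c l \<noteq> 0 \<Longrightarrow> l \<in> F" for l
        unfolding F_def by (auto elim!: sum.not_neutral_contains_not_neutral)
      then have sub: "{l. ?c l \<noteq> 0} \<subseteq> F" by blast
      have "Q * V e j = (\<Sum>l | ?c l \<noteq> 0. ?c l * V l j)" for j
      proof -
        have "Q * V e j = (\<Sum>i<n. V e i * U i j)"
        proof (cases "j < n")
          case True
          have "(\<Sum>i<n. V e i * U i j) = (\<Sum>i<n. if i = j then V e j * Q else 0)"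
            by (rule sum.cong) (auto simp: U_def)
          then show ?thesis using True by (simp add: mult.commute)
        next
          case False
          then show ?thesis by (auto simp: V0 U_def intro!: sum.neutral)
        qed
        also have "\<dots> = (\<Sum>l\<in>F. ?c l * V l j)"
          unfolding matrix_sum_assoc by (rule sum.cong) (simp_all add: expand_U)
        also have "\<dots> = (\<Sum>l | ?c l \<noteq> 0. ?c l * V l j)"
          by (rule sum.mono_neutral_right) (use sub F in auto)
        finally show ?thesis .
      qed
      moreover have "?c l \<in> polys n" for l
        using C Ve by (auto simp: expr_def intro!: polys_sum)
      ultimately show ?thesis
        using sub F finite_subset[OF sub F(1)] by (auto simp: expr_def)
    qed
    have "?c = (\<lambda>l. if l = e then Q else 0)"
      by (rule expr_unique[OF scale[OF Q(1) V(1)[OF e]] c2 c1])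
    then show ?thesis by (rule fun_cong)
  qed
  have "E \<subseteq> F"
  proof
    fix e assume "e \<in> E"
    then have "(\<Sum>i<n. V e i * C i e) \<noteq> 0" using EF Q(2) by simp
    then show "e \<in> F"
      unfolding F_def by (auto elim!: sum.not_neutral_contains_not_neutral)
  qed
  then have "F = E" using F(2) by blast
  define N where "N = card E"
  obtain f where f: "bij_betw f {..<N} E"
    using ex_bij_betw_nat_finite[of E] F(1) \<open>F = E\<close> by (auto simp: N_def lessThan_atLeast0)
  have f_in: "f j \<in> E" if "j < N" for j using f that by (auto simp: bij_betw_def)
  have f_eq: "f j = f k \<longleftrightarrow> j = k" if "j < N" "k < N" for j k
    using f that by (auto simp: bij_betw_def inj_on_def)
  have sum_f: "(\<Sum>e\<in>E. h e) = (\<Sum>j<N. h (f j))" for h :: "_ \<Rightarrow> 'k mpoly"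
    using sum.reindex_bij_betw[OF f, of h] by simp
  have VC: "(\<Sum>i<n. V (f j) i * C i (f k)) = (if j = k then Q else 0)" if "j < N" "k < N" for j k
    using EF[OF f_in[OF that(1)], of "f k"] f_eq[OF that(2,1)] by auto
  have CV: "(\<Sum>l<N. C i (f l) * V (f l) j) = (if i = j then Q else 0)" if "i < n" "j < n" for i j
    using expand_U[OF that(1), of j] unfolding \<open>F = E\<close> sum_f by (auto simp: U_def)
  obtain g where "inj_on g {..<N}" "\<And>t. t < N \<Longrightarrow> g t < n"
    by (rule nonzero_transversal[OF VC Q(2)]) auto
  then have "N \<le> n" using card_inj_on_le[of g "{..<N}" "{..<n}"] by auto
  obtain g where "inj_on g {..<n}" "\<And>t. t < n \<Longrightarrow> g t < N"
    by (rule nonzero_transversal[OF CV Q(2)]) auto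
  then have "n \<le> N" using card_inj_on_le[of g "{..<n}" "{..<N}"] by auto
  with \<open>N \<le> n\<close> have N: "N = n" by simp
  show thesis
  proof (rule that[of "\<lambda>j. V (f j)"], unfold vec_basis_def, intro conjI ballI allI impI)
    fix v assume "v \<in> M"
    then obtain c where c: "expr v c" using ex_expr by blast
    have "v = (\<lambda>i. \<Sum>e\<in>E. c e * V e i)"
    proof
      fix i
      have "v i = (\<Sum>e | c e \<noteq> 0. c e * V e i)" using c by (simp add: expr_def fun_eq_iff)
      also have "\<dots> = (\<Sum>e\<in>E. c e * V e i)"
        by (rule sum.mono_neutral_left) (use c F \<open>F = E\<close> in \<open>auto simp: expr_def\<close>)
      finally show "v i = (\<Sum>e\<in>E. c e * V e i)" .
    qed
    then show "\<exists>c. v = (\<lambda>i. \<Sum>j<n. c j * V (f j) i)"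
      unfolding sum_f N by (intro exI[of _ "\<lambda>j. c (f j)"])
  next
    fix c k assume 0: "\<forall>i. (\<Sum>j<n. c j * V (f j) i) = 0" and k: "k < n"
    have "0 = (\<Sum>i<n. (\<Sum>j<n. c j * V (f j) i) * C i (f k))" using 0 by simp
    also have "\<dots> = (\<Sum>j<n. c j * (\<Sum>i<n. V (f j) i * C i (f k)))"
      by (rule matrix_sum_assoc)
    also have "\<dots> = (\<Sum>j<n. if j = k then c j * Q else 0)"
      using k VC unfolding N by (intro sum.cong) auto
    also have "\<dots> = c k * Q" using k by simp
    finally show "c k = 0" using Q(2) by simp
  qed (use V f_in N in auto)
qed

section \<open>Homogeneous bases\<close>

lemma vec_basis_fdet_nonzero:
  assumes \<theta>: "vec_basis n M \<theta>" and Q: "Q \<noteq> 0" "\<And>i. i < n \<Longrightarrow> (\<lambda>j. if j = i then Q else 0) \<in> M"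
  shows "fdet n \<theta> \<noteq> 0"
proof -
  have "\<exists>c. (\<lambda>j. if j = i then Q else 0) = (\<lambda>j. \<Sum>k<n. c k * \<theta> k j)" if "i < n" for i
    using \<theta> Q(2)[OF that] unfolding vec_basis_def by blast
  then obtain c where c: "\<And>i. i < n \<Longrightarrow>
      (\<lambda>j. if j = i then Q else 0) = (\<lambda>j. \<Sum>k<n. c i k * \<theta> k j)"
    by metis
  have "(\<Sum>k<n. c i k * \<theta> k j) = (if i = j then Q else 0)" if "i < n" for i j
    using fun_cong[OF c[OF that], of j] by auto
  then have "fdet n c * fdet n \<theta> = fdet n (\<lambda>i j. if i = j then Q else 0)"
    unfolding fdet_mult[symmetric] by (intro fdet_cong)
  also have "\<dots> = Q ^ n" by (rule fdet_scalar)
  finally show ?thesis using Q(1) by auto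
qed

lemma vec_basis_fdet_dvd:
  assumes \<theta>: "vec_basis n M \<theta>" and v: "\<And>j. j < n \<Longrightarrow> v j \<in> M"
  shows "fdet n \<theta> dvd fdet n v"
proof -
  have "\<exists>c. v j = (\<lambda>i. \<Sum>k<n. c k * \<theta> k i)" if "j < n" for j
    using \<theta> v[OF that] unfolding vec_basis_def by blast
  then obtain c where c: "\<And>j. j < n \<Longrightarrow> v j = (\<lambda>i. \<Sum>k<n. c j k * \<theta> k i)"
    by metis
  have "fdet n v = fdet n c * fdet n \<theta>"
    unfolding fdet_mult[symmetric] by (rule fdet_cong) (simp add: c)
  then show ?thesis by simp
qed

lemma vec_basis_unimodular:
  assumes e: "vec_basis n M e" and \<theta>: "\<And>j. j < n \<Longrightarrow> \<theta> j \<in> M"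
    and T: "\<And>j. j < n \<Longrightarrow> \<theta> j = (\<lambda>i. \<Sum>k<n. T j k * e k i)"
    and u: "fdet n T * u = 1"
  shows "vec_basis n M \<theta>"
  unfolding vec_basis_def
proof (intro conjI ballI allI impI)
  obtain B where TB: "\<And>j i. j < n \<Longrightarrow> i < n \<Longrightarrow>
      (\<Sum>k<n. T j k * B k i) = (if j = i then fdet n T else 0)"
    and BT: "\<And>j i. j < n \<Longrightarrow> i < n \<Longrightarrow>
      (\<Sum>k<n. B j k * T k i) = (if j = i then fdet n T else 0)"
    by (rule fdet_adjugate[of n T]) blast
  {
    fix v assume "v \<in> M"
    then obtain c where c: "v = (\<lambda>i. \<Sum>l<n. c l * e l i)"
      using e unfolding vec_basis_def by blast
    have B\<theta>: "(\<Sum>k<n. B l k * \<theta> k i) = fdet n T * e l i" if "l < n" for l i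
    proof -
      have "(\<Sum>k<n. B l k * \<theta> k i) = (\<Sum>j<n. (\<Sum>k<n. B l k * T k j) * e j i)"
        unfolding matrix_sum_assoc by (rule sum.cong) (simp_all add: T)
      also have "\<dots> = (\<Sum>j<n. if j = l then fdet n T * e l i else 0)"
        using BT[OF that] by (intro sum.cong) auto
      finally show ?thesis using that by simp
    qed
    have "v i = (\<Sum>k<n. (u * (\<Sum>l<n. c l * B l k)) * \<theta> k i)" for i
    proof -
      have "(\<Sum>k<n. (u * (\<Sum>l<n. c l * B l k)) * \<theta> k i) = u * (\<Sum>k<n. (\<Sum>l<n. c l * B l k) * \<theta> k i)"
        unfolding sum_distrib_left[of u "\<lambda>k. (\<Sum>l<n. c l * B l k) * \<theta> k i"]
        by (simp only: mult.assoc)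
      also have "\<dots> = u * (\<Sum>l<n. c l * (fdet n T * e l i))"
        unfolding matrix_sum_assoc by (simp add: B\<theta>)
      also have "\<dots> = (fdet n T * u) * v i" by (simp add: c sum_distrib_left ac_simps)
      finally show ?thesis by (simp add: u)
    qed
    then have "v = (\<lambda>i. \<Sum>k<n. (u * (\<Sum>l<n. c l * B l k)) * \<theta> k i)" by (rule ext)
    then show "\<exists>c. v = (\<lambda>i. \<Sum>j<n. c j * \<theta> j i)"
      by (rule exI[of _ "\<lambda>k. u * (\<Sum>l<n. c l * B l k)"])
  }
  fix c j assume 0: "\<forall>i. (\<Sum>j<n. c j * \<theta> j i) = 0" and j: "j < n"
  have "(\<Sum>k<n. (\<Sum>l<n. c l * T l k) * e k i) = 0" for i
  proof -
    have "(\<Sum>k<n. (\<Sum>l<n. c l * T l k) * e k i) = (\<Sum>l<n. c l * \<theta> l i)"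
      unfolding matrix_sum_assoc by (simp add: T)
    then show ?thesis using 0 by simp
  qed
  then have cT: "(\<Sum>l<n. c l * T l k) = 0" if "k < n" for k
    using e that unfolding vec_basis_def by fastforce
  have "0 = (\<Sum>k<n. (\<Sum>l<n. c l * T l k) * B k j)" using cT by simp
  also have "\<dots> = (\<Sum>l<n. c l * (if l = j then fdet n T else 0))"
    unfolding matrix_sum_assoc using j TB by simp
  also have "\<dots> = c j * fdet n T" using j by (simp add: if_distrib cong: if_cong)
  finally show "c j = 0" using u by auto
qed (use \<theta> in simp)

lemma homogeneous_fdet:
  assumes "\<And>j i. j < n \<Longrightarrow> i < n \<Longrightarrow> homogeneous (d j) (T j i)"
  shows "homogeneous (\<Sum>j<n. d j) (fdet n T)"
  unfolding fdet_leibniz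
proof (rule homogeneous_sum)
  fix p assume "p \<in> {p. p permutes {0..<n}}"
  then have p: "p permutes {0..<n}" by simp
  have "homogeneous (\<Sum>j\<in>{0..<n}. d j) (\<Prod>j\<in>{0..<n}. T j (p j))"
  proof (rule homogeneous_prod)
    fix j assume "j \<in> {0..<n}"
    then show "homogeneous (d j) (T j (p j))"
      using permutes_in_image[OF p, of j] by (intro assms) auto
  qed
  moreover have "homogeneous 0 (of_int (sign p) :: 'a mpoly)"
    using homogeneous_mconst[of "-1"] by (auto simp: sign_def mconst_uminus simp del: homogeneous_mconst)
  ultimately show "homogeneous (\<Sum>j<n. d j) (of_int (sign p) * (\<Prod>j\<in>{0..<n}. T j (p j)))"
    using homogeneous_mult by (fastforce simp: lessThan_atLeast0)
qed

text \<open>If the determinant \<open>\<Delta>\<close> of a basis is homogeneous, then expanding it along the homogeneous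
  components of the basis vectors leaves a choice of one component for each vector whose
  determinant is nonzero and of the same degree as \<open>\<Delta>\<close>. As it is a multiple of \<open>\<Delta>\<close>, it is a
  constant multiple, so these components are again a basis.\<close>

lemma homogeneous_basis:
  fixes e :: "nat \<Rightarrow> nat \<Rightarrow> 'k::field mpoly"
  assumes e: "vec_basis n M e" and M: "M \<subseteq> poly_vecs n"
    and graded: "\<And>d v. v \<in> M \<Longrightarrow> (\<lambda>i. hcomp d (v i)) \<in> M"
    and \<Delta>: "homogeneous \<delta> (fdet n e)" "fdet n e \<noteq> 0"
  obtains \<theta> d where "vec_basis n M \<theta>" "\<And>j i. j < n \<Longrightarrow> homogeneous (d j) (\<theta> j i)"
    "(\<Sum>j<n. d j) = \<delta>"
proof -
  have eM: "e j \<in> M" if "j < n" for j using e that by (simp add: vec_basis_def)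
  define N where "N j i = (SOME N. \<forall>M\<ge>N. e j i = (\<Sum>d<M. hcomp d (e j i)))" for j i
  have "\<exists>N. \<forall>M\<ge>N. e j i = (\<Sum>d<M. hcomp d (e j i))" for j i
    by (rule hcomp_decomposition[of "e j i"]) blast
  from someI_ex[OF this]
  have N: "N j i \<le> M \<Longrightarrow> e j i = (\<Sum>d<M. hcomp d (e j i))" for j i M
    unfolding N_def by blast
  define K where "K = (\<Sum>j<n. \<Sum>i<n. N j i)"
  have K: "e j i = (\<Sum>d<K. hcomp d (e j i))" if "j < n" "i < n" for j i
  proof (rule N)
    have "N j i \<le> (\<Sum>i<n. N j i)" using that by (intro member_le_sum) auto
    also have "\<dots> \<le> K" unfolding K_def using that by (intro member_le_sum) auto
    finally show "N j i \<le> K" .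
  qed
  let ?G = "\<lambda>f. fdet n (\<lambda>j i. hcomp (f j) (e j i))"
  let ?F = "{f. (\<forall>j\<in>{0..<n}. f j \<in> {..<K}) \<and> (\<forall>j. j \<notin> {0..<n} \<longrightarrow> f j = j)}"
  have "fdet n e = fdet n (\<lambda>j i. \<Sum>d<K. hcomp d (e j i))"
    by (rule fdet_cong) (rule K)
  also have "\<dots> = (\<Sum>f\<in>?F. ?G f)" by (rule fdet_row_sums) simp
  finally have "hcomp \<delta> (fdet n e) = (\<Sum>f\<in>?F. hcomp \<delta> (?G f))" by (simp add: hcomp_sum)
  then have "(\<Sum>f\<in>?F. hcomp \<delta> (?G f)) \<noteq> 0" using \<Delta> by (simp add: hcomp_homogeneous)
  then obtain f where f: "hcomp \<delta> (?G f) \<noteq> 0"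
    by (elim sum.not_neutral_contains_not_neutral)
  have hom: "homogeneous (\<Sum>j<n. f j) (?G f)"
    by (intro homogeneous_fdet homogeneous_hcomp)
  with f have \<delta>: "(\<Sum>j<n. f j) = \<delta>" "?G f \<noteq> 0"
    by (auto simp: hcomp_homogeneous split: if_splits)
  define \<theta> where "\<theta> = (\<lambda>j i. hcomp (f j) (e j i))"
  have \<theta>M: "\<theta> j \<in> M" if "j < n" for j unfolding \<theta>_def by (rule graded[OF eM[OF that]])
  then have "\<exists>c. \<theta> j = (\<lambda>i. \<Sum>k<n. c k * e k i)" if "j < n" for j
    using e that unfolding vec_basis_def by blast
  then obtain T where T: "\<And>j. j < n \<Longrightarrow> \<theta> j = (\<lambda>i. \<Sum>k<n. T j k * e k i)" by metis
  have det: "fdet n \<theta> = fdet n T * fdet n e"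
    unfolding fdet_mult[symmetric] by (rule fdet_cong) (simp add: T)
  have \<theta>hom: "homogeneous \<delta> (fdet n \<theta>)" and \<theta>0: "fdet n \<theta> \<noteq> 0"
    using hom \<delta> by (simp_all add: \<theta>_def)
  obtain d where d: "homogeneous d (fdet n T)"
    using homogeneous_factor[of \<delta> "fdet n T" "fdet n e"] \<theta>hom \<theta>0 unfolding det by blast
  have "homogeneous (d + \<delta>) (fdet n \<theta>)" unfolding det by (rule homogeneous_mult[OF d \<Delta>(1)])
  then have "d = 0" using homogeneous_unique[OF _ \<theta>hom \<theta>0] by fastforce
  then obtain c where c: "fdet n T = mconst c" using d homogeneous_0_imp_mconst by blast
  then have "c \<noteq> 0" using \<theta>0 det by auto
  then have "fdet n T * mconst (1 / c) = 1" by (simp add: c flip: mconst_mult)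
  from vec_basis_unimodular[OF e \<theta>M T this] show thesis
    by (rule that[of \<theta> f]) (simp_all add: \<theta>_def homogeneous_hcomp \<delta>)
qed

section \<open>Free multiarrangements have homogeneous bases of small degree\<close>

lemma homogeneous_lin_form_power: "homogeneous m (lin_form n a ^ m)"
  using homogeneous_power[OF homogeneous_eval_form[OF homogeneous_mvar]] by fastforce

lemma log_vecs_subset: "log_vecs n A a m \<subseteq> poly_vecs n"
  by (auto simp: log_vecs_def)

lemma log_vecs_mult:
  "p \<in> polys n \<Longrightarrow> v \<in> log_vecs n A a m \<Longrightarrow> (\<lambda>i. p * v i) \<in> log_vecs n A a m"
  by (auto simp: log_vecs_def poly_vecs_def eval_form_mult)

lemma log_vecs_add:
  "v \<in> log_vecs n A a m \<Longrightarrow> w \<in> log_vecs n A a m \<Longrightarrow> (\<lambda>i. v i + w i) \<in> log_vecs n A a m"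
  by (auto simp: log_vecs_def poly_vecs_def eval_form_add)

lemma log_vecs_hcomp:
  assumes "v \<in> log_vecs n A a m" shows "(\<lambda>i. hcomp d (v i)) \<in> log_vecs n A a m"
proof -
  have "lin_form n (a H) ^ m H dvd eval_form n (a H) (\<lambda>i. hcomp d (v i))" if "H \<in> A" for H
  proof -
    obtain q where "eval_form n (a H) v = lin_form n (a H) ^ m H * q"
      using assms \<open>H \<in> A\<close> by (auto simp: log_vecs_def dvd_def)
    then show ?thesis
      by (auto simp: hcomp_mult_homogeneous[OF homogeneous_lin_form_power] simp flip: hcomp_eval_form)
  qed
  then show ?thesis using assms by (auto simp: log_vecs_def poly_vecs_def)
qed

lemma log_vecs_const:
  assumes "q \<in> polys n" and "\<And>i. i \<ge> n \<Longrightarrow> w i = 0"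
    and "\<And>H. H \<in> A \<Longrightarrow> pairing n (a H) w \<noteq> 0 \<Longrightarrow> lin_form n (a H) ^ m H dvd q"
  shows "(\<lambda>i. mconst (w i) * q) \<in> log_vecs n A a m"
proof -
  have "lin_form n (a H) ^ m H dvd mconst (pairing n (a H) w) * q" if "H \<in> A" for H
    using assms(3)[OF that] by (cases "pairing n (a H) w = 0") auto
  then show ?thesis
    using assms(1,2) by (auto simp: log_vecs_def poly_vecs_def eval_form_const)
qed

definition arr_poly :: "nat \<Rightarrow> 'h set \<Rightarrow> ('h \<Rightarrow> nat \<Rightarrow> 'k) \<Rightarrow> ('h \<Rightarrow> nat) \<Rightarrow> 'k::field mpoly"
  where "arr_poly n A a m = (\<Prod>H\<in>A. lin_form n (a H) ^ m H)"

lemma arr_poly_in_polys [simp]: "arr_poly n A a m \<in> polys n"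
  by (auto simp: arr_poly_def intro!: polys_prod polys_power)

lemma arr_poly_dvd: "finite A \<Longrightarrow> H \<in> A \<Longrightarrow> lin_form n (a H) ^ m H dvd arr_poly n A a m"
  by (auto simp: arr_poly_def intro: dvd_prodI)

lemma homogeneous_arr_poly: "homogeneous (\<Sum>H\<in>A. m H) (arr_poly n A a m)"
  by (auto simp: arr_poly_def intro!: homogeneous_prod homogeneous_lin_form_power)

text \<open>That two hyperplanes are different is expressed by a vector in the first one that is not in the
  second one. It shows that the form of the first one does not divide the other form.\<close>

locale hyperplane_equations =
  fixes n :: nat and A :: "'h set" and a :: "'h \<Rightarrow> nat \<Rightarrow> 'k::field"
  assumes finite_A: "finite A"
    and nonzero: "H \<in> A \<Longrightarrow> \<exists>w. pairing n (a H) w \<noteq> 0"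
    and separated: "H \<in> A \<Longrightarrow> H' \<in> A \<Longrightarrow> H \<noteq> H' \<Longrightarrow>
      \<exists>w. pairing n (a H) w = 0 \<and> pairing n (a H') w \<noteq> 0"
begin

abbreviation \<alpha> :: "'h \<Rightarrow> 'k mpoly" where "\<alpha> H \<equiv> lin_form n (a H)"

lemma \<alpha>_prime: "H \<in> A \<Longrightarrow> prime_elem (\<alpha> H)"
  using nonzero lin_form_prime by blast

lemma \<alpha>_nonzero: "H \<in> A \<Longrightarrow> \<alpha> H \<noteq> 0"
  using \<alpha>_prime by (auto simp: prime_elem_def)

lemma \<alpha>_not_dvd_arr_poly: "H \<in> A \<Longrightarrow> \<not> \<alpha> H dvd arr_poly n (A - {H}) a m"
  unfolding arr_poly_def
proof (intro prime_elem_not_dvd_prod \<alpha>_prime)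
  fix H' assume "H \<in> A" "H' \<in> A - {H}"
  then have "\<not> \<alpha> H dvd \<alpha> H'" using separated lin_form_not_dvd by (metis Diff_iff singletonI)
  then show "\<not> \<alpha> H dvd \<alpha> H' ^ m H'"
    using \<alpha>_prime[OF \<open>H \<in> A\<close>] by (auto dest: prime_elem_dvd_power)
qed

lemma arr_poly_nonzero: "arr_poly n A a m \<noteq> 0"
  using finite_A \<alpha>_nonzero by (simp add: arr_poly_def)

lemma arr_poly_remove: "H \<in> A \<Longrightarrow> arr_poly n A a m = \<alpha> H ^ m H * arr_poly n (A - {H}) a m"
  using finite_A by (simp add: arr_poly_def prod.remove)

lemma arr_poly_unit_vecs:
  assumes "i < n" shows "(\<lambda>j. if j = i then arr_poly n A a m else 0) \<in> log_vecs n A a m"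
proof -
  have "(\<lambda>j. mconst (if j = i then 1 else 0) * arr_poly n A a m) \<in> log_vecs n A a m"
    by (rule log_vecs_const) (use assms arr_poly_dvd[OF finite_A] in auto)
  also have "(\<lambda>j. mconst (if j = i then 1 else 0) * arr_poly n A a m) =
      (\<lambda>j. if j = i then arr_poly n A a m else 0)" by auto
  finally show ?thesis .
qed

text \<open>Near a generic point of one hyperplane \<open>H\<close>, the other forms are invertible, and the
  logarithmic module has a basis with the determinant \<open>\<alpha> H ^ m H\<close>. Powers of the other forms
  serve as common denominators here.\<close>

lemma fdet_dvd_local:
  assumes e: "vec_basis n (log_vecs n A a m) e" and H: "H \<in> A"
  shows "fdet n e dvd \<alpha> H ^ m H * arr_poly n (A - {H}) a m ^ n"
proof -
  let ?Q = "arr_poly n (A - {H}) a m"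
  obtain w where "pairing n (a H) w \<noteq> 0" using nonzero[OF H] by blast
  then obtain p where p: "p < n" "a H p \<noteq> 0"
    unfolding pairing_def by (elim sum.not_neutral_contains_not_neutral) auto
  (* Together with the p-th row, the j-th row spans the same space as the j-th and the p-th unit
     vectors; it lies in the kernel of the form of H unless j = p. *)
  define U where "U = (\<lambda>j i. if j = p then (if i = p then 1 else 0)
    else (if i = j then a H p else if i = p then - a H j else 0))"
  define W where "W = (\<lambda>j i. if j = p then (if i = p then a H p else 0)
    else (if i = j then 1 else if i = p then a H j else 0))"
  define g where "g = (\<lambda>j. if j = p then \<alpha> H ^ m H * ?Q else ?Q)"
  have pair: "pairing n (a H) (U j) = 0" if "j \<noteq> p" "j < n" for j
  proof -
    have "pairing n (a H) (U j) = (\<Sum>i<n. (if i = j then a H j * a H p else 0)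
        + (if i = p then - (a H p * a H j) else 0))"
      unfolding pairing_def by (rule sum.cong) (use that in \<open>auto simp: U_def\<close>)
    then show ?thesis using p that by (simp add: sum.distrib)
  qed
  have "(\<lambda>i. mconst (U j i) * g j) \<in> log_vecs n A a m" if j: "j < n" for j
  proof (rule log_vecs_const)
    show "g j \<in> polys n" by (auto simp: g_def)
    show "U j i = 0" if "n \<le> i" for i using that p j by (auto simp: U_def)
    fix H' assume H': "H' \<in> A" "pairing n (a H') (U j) \<noteq> 0"
    show "\<alpha> H' ^ m H' dvd g j"
    proof (cases "H' = H")
      case True
      then show ?thesis using H' pair[of j] j by (auto simp: g_def)
    next
      case False
      then have "\<alpha> H' ^ m H' dvd ?Q" using H' finite_A by (intro arr_poly_dvd) auto
      then show ?thesis by (simp add: g_def)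
    qed
  qed
  from vec_basis_fdet_dvd[OF e this]
  have "fdet n e dvd fdet n (\<lambda>j i. mconst (U j i) * g j)" .
  also have "fdet n (\<lambda>j i. mconst (U j i) * g j) = (\<Prod>j\<in>{0..<n}. g j) * fdet n (\<lambda>j i. mconst (U j i))"
    using fdet_rows_mult[of n g "\<lambda>j i. mconst (U j i)"] by (simp add: mult.commute)
  also have "(\<Prod>j\<in>{0..<n}. g j) = (\<Prod>j\<in>{0..<n}. (if j = p then \<alpha> H ^ m H else 1) * ?Q)"
    by (rule prod.cong) (auto simp: g_def)
  also have "\<dots> = \<alpha> H ^ m H * ?Q ^ n" using p by (simp add: prod.distrib)
  also have "fdet n (\<lambda>j i. mconst (U j i)) dvd 1"
  proof -
    have "(\<Sum>k<n. U j k * W k i) = (if j = i then a H p else 0)" if "j < n" "i < n" for j i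
    proof (cases "j = p")
      case True
      have "(\<Sum>k<n. U j k * W k i) = (\<Sum>k<n. if k = p then W p i else 0)"
        by (rule sum.cong) (auto simp: U_def True)
      then show ?thesis using p by (auto simp: W_def True)
    next
      case False
      have "(\<Sum>k<n. U j k * W k i) =
          (\<Sum>k<n. (if k = j then a H p * W j i else 0) + (if k = p then - a H j * W p i else 0))"
        by (rule sum.cong) (use False in \<open>auto simp: U_def\<close>)
      also have "\<dots> = a H p * W j i - a H j * W p i" using p that by (simp add: sum.distrib)
      finally show ?thesis using False by (auto simp: W_def)
    qed
    then have "(\<Sum>k<n. mconst (U j k) * mconst (W k i)) = (if j = i then mconst (a H p) else 0)"
      if "j < n" "i < n" for j i
      using that by (simp flip: mconst_mult mconst_sum)
    then have "fdet n (\<lambda>j i. mconst (U j i)) * fdet n (\<lambda>j i. mconst (W j i)) =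
        fdet n (\<lambda>j i. if j = i then mconst (a H p) else 0)"
      unfolding fdet_mult[symmetric] by (intro fdet_cong)
    also have "\<dots> = mconst (a H p ^ n)" by (simp add: fdet_scalar mconst_power)
    finally have "fdet n (\<lambda>j i. mconst (U j i)) dvd mconst (a H p ^ n)" by (metis dvd_triv_left)
    also have "mconst (a H p ^ n) * mconst (1 / a H p ^ n) = 1"
      using p by (simp flip: mconst_mult)
    then have "mconst (a H p ^ n) dvd 1" by (metis dvd_triv_left)
    finally show ?thesis .
  qed
  then have "\<alpha> H ^ m H * ?Q ^ n * fdet n (\<lambda>j i. mconst (U j i)) dvd \<alpha> H ^ m H * ?Q ^ n * 1"
    by (intro mult_dvd_mono dvd_refl)
  finally show ?thesis by simp
qed

text \<open>By the local estimates, the exponents of the forms in the determinant of a basis are at most the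
  multiplicities. So it is a product of linear forms, hence homogeneous, and its degree is the sum of
  the degrees of a homogeneous basis.\<close>

lemma free_imp_homogeneous_basis:
  assumes A: "A \<noteq> {}" and free: "free_module (polys n) (der_of n ` log_vecs n A a m)"
  obtains \<theta> d where "vec_basis n (log_vecs n A a m) \<theta>"
    "\<And>j i. j < n \<Longrightarrow> homogeneous (d j) (\<theta> j i)" "(\<Sum>j<n. d j) \<le> (\<Sum>H\<in>A. m H)"
proof -
  let ?Q = "arr_poly n A a m"
  obtain e where e: "vec_basis n (log_vecs n A a m) e"
    using vec_basis_if_free_module[OF log_vecs_subset log_vecs_mult arr_poly_in_polys
      arr_poly_nonzero arr_poly_unit_vecs free] by blast
  let ?\<Delta> = "fdet n e"
  have \<Delta>0: "?\<Delta> \<noteq> 0"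
    by (rule vec_basis_fdet_nonzero[OF e arr_poly_nonzero arr_poly_unit_vecs])
  obtain H0 where H0: "H0 \<in> A" using A by blast
  let ?N = "\<lambda>H. if H = H0 then m H else m H * n"
  have "?\<Delta> dvd arr_poly n A a ?N * 1"
  proof -
    have "arr_poly n (A - {H0}) a ?N = arr_poly n (A - {H0}) a m ^ n"
      unfolding arr_poly_def prod_power_distrib
      by (rule prod.cong) (auto simp: power_mult)
    then show ?thesis
      using fdet_dvd_local[OF e H0] by (simp add: arr_poly_remove[OF H0, of ?N])
  qed
  then have "?\<Delta> dvd (\<Prod>H\<in>A. \<alpha> H ^ m H) * 1"
    unfolding arr_poly_def
  proof (rule dvd_lower_prime_exponents[OF finite_A])
    fix H assume H: "H \<in> A"
    show "prime_elem (\<alpha> H)" by (rule \<alpha>_prime[OF H])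
    have "\<not> \<alpha> H dvd arr_poly n (A - {H}) a m ^ n"
      using \<alpha>_prime[OF H] \<alpha>_not_dvd_arr_poly[OF H] by (auto dest: prime_elem_dvd_power)
    then show "\<exists>G. ?\<Delta> dvd \<alpha> H ^ m H * G \<and> \<not> \<alpha> H dvd G"
      using fdet_dvd_local[OF e H] by blast
  qed
  then obtain h where h: "?Q = ?\<Delta> * h" by (auto simp: arr_poly_def dvd_def)
  then obtain \<delta> where \<delta>: "homogeneous \<delta> ?\<Delta>" "\<delta> \<le> (\<Sum>H\<in>A. m H)"
    using homogeneous_factor[of "\<Sum>H\<in>A. m H" ?\<Delta> h] homogeneous_arr_poly arr_poly_nonzero
    by metis
  show thesis
    using homogeneous_basis[OF e log_vecs_subset log_vecs_hcomp \<delta>(1) \<Delta>0] that \<delta>(2) by metis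
qed

end

section \<open>Total freeness excludes long circuits\<close>

text \<open>By Pascal's rule, if the binomial coefficients of order \<open>r + 1\<close> vanish from some point on,
  then so do those of order \<open>r\<close>.\<close>

lemma binomial_nonzero_in_field: "\<exists>K\<ge>K0. of_nat (K choose r) \<noteq> (0 :: 'k::field)"
proof (induction r)
  case (Suc r)
  show ?case
  proof (rule ccontr)
    assume "\<not> ?thesis"
    then have 0: "of_nat (K choose Suc r) = (0 :: 'k)" if "K \<ge> K0" for K
      using that by blast
    have "of_nat (K choose r) = (0 :: 'k)" if "K \<ge> K0" for K
      using 0[of K] 0[of "Suc K"] that by simp
    then show False using Suc by blast
  qed
qed auto

lemma coef_mvar_power_mult:
  fixes g :: "'k::field mpoly"
  assumes "coef (mvar i ^ L * g) t \<noteq> 0" shows "L \<le> expo t i"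
proof -
  have "t \<in> supp (mvar i ^ L * g)" using assms by (simp add: in_keys_iff)
  then obtain u v where "u \<in> supp (mvar i ^ L :: 'k mpoly)" "t = u + v"
    using keys_mult[of "mvar i ^ L" g] by blast
  then have "t = Poly_Mapping.single i L + v"
    by (simp add: monom_poly_def split: if_splits flip: monom_poly_single)
  then show ?thesis by (simp add: lookup_add)
qed

lemma coef_mconst_mult: "coef (mconst c * p) t = c * coef p t"
  unfolding mconst_def mult_map_scale_conv_mult[symmetric] by (simp add: map.rep_eq when_def)

lemma coef_binary_power:
  assumes "p + q = K"
  shows "coef ((mconst c1 * mvar 0 + mconst c2 * mvar 1) ^ K)
      (Poly_Mapping.single 0 p + Poly_Mapping.single 1 q) =
    of_nat (K choose p) * c1 ^ p * (c2 ^ q :: 'k::field)"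
proof -
  let ?t = "\<lambda>j. Poly_Mapping.single 0 j + Poly_Mapping.single (1::nat) (K - j)"
  let ?c = "\<lambda>j. of_nat (K choose j) * c1 ^ j * c2 ^ (K - j)"
  have t_eq: "?t i = ?t j \<longleftrightarrow> i = j" for i j
  proof
    assume "?t i = ?t j"
    then have "expo (?t i) 0 = expo (?t j) 0" by simp
    then show "i = j" by (simp add: lookup_add lookup_single)
  qed simp
  have "(mconst c1 * mvar 0 + mconst c2 * mvar 1) ^ K =
      (\<Sum>j\<le>K. mconst (?c j) * monom_poly (?t j))"
    unfolding binomial_ring
    by (intro sum.cong refl)
      (simp add: power_mult_distrib monom_poly_add monom_poly_single mconst_mult mconst_of_nat
        mconst_power ac_simps)
  also have "coef \<dots> (?t p) = (\<Sum>j\<le>K. if j = p then ?c p else 0)"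
    unfolding lookup_sum
    by (intro sum.cong refl) (simp add: mconst_mult_monom_poly lookup_single when_def t_eq del: One_nat_def)
  also have "\<dots> = ?c p" using assms by simp
  finally show ?thesis using assms by auto
qed

lemma pairing_truncate: "pairing n a (\<lambda>i. if i < n then w i else 0) = pairing n a w"
  by (simp add: pairing_def)

context hyperplane_equations
begin

lemma multiplicity_le_degree:
  assumes v: "v \<in> log_vecs n A a m" "\<And>i. homogeneous d (v i)"
    and H: "H \<in> A" "eval_form n (a H) v \<noteq> 0"
  shows "m H \<le> d"
proof -
  obtain g where g: "eval_form n (a H) v = \<alpha> H ^ m H * g"
    using v(1) H(1) by (auto simp: log_vecs_def dvd_def)
  have "homogeneous d (\<alpha> H ^ m H * g)"
    unfolding g[symmetric] by (rule homogeneous_eval_form) (rule v(2))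
  then obtain e where "homogeneous e (\<alpha> H ^ m H)" "e \<le> d"
    using homogeneous_factor H(2) g by metis
  then show ?thesis
    using homogeneous_unique[OF homogeneous_lin_form_power] \<alpha>_nonzero[OF H(1)]
    by (metis power_not_zero)
qed

text \<open>Multiplying a power of \<open>\<alpha> H0\<close> by the equation of the hyperplanes different from \<open>H0\<close>
  and \<open>H1\<close>, and by a constant derivation along \<open>H1\<close>, yields a logarithmic derivation whose
  value at \<open>\<alpha> H0\<close> is prime to \<open>\<alpha> H1\<close>. So if one basis element alone takes nonzero values at
  \<open>\<alpha> H0\<close>, its value has no other prime factor than \<open>\<alpha> H0\<close>.\<close>

lemma single_basis_value:
  assumes \<theta>: "vec_basis n (log_vecs n A a m) \<theta>" and H0: "H0 \<in> A"
    and j0: "j0 < n" and only: "\<And>j. j < n \<Longrightarrow> j \<noteq> j0 \<Longrightarrow> eval_form n (a H0) (\<theta> j) = 0"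
    and other: "H2 \<in> A" "H2 \<noteq> H0"
  obtains c where "c \<noteq> 0" "eval_form n (a H0) (\<theta> j0) = mconst c * \<alpha> H0 ^ m H0"
proof -
  have "\<theta> j0 \<in> log_vecs n A a m" using \<theta> j0 by (simp add: vec_basis_def)
  then obtain u where u: "eval_form n (a H0) (\<theta> j0) = \<alpha> H0 ^ m H0 * u"
    using H0 by (auto simp: log_vecs_def dvd_def)
  have val: "\<exists>p. eval_form n (a H0) v = p * (\<alpha> H0 ^ m H0 * u)" if v: "v \<in> log_vecs n A a m" for v
  proof -
    obtain c where "v = (\<lambda>i. \<Sum>j<n. c j * \<theta> j i)" using \<theta> v unfolding vec_basis_def by blast
    then have "eval_form n (a H0) v = (\<Sum>j<n. c j * eval_form n (a H0) (\<theta> j))"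
      by (simp add: eval_form_comb)
    also have "\<dots> = (\<Sum>j<n. if j = j0 then c j0 * (\<alpha> H0 ^ m H0 * u) else 0)"
      by (rule sum.cong) (auto simp: only u)
    finally show ?thesis using j0 by auto
  qed
  have u_dvd: "u dvd arr_poly n (A - {H1} - {H0}) a m" if H1: "H1 \<in> A" "H1 \<noteq> H0" for H1
  proof -
    let ?R = "arr_poly n (A - {H1} - {H0}) a m" and ?q = "arr_poly n (A - {H1}) a m"
    obtain w0 where w0: "pairing n (a H1) w0 = 0" "pairing n (a H0) w0 \<noteq> 0"
      using separated[of H1 H0] H0 H1 by blast
    define w where "w = (\<lambda>i. if i < n then w0 i else 0)"
    have w: "pairing n (a H1) w = 0" "pairing n (a H0) w \<noteq> 0"
      using w0 by (simp_all add: w_def pairing_truncate)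
    have "(\<lambda>i. mconst (w i) * ?q) \<in> log_vecs n A a m"
    proof (rule log_vecs_const)
      fix H assume "H \<in> A" "pairing n (a H) w \<noteq> 0"
      then have "H \<in> A - {H1}" using w(1) by auto
      then show "\<alpha> H ^ m H dvd ?q" using finite_A by (intro arr_poly_dvd) auto
    qed (auto simp: w_def)
    from val[OF this] obtain p
      where p: "mconst (pairing n (a H0) w) * ?q = p * (\<alpha> H0 ^ m H0 * u)"
      by (auto simp: eval_form_const)
    have "?q = \<alpha> H0 ^ m H0 * ?R"
      unfolding arr_poly_def using finite_A H0 H1 by (intro prod.remove) auto
    then have "\<alpha> H0 ^ m H0 * (mconst (pairing n (a H0) w) * ?R) = \<alpha> H0 ^ m H0 * (p * u)"
      using p by (simp add: ac_simps)
    then have eq: "mconst (pairing n (a H0) w) * ?R = p * u" using \<alpha>_nonzero[OF H0] by simp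
    have "?R = mconst (1 / pairing n (a H0) w) * (mconst (pairing n (a H0) w) * ?R)"
      using mconst_inverse[OF w(2)] by (simp flip: mult.assoc)
    also have "\<dots> = u * (mconst (1 / pairing n (a H0) w) * p)"
      unfolding eq by (simp add: ac_simps)
    finally show ?thesis by (rule dvdI)
  qed
  have "u dvd (\<Prod>H\<in>A - {H0}. \<alpha> H ^ m H) * 1"
  proof -
    have "arr_poly n (A - {H2} - {H0}) a m dvd (\<Prod>H\<in>A - {H0}. \<alpha> H ^ m H) * 1"
      unfolding arr_poly_def mult_1_right using finite_A by (intro prod_dvd_prod_subset) auto
    then show ?thesis using u_dvd[OF other] by (rule dvd_trans[rotated])
  qed
  then have "u dvd (\<Prod>H\<in>A - {H0}. \<alpha> H ^ 0) * 1"
  proof (rule dvd_lower_prime_exponents[rotated])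
    fix H assume H: "H \<in> A - {H0}"
    show "prime_elem (\<alpha> H)" using \<alpha>_prime H by simp
    have "arr_poly n (A - {H} - {H0}) a m dvd arr_poly n (A - {H}) a m"
      unfolding arr_poly_def using finite_A by (intro prod_dvd_prod_subset) auto
    then have "\<not> \<alpha> H dvd arr_poly n (A - {H} - {H0}) a m"
      using \<alpha>_not_dvd_arr_poly[of H m] H by (auto dest: dvd_trans)
    then show "\<exists>G. u dvd \<alpha> H ^ 0 * G \<and> \<not> \<alpha> H dvd G"
      using u_dvd H by auto
  qed (simp add: finite_A)
  then obtain h where h: "u * h = 1" by (auto simp: dvd_def)
  then obtain e where "homogeneous e u" "e \<le> 0"
    using homogeneous_factor[of 0 u h] by auto
  then obtain c where "u = mconst c" using homogeneous_0_imp_mconst by auto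
  moreover from this h have "c \<noteq> 0" by auto
  ultimately show thesis using that u by (simp add: mult.commute)
qed

text \<open>Three hyperplanes \<open>h 0\<close>, \<open>h 1\<close>, \<open>h 2\<close> with independent equations get multiplicities
  \<open>K\<close>, \<open>L\<close> and \<open>B\<close> larger than the number of hyperplanes, where \<open>K\<close> exceeds \<open>L\<close> and
  \<open>B\<close> by more than that number; the remaining hyperplanes get multiplicity one. In a homogeneous
  basis, three different elements must be nonzero on the three equations, so their degrees are at
  least \<open>K\<close>, \<open>L\<close> and \<open>B\<close>. As the sum of all degrees exceeds \<open>K + L + B\<close> at most by the
  number of hyperplanes, a single element has degree at least \<open>K\<close>, and it maps \<open>\<alpha> (h 0)\<close> to a
  constant multiple of \<open>\<alpha> (h 0) ^ K\<close> by the lemma above.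

  Now suppose that \<open>\<alpha> (h 0)\<close> is a combination of \<open>\<alpha> (h 1)\<close>, \<open>\<alpha> (h 2)\<close> and further equations.
  Restricted to the plane spanned by \<open>e1\<close> and \<open>e2\<close>, where the further equations vanish and the
  first two become coordinates \<open>y\<close> and \<open>z\<close>, the derivation shows that
  \<open>(c1 y + c2 z) ^ K\<close> lies in the ideal of \<open>y ^ L\<close> and \<open>z ^ B\<close>. This is impossible if
  the coefficient at \<open>y ^ (L - 1) z ^ (K - L + 1)\<close> is nonzero and \<open>K - L + 1 < B\<close>.\<close>

lemma no_long_circuit:
  fixes h :: "nat \<Rightarrow> 'h"
  assumes free: "\<And>m. \<forall>H\<in>A. m H > 0 \<Longrightarrow> free_module (polys n) (der_of n ` log_vecs n A a m)"
    and h: "\<And>s. s < 3 \<Longrightarrow> h s \<in> A"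
    and dual: "\<And>s t. s < 3 \<Longrightarrow> t < 3 \<Longrightarrow> pairing n (a (h s)) (w t) = (if s = t then 1 else 0)"
    and T: "T \<subseteq> A"
    and relation: "\<And>i. i < n \<Longrightarrow>
      a (h 0) i = c1 * a (h 1) i + c2 * a (h 2) i + (\<Sum>t\<in>T. c t * a t i)"
    and e: "pairing n (a (h 1)) e1 = 1" "pairing n (a (h 2)) e1 = 0"
      "pairing n (a (h 1)) e2 = 0" "pairing n (a (h 2)) e2 = 1"
      "\<And>t. t \<in> T \<Longrightarrow> pairing n (a t) e1 = 0" "\<And>t. t \<in> T \<Longrightarrow> pairing n (a t) e2 = 0"
    and c: "c1 \<noteq> 0" "c2 \<noteq> 0"
  shows False
proof -
  (* \<rho> bounds the sum of the multiplicities of the other hyperplanes, which is also how much a degree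
     may exceed the least possible one. The critical monomial is y ^ (L - 1) z ^ (\<rho> + 2). *)
  define \<rho> where "\<rho> = card A"
  define B where "B = \<rho> + 3"
  obtain K where K: "K \<ge> 2 * \<rho> + 4" "of_nat (K choose (\<rho> + 2)) \<noteq> (0 :: 'k)"
    using binomial_nonzero_in_field[of "2 * \<rho> + 4" "\<rho> + 2"] by blast
  define L where "L = K - \<rho> - 1"
  have h_eq: "h s = h t \<longleftrightarrow> s = t" if "s < 3" "t < 3" for s t
    using dual[OF that(1) that(1)] dual[OF that(2) that(1)] by (auto split: if_splits)
  define m where "m = (\<lambda>H. if H = h 0 then K else if H = h 1 then L else if H = h 2 then B else 1)"
  have mh: "m (h 0) = K" "m (h 1) = L" "m (h 2) = B" by (simp_all add: m_def h_eq)
  have m_pos: "\<forall>H\<in>A. m H > 0" using K by (auto simp: m_def L_def B_def)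
  have sum_m: "(\<Sum>H\<in>A. m H) \<le> K + L + B + \<rho>"
  proof -
    have "(\<Sum>H\<in>A. m H) \<le> (\<Sum>H\<in>A. (if H = h 0 then K else 0) + (if H = h 1 then L else 0)
        + (if H = h 2 then B else 0) + 1)"
      by (rule sum_mono) (simp add: m_def)
    also have "\<dots> = K + L + B + \<rho>"
      unfolding sum.distrib using finite_A h[of 0] h[of 1] h[of 2] by (simp add: \<rho>_def)
    finally show ?thesis .
  qed
  have "A \<noteq> {}" using h[of 0] by auto
  from free_imp_homogeneous_basis[OF this free[OF m_pos]] obtain \<theta> d
    where \<theta>: "vec_basis n (log_vecs n A a m) \<theta>"
      and hom: "\<And>j i. j < n \<Longrightarrow> homogeneous (d j) (\<theta> j i)"
      and "(\<Sum>j<n. d j) \<le> (\<Sum>H\<in>A. m H)" by blast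
  with sum_m have sum_d: "(\<Sum>j<n. d j) \<le> K + L + B + \<rho>" by simp
  have \<theta>D: "\<theta> j \<in> log_vecs n A a m" if "j < n" for j
    using \<theta> that by (simp add: vec_basis_def)
  let ?\<Theta> = "\<lambda>j s. eval_form n (a (h s)) (\<theta> j)"
  have d_ge: "m (h s) \<le> d j" if "j < n" "s < 3" "?\<Theta> j s \<noteq> 0" for j s
    using multiplicity_le_degree[OF \<theta>D[OF that(1)] hom[OF that(1)] h[OF that(2)] that(3)] .
  let ?Q = "arr_poly n A a m"
  have "\<exists>C. (\<lambda>i. mconst (if i < n then w s i else 0) * ?Q) = (\<lambda>i. \<Sum>j<n. C j * \<theta> j i)" for s
  proof -
    have "(\<lambda>i. mconst (if i < n then w s i else 0) * ?Q) \<in> log_vecs n A a m"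
      by (rule log_vecs_const) (use finite_A arr_poly_dvd in auto)
    then show ?thesis using \<theta> unfolding vec_basis_def by blast
  qed
  then have "\<forall>s. \<exists>C. (\<lambda>i. mconst (if i < n then w s i else 0) * ?Q) = (\<lambda>i. \<Sum>j<n. C j * \<theta> j i)"
    by blast
  from choice[OF this] obtain C where
    C: "\<And>s. (\<lambda>i. mconst (if i < n then w s i else 0) * ?Q) = (\<lambda>i. \<Sum>j<n. C s j * \<theta> j i)"
    by blast
  have "(\<Sum>j<n. C s j * ?\<Theta> j t) = (if s = t then ?Q else 0)" if "s < 3" "t < 3" for s t
    unfolding eval_form_comb[symmetric] C[symmetric] eval_form_const pairing_truncate
    using dual[OF that(2,1)] by auto
  then obtain f where f: "inj_on f {..<3}" "\<And>t. t < 3 \<Longrightarrow> f t < n"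
    and f_nz: "\<And>t. t < 3 \<Longrightarrow> ?\<Theta> (f t) t \<noteq> 0"
    using nonzero_transversal[where r = 3 and n = n and A = C and \<Theta> = "?\<Theta>" and Q = "?Q"] arr_poly_nonzero by blast
  have f_ne: "f 0 \<noteq> f 1" "f 0 \<noteq> f 2" "f 1 \<noteq> f 2"
    using f(1) by (auto dest: inj_onD)
  have d_f: "K \<le> d (f 0)" "L \<le> d (f 1)" "B \<le> d (f 2)"
    using d_ge[OF f(2)[of 0] _ f_nz[of 0]] d_ge[OF f(2)[of 1] _ f_nz[of 1]]
      d_ge[OF f(2)[of 2] _ f_nz[of 2]] by (simp_all only: mh)
  have only: "?\<Theta> j 0 = 0" if j: "j < n" "j \<noteq> f 0" for j
  proof -
    have sum3: "d (f 0) + d (f 1) + d (f 2) = (\<Sum>j\<in>{f 0, f 1, f 2}. d j)"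
      using f_ne by simp
    have "(\<Sum>j\<in>{f 0, f 1, f 2}. d j) + (if j \<in> {f 0, f 1, f 2} then 0 else d j) =
        (\<Sum>j\<in>insert j {f 0, f 1, f 2}. d j)"
      by (simp add: insert_absorb)
    also have "\<dots> \<le> (\<Sum>j<n. d j)"
      by (rule sum_mono2) (use f(2)[of 0] f(2)[of 1] f(2)[of 2] j in auto)
    finally have "d (f 0) + d (f 1) + d (f 2) + (if j \<in> {f 0, f 1, f 2} then 0 else d j)
        \<le> K + L + B + \<rho>"
      unfolding sum3 using sum_d by (rule order_trans)
    moreover have "j = f 1 \<or> j = f 2 \<or> j \<notin> {f 0, f 1, f 2}" using j by auto
    ultimately have "d j < K"
      using d_f K(1) unfolding L_def B_def by (elim disjE) (simp_all split: if_splits)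
    then show ?thesis using d_ge[of j 0] j mh by fastforce
  qed
  have "h 1 \<in> A" "h 1 \<noteq> h 0" using h h_eq by auto
  from single_basis_value[OF \<theta> h[of 0] f(2)[of 0] only this] obtain c0
    where c0: "c0 \<noteq> 0" "?\<Theta> (f 0) 0 = mconst c0 * \<alpha> (h 0) ^ K"
    unfolding mh by auto
  define \<phi> where "\<phi> = \<theta> (f 0)"
  have \<phi>D: "\<phi> \<in> log_vecs n A a m" unfolding \<phi>_def by (intro \<theta>D f) simp
  have "\<exists>g. eval_form n (a H) \<phi> = \<alpha> H ^ m H * g" if "H \<in> A" for H
    using \<phi>D that by (auto simp: log_vecs_def dvd_def)
  then have "\<forall>H. \<exists>g. H \<in> A \<longrightarrow> eval_form n (a H) \<phi> = \<alpha> H ^ m H * g" by blast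
  from choice[OF this] obtain g
    where g: "\<And>H. H \<in> A \<Longrightarrow> eval_form n (a H) \<phi> = \<alpha> H ^ m H * g H" by blast
  define s where "s = (\<lambda>i. mconst (e1 i) * mvar 0 + mconst (e2 i) * mvar 1 :: 'k mpoly)"
  have \<tau>: "subst s (lin_form n b) =
      mconst (pairing n b e1) * mvar 0 + mconst (pairing n b e2) * mvar 1" for b
    by (simp add: subst_lin_form s_def eval_form_add eval_form_const)
  have pair0: "pairing n (a (h 0)) v = c1 * pairing n (a (h 1)) v + c2 * pairing n (a (h 2)) v
      + (\<Sum>t\<in>T. c t * pairing n (a t) v)" for v
    by (simp add: pairing_def relation ring_distribs sum.distrib sum_distrib_left sum_distrib_right
        mult.assoc sum.swap[of _ T])
  have \<tau>0: "subst s (\<alpha> (h 0)) = mconst c1 * mvar 0 + mconst c2 * mvar 1"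
    by (simp add: \<tau> pair0 e del: One_nat_def)
  have \<tau>1: "subst s (\<alpha> (h 1)) = mvar 0" "subst s (\<alpha> (h 2)) = mvar 1"
    by (simp_all add: \<tau> e del: One_nat_def)
  have \<tau>T: "subst s (eval_form n (a t) \<phi>) = 0" if "t \<in> T" for t
  proof -
    have "t \<in> A" "m t > 0" using T that m_pos by auto
    then show ?thesis using e that by (simp add: g subst_mult subst_power \<tau>)
  qed
  have "eval_form n (a (h 0)) \<phi> = mconst c1 * eval_form n (a (h 1)) \<phi>
      + mconst c2 * eval_form n (a (h 2)) \<phi> + (\<Sum>t\<in>T. mconst (c t) * eval_form n (a t) \<phi>)"
    unfolding eval_form_form_comb[symmetric]
    unfolding eval_form_form_scale[symmetric] eval_form_form_add[symmetric]
    by (rule eval_form_cong) (simp_all add: relation)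
  then have "subst s (mconst c0 * \<alpha> (h 0) ^ K) = mconst c1 * subst s (eval_form n (a (h 1)) \<phi>)
      + mconst c2 * subst s (eval_form n (a (h 2)) \<phi>)"
    unfolding c0(2)[folded \<phi>_def] by (simp add: subst_add subst_mult subst_sum \<tau>T)
  then have eq: "mconst c0 * (mconst c1 * mvar 0 + mconst c2 * mvar 1) ^ K =
      mvar 0 ^ L * (mconst c1 * subst s (g (h 1))) + mvar 1 ^ B * (mconst c2 * subst s (g (h 2)))"
    using h[of 1] h[of 2] by (simp add: g mh \<tau>0 \<tau>1 subst_mult subst_power ac_simps del: One_nat_def)
  let ?t = "Poly_Mapping.single 0 (L - 1) + Poly_Mapping.single (1::nat) (\<rho> + 2)"
  have "expo ?t 0 = L - 1" "expo ?t 1 = \<rho> + 2"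
    by (simp_all add: lookup_add lookup_single)
  moreover have "\<not> L \<le> L - 1" "\<not> B \<le> \<rho> + 2" using K(1) by (auto simp: L_def B_def)
  ultimately have "coef (mvar 0 ^ L * p) ?t = 0" "coef (mvar 1 ^ B * p) ?t = 0" for p :: "'k mpoly"
    by (metis coef_mvar_power_mult)+
  then have "coef (mconst c0 * (mconst c1 * mvar 0 + mconst c2 * mvar 1) ^ K) ?t = 0"
    unfolding eq by (simp add: lookup_add)
  moreover have "L - 1 + (\<rho> + 2) = K" using K(1) by (simp add: L_def)
  ultimately have "c0 * (of_nat (K choose (L - 1)) * c1 ^ (L - 1) * c2 ^ (\<rho> + 2)) = 0"
    by (simp only: coef_mconst_mult coef_binary_power)
  moreover have "K choose (L - 1) = K choose (\<rho> + 2)"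
    using \<open>L - 1 + (\<rho> + 2) = K\<close> binomial_symmetric[of "\<rho> + 2" K] by auto
  ultimately show False using K(2) c c0 by simp
qed

end

section \<open>Binary forms\<close>

primrec binary_forms :: "'k::field mpoly \<Rightarrow> 'k mpoly \<Rightarrow> nat \<Rightarrow> 'k mpoly set" where
  "binary_forms p q 0 = range mconst"
| "binary_forms p q (Suc e) = {p * f + q * g |f g. f \<in> binary_forms p q e \<and> g \<in> binary_forms p q e}"

lemma binary_forms_const: "mconst c \<in> binary_forms p q 0"
  by simp

lemma binary_forms_SucI:
  "f \<in> binary_forms p q e \<Longrightarrow> g \<in> binary_forms p q e \<Longrightarrow> p * f + q * g \<in> binary_forms p q (Suc e)"
  by (simp only: binary_forms.simps) blast

lemma binary_forms_0: "0 \<in> binary_forms p q e"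
proof (induction e)
  case 0
  show ?case using binary_forms_const[of 0] by simp
next
  case (Suc e)
  from binary_forms_SucI[OF this this] show ?case by simp
qed

lemma binary_forms_left: "f \<in> binary_forms p q e \<Longrightarrow> p * f \<in> binary_forms p q (Suc e)"
  using binary_forms_SucI[OF _ binary_forms_0] by fastforce

lemma binary_forms_right: "f \<in> binary_forms p q e \<Longrightarrow> q * f \<in> binary_forms p q (Suc e)"
  using binary_forms_SucI[OF binary_forms_0] by fastforce

lemma binary_forms_add:
  "f \<in> binary_forms p q e \<Longrightarrow> g \<in> binary_forms p q e \<Longrightarrow> f + g \<in> binary_forms p q e"
proof (induction e arbitrary: f g)
  case 0
  then show ?case by (auto simp flip: mconst_add)
next
  case (Suc e)
  then obtain f1 f2 g1 g2 where "f = p * f1 + q * f2" "g = p * g1 + q * g2"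
    "f1 \<in> binary_forms p q e" "f2 \<in> binary_forms p q e"
    "g1 \<in> binary_forms p q e" "g2 \<in> binary_forms p q e" by auto
  then have "f + g = p * (f1 + g1) + q * (f2 + g2)"
    "f1 + g1 \<in> binary_forms p q e" "f2 + g2 \<in> binary_forms p q e"
    using Suc.IH by (auto simp: algebra_simps)
  then show ?case by auto
qed

declare binary_forms.simps(2) [simp del]

lemma binary_forms_induct [consumes 1, case_names const left right add]:
  assumes "f \<in> binary_forms p q e" and "\<And>c. R (mconst c) 0"
    and "\<And>f e. f \<in> binary_forms p q e \<Longrightarrow> R f e \<Longrightarrow> R (p * f) (Suc e)"
    and "\<And>f e. f \<in> binary_forms p q e \<Longrightarrow> R f e \<Longrightarrow> R (q * f) (Suc e)"
    and "\<And>f e g. R f e \<Longrightarrow> R g e \<Longrightarrow> R (f + g) e"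
  shows "R f e"
  using assms(1)
proof (induction e arbitrary: f)
  case (Suc e)
  then show ?case using assms(3-5) by (auto simp: binary_forms.simps(2))
qed (use assms(2) in auto)

lemma binary_forms_scale: "f \<in> binary_forms p q e \<Longrightarrow> mconst c * f \<in> binary_forms p q e"
proof (induction rule: binary_forms_induct)
  case (const d)
  then show ?case using binary_forms_const[of "c * d"] by (simp add: mconst_mult)
next
  case (left f e)
  then show ?case using binary_forms_left[OF left.IH] by (simp add: ac_simps)
next
  case (right f e)
  then show ?case using binary_forms_right[OF right.IH] by (simp add: ac_simps)
qed (simp add: ring_distribs binary_forms_add)

lemma binary_forms_linear_mult:
  assumes "f \<in> binary_forms p q e"
  shows "(mconst x * p + mconst y * q) * f \<in> binary_forms p q (Suc e)"
proof -
  have "mconst x * (p * f) + mconst y * (q * f) \<in> binary_forms p q (Suc e)"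
    by (intro binary_forms_add binary_forms_scale binary_forms_left binary_forms_right assms)
  then show ?thesis by (simp add: ring_distribs mult.assoc)
qed

lemma binary_forms_change:
  assumes "f \<in> binary_forms p q e"
    and "p = mconst x * p' + mconst y * q'" "q = mconst z * p' + mconst w * q'"
  shows "f \<in> binary_forms p' q' e"
  using assms(1)
proof (induction rule: binary_forms_induct)
  case (left f e)
  then show ?case unfolding assms(2) using binary_forms_linear_mult by blast
next
  case (right f e)
  then show ?case unfolding assms(3) using binary_forms_linear_mult by blast
qed (auto intro: binary_forms_const binary_forms_add)

lemma binary_forms_commute: "f \<in> binary_forms p q e \<Longrightarrow> f \<in> binary_forms q p e"
  using binary_forms_change[of f p q e 0 q 1 p 1 0] by simp

lemma binary_forms_power_mult:
  "f \<in> binary_forms p q e \<Longrightarrow> p ^ k * f \<in> binary_forms p q (k + e)"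
  by (induction k) (auto simp: mult.assoc intro: binary_forms_left)

lemma binary_forms_split:
  assumes "f \<in> binary_forms p q e"
  shows "\<exists>c g. f = mconst c * q ^ e + p * g \<and>
    (case e of 0 \<Rightarrow> g = 0 | Suc e' \<Rightarrow> g \<in> binary_forms p q e')"
  using assms
proof (induction rule: binary_forms_induct)
  case (const c)
  show ?case by (intro exI[of _ c] exI[of _ 0]) simp
next
  case (left f e)
  then show ?case by (intro exI[of _ 0] exI[of _ f]) simp
next
  case (right f e)
  then obtain c g where "f = mconst c * q ^ e + p * g"
    and g: "case e of 0 \<Rightarrow> g = 0 | Suc e' \<Rightarrow> g \<in> binary_forms p q e'" by blast
  then have "q * f = mconst c * q ^ Suc e + p * (q * g)" by (simp add: ring_distribs ac_simps)
  moreover have "q * g \<in> binary_forms p q e"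
    using g binary_forms_0 by (cases e) (auto intro: binary_forms_right)
  ultimately show ?case by auto
next
  case (add f e g)
  then obtain c f' d g' where "f = mconst c * q ^ e + p * f'" "g = mconst d * q ^ e + p * g'"
    and fg: "case e of 0 \<Rightarrow> f' = 0 | Suc e' \<Rightarrow> f' \<in> binary_forms p q e'"
      "case e of 0 \<Rightarrow> g' = 0 | Suc e' \<Rightarrow> g' \<in> binary_forms p q e'" by blast
  then have "f + g = mconst (c + d) * q ^ e + p * (f' + g')"
    by (simp add: mconst_add ring_distribs)
  moreover have "case e of 0 \<Rightarrow> f' + g' = 0 | Suc e' \<Rightarrow> f' + g' \<in> binary_forms p q e'"
    using fg by (cases e) (auto intro: binary_forms_add)
  ultimately show ?case by blast
qed

lemma prime_dvd_const_power:
  assumes "prime_elem p" "q = 0 \<or> \<not> p dvd q" "p dvd mconst c * q ^ e"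
  shows "mconst c * q ^ e = 0"
proof (rule ccontr)
  assume nz: "mconst c * q ^ e \<noteq> 0"
  then have "mconst (1 / c) * mconst c = 1" by (intro mconst_inverse) auto
  then have "mconst c dvd 1" by (metis dvd_triv_right)
  then have "\<not> p dvd mconst c" using assms(1) by (auto simp: prime_elem_def dest: dvd_trans)
  then have "p dvd q ^ e" using assms by (auto dest: prime_elem_dvd_multD)
  then have "q = 0 \<and> e > 0"
    using assms(1,2) prime_elem_dvd_power[of p q e] by (cases e) (auto simp: prime_elem_def)
  then show False using nz by simp
qed

text \<open>A binary form of degree \<open>d\<close> in \<open>p\<close> and \<open>q\<close> that is divisible by \<open>p ^ m\<close> has, modulo
  \<open>p\<close>, a constant multiple of a power of \<open>q\<close> as quotient. The case \<open>q = 0\<close> covers the forms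
  in \<open>p\<close> alone.\<close>

lemma binary_forms_quotient:
  assumes p: "prime_elem p" "q = 0 \<or> \<not> p dvd q"
    and f: "f \<in> binary_forms p q d" "p ^ m dvd f"
  shows "\<exists>c g. f = p ^ m * (mconst c * q ^ (d - m) + p * g) \<and> (d < m \<longrightarrow> c = 0)"
  using f
proof (induction m arbitrary: f d)
  case 0
  then show ?case using binary_forms_split[of f p q d] by auto
next
  case (Suc m)
  from binary_forms_split[OF Suc.prems(1)] obtain c g where fg: "f = mconst c * q ^ d + p * g"
    and g: "case d of 0 \<Rightarrow> g = 0 | Suc d' \<Rightarrow> g \<in> binary_forms p q d'" by blast
  have "p dvd f" using Suc.prems(2) by (auto dest: dvd_mult_left)
  then have "p dvd mconst c * q ^ d" unfolding fg by (simp add: dvd_add_left_iff)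
  then have "mconst c * q ^ d = 0" by (rule prime_dvd_const_power[OF p])
  then have f: "f = p * g" using fg by simp
  show ?case
  proof (cases d)
    case 0
    then show ?thesis using f g by (intro exI[of _ 0]) auto
  next
    case d: (Suc d')
    have "p ^ m dvd g" using Suc.prems(2) p(1) unfolding f by (auto simp: prime_elem_def)
    moreover have "g \<in> binary_forms p q d'" using g d by simp
    ultimately obtain c g' where "g = p ^ m * (mconst c * q ^ (d' - m) + p * g')" "d' < m \<longrightarrow> c = 0"
      using Suc.IH by blast
    then show ?thesis unfolding f d
      by (intro exI[of _ c] exI[of _ g']) (auto simp: mult.assoc)
  qed
qed

section \<open>Elementary changes of bases\<close>

lemma sum_update:
  fixes j0 :: nat
  assumes "j0 < n"
  shows "(\<Sum>j<n. c j * (\<theta>(j0 := w)) j i) =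
    (\<Sum>j<n. c j * \<theta> j i) + c j0 * (w i - \<theta> j0 i :: 'r::comm_ring_1)"
proof -
  have "(\<Sum>j<n. c j * (\<theta>(j0 := w)) j i) =
      (\<Sum>j<n. c j * \<theta> j i + (if j = j0 then c j0 * (w i - \<theta> j0 i) else 0))"
    by (rule sum.cong) (auto simp: algebra_simps)
  then show ?thesis using assms by (simp add: sum.distrib)
qed

lemma sum_coeff_update:
  fixes j0 :: nat
  assumes "j0 < n"
  shows "(\<Sum>j<n. (c(j0 := d)) j * \<theta> j i) = (\<Sum>j<n. c j * \<theta> j i) + (d - c j0) * (\<theta> j0 i :: 'r::comm_ring_1)"
proof -
  have "(\<Sum>j<n. (c(j0 := d)) j * \<theta> j i) =
      (\<Sum>j<n. c j * \<theta> j i + (if j = j0 then (d - c j0) * \<theta> j0 i else 0))"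
    by (rule sum.cong) (auto simp: algebra_simps)
  then show ?thesis using assms by (simp add: sum.distrib)
qed

lemma vec_basis_shear:
  assumes \<theta>: "vec_basis n M \<theta>" and ij: "i < n" "j < n" "i \<noteq> j"
    and w: "(\<lambda>x. \<theta> i x - h * \<theta> j x) \<in> M"
  shows "vec_basis n M (\<theta>(i := \<lambda>x. \<theta> i x - h * \<theta> j x))"
proof -
  have eq: "(\<Sum>k<n. c k * (\<theta>(i := \<lambda>x. \<theta> i x - h * \<theta> j x)) k x) =
      (\<Sum>k<n. (c(j := c j - c i * h)) k * \<theta> k x)" for c x
    unfolding sum_update[OF ij(1)] sum_coeff_update[OF ij(2)] by (simp add: algebra_simps)
  show ?thesis
    unfolding vec_basis_def eq
  proof (intro conjI ballI allI impI)
    fix v assume "v \<in> M"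
    then obtain c where c: "v = (\<lambda>x. \<Sum>k<n. c k * \<theta> k x)" using \<theta> unfolding vec_basis_def by blast
    let ?c = "c(j := c j + c i * h)"
    have "?c(j := ?c j - ?c i * h) = c" using ij by auto
    then show "\<exists>c. v = (\<lambda>x. \<Sum>k<n. (c(j := c j - c i * h)) k * \<theta> k x)"
      unfolding c by (intro exI[of _ ?c]) (simp only:)
  next
    fix c k assume "\<forall>x. (\<Sum>k<n. (c(j := c j - c i * h)) k * \<theta> k x) = 0" and k: "k < n"
    then have 0: "(c(j := c j - c i * h)) k = 0" if "k < n" for k
      using \<theta> that unfolding vec_basis_def by blast
    have "c i = 0" using 0[OF ij(1)] ij(3) by simp
    then show "c k = 0" using 0[OF k] by (cases "k = j") auto
  qed (use \<theta> w in \<open>auto simp: vec_basis_def\<close>)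
qed

lemma vec_basis_scale:
  assumes \<theta>: "vec_basis n M \<theta>" and "M' \<subseteq> M" and j0: "j0 < n"
    and in_M': "\<And>j. j < n \<Longrightarrow> j \<noteq> j0 \<Longrightarrow> \<theta> j \<in> M'" "(\<lambda>i. p * \<theta> j0 i) \<in> M'"
    and dvd: "\<And>c. (\<lambda>i. \<Sum>j<n. c j * \<theta> j i) \<in> M' \<Longrightarrow> p dvd c j0" and "p \<noteq> 0"
  shows "vec_basis n M' (\<theta>(j0 := \<lambda>i. p * \<theta> j0 i))"
proof -
  have eq: "(\<Sum>k<n. c k * (\<theta>(j0 := \<lambda>i. p * \<theta> j0 i)) k x) = (\<Sum>k<n. (c(j0 := c j0 * p)) k * \<theta> k x)" for c x
    unfolding sum_update[OF j0] sum_coeff_update[OF j0] by (simp add: algebra_simps)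
  show ?thesis
    unfolding vec_basis_def eq
  proof (intro conjI ballI allI impI)
    fix v assume v: "v \<in> M'"
    then have "v \<in> M" using \<open>M' \<subseteq> M\<close> by blast
    then obtain c where c: "v = (\<lambda>x. \<Sum>k<n. c k * \<theta> k x)" using \<theta> unfolding vec_basis_def by blast
    then obtain d where d: "c j0 = p * d" using dvd v by (auto simp: dvd_def)
    let ?c = "c(j0 := d)"
    have "?c(j0 := ?c j0 * p) = c" using d by (auto simp: mult.commute)
    then show "\<exists>c. v = (\<lambda>x. \<Sum>k<n. (c(j0 := c j0 * p)) k * \<theta> k x)"
      unfolding c by (intro exI[of _ ?c]) (simp only:)
  next
    fix c k assume "\<forall>x. (\<Sum>k<n. (c(j0 := c j0 * p)) k * \<theta> k x) = 0" and k: "k < n"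
    then have "(c(j0 := c j0 * p)) k = 0" using \<theta> unfolding vec_basis_def by blast
    then show "c k = 0" using \<open>p \<noteq> 0\<close> by (cases "k = j0") auto
  qed (use in_M' in auto)
qed

section \<open>Products of arrangements of rank at most two are totally free\<close>

text \<open>The vectors \<open>D j\<close> and the forms \<open>b j\<close> are dual bases, and the involution \<open>\<pi>\<close>
  divides the indices into blocks of at most two elements. Each equation depends on the
  coordinates of one block only.\<close>

locale block_arrangement =
  fixes n :: nat and A :: "'h set" and a :: "'h \<Rightarrow> nat \<Rightarrow> 'k::field"
    and D b :: "nat \<Rightarrow> nat \<Rightarrow> 'k" and \<pi> :: "nat \<Rightarrow> nat"
  assumes finite_A: "finite A"
    and dual: "j < n \<Longrightarrow> k < n \<Longrightarrow> pairing n (b j) (D k) = (if j = k then 1 else 0)"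
    and complete: "i < n \<Longrightarrow> i' < n \<Longrightarrow> (\<Sum>j<n. D j i * b j i') = (if i = i' then 1 else 0)"
    and D_support: "i \<ge> n \<Longrightarrow> D j i = 0"
    and \<pi>: "j < n \<Longrightarrow> \<pi> j < n" "j < n \<Longrightarrow> \<pi> (\<pi> j) = j"
    and block: "H \<in> A \<Longrightarrow> \<exists>j<n. \<forall>k<n. k \<noteq> j \<longrightarrow> k \<noteq> \<pi> j \<longrightarrow> pairing n (a H) (D k) = 0"
    and nonzero: "H \<in> A \<Longrightarrow> \<exists>w. pairing n (a H) w \<noteq> 0"
begin

abbreviation coord :: "(nat \<Rightarrow> 'k mpoly) \<Rightarrow> nat \<Rightarrow> 'k mpoly"
  where "coord v k \<equiv> eval_form n (b k) v"

abbreviation P :: "nat \<Rightarrow> 'k mpoly" where "P k \<equiv> lin_form n (b k)"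

lemma form_expand:
  assumes "i < n" shows "c i = (\<Sum>k<n. pairing n c (D k) * b k i)"
proof -
  have "(\<Sum>k<n. pairing n c (D k) * b k i) = (\<Sum>i'<n. c i' * (if i' = i then 1 else 0))"
    unfolding pairing_def matrix_sum_assoc using assms complete by simp
  then show ?thesis using assms by (simp add: if_distrib[of "\<lambda>x. _ * x"] cong: if_cong)
qed

lemma eval_form_expand: "eval_form n c v = (\<Sum>k<n. mconst (pairing n c (D k)) * coord v k)"
  unfolding eval_form_form_comb[symmetric] by (rule eval_form_cong) (rule form_expand, simp_all)

lemma pairing_expand: "pairing n c w = (\<Sum>k<n. pairing n c (D k) * pairing n (b k) w)"
proof -
  have "pairing n c w = (\<Sum>i<n. (\<Sum>k<n. pairing n c (D k) * b k i) * w i)"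
    unfolding pairing_def[of n c w] by (simp flip: form_expand)
  then show ?thesis unfolding matrix_sum_assoc by (simp only: pairing_def[of n "b _" w])
qed

lemma constant_basis: "vec_basis n (poly_vecs n) (\<lambda>j i. mconst (D j i))"
  unfolding vec_basis_def
proof (intro conjI ballI allI impI)
  fix v :: "nat \<Rightarrow> 'k mpoly" assume v: "v \<in> poly_vecs n"
  have "v i = (\<Sum>j<n. coord v j * mconst (D j i))" for i
  proof (cases "i < n")
    case True
    have "(\<Sum>j<n. coord v j * mconst (D j i)) = (\<Sum>j<n. mconst (D j i) * coord v j)"
      by (simp add: mult.commute)
    also have "\<dots> = eval_form n (\<lambda>i'. \<Sum>j<n. D j i * b j i') v"
      by (simp add: eval_form_form_comb)
    also have "\<dots> = (\<Sum>i'<n. if i' = i then v i' else 0)"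
      unfolding eval_form_def using True complete by (intro sum.cong) auto
    finally show ?thesis using True by simp
  next
    case False
    then show ?thesis using v by (simp add: poly_vecs_def D_support)
  qed
  then have "v = (\<lambda>i. \<Sum>j<n. coord v j * mconst (D j i))" by (rule ext)
  then show "\<exists>c. v = (\<lambda>i. \<Sum>j<n. c j * mconst (D j i))"
    by (rule exI[of _ "coord v"])
next
  fix c k assume 0: "\<forall>i. (\<Sum>j<n. c j * mconst (D j i)) = 0" and k: "k < n"
  have "0 = coord (\<lambda>i. \<Sum>j<n. c j * mconst (D j i)) k" using 0 by simp
  also have "\<dots> = (\<Sum>j<n. c j * coord (\<lambda>i. mconst (D j i)) k)" by (rule eval_form_comb)
  also have "\<dots> = (\<Sum>j<n. if j = k then c j else 0)"
    using k dual eval_form_const[of n "b k" "D _" 1] by (intro sum.cong) auto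
  finally show "c k = 0" using k by simp
qed (auto simp: poly_vecs_def D_support)

text \<open>The basis elements belong to blocks, and their coordinates are binary forms.\<close>

definition block_basis :: "('h \<Rightarrow> nat) \<Rightarrow> (nat \<Rightarrow> nat \<Rightarrow> 'k mpoly) \<Rightarrow> (nat \<Rightarrow> nat) \<Rightarrow> bool"
  where "block_basis m \<theta> d \<longleftrightarrow> vec_basis n (log_vecs n A a m) \<theta> \<and>
    (\<forall>j<n. \<forall>k<n. coord (\<theta> j) k \<in>
      (if k = j \<or> k = \<pi> j then binary_forms (P j) (P (\<pi> j)) (d j) else {0}))"

text \<open>Raising the multiplicity of \<open>H\<close> by one affects the two basis elements of one block only.
  Modulo \<open>\<alpha>\<close>, their values at \<open>\<alpha> = \<alpha> H\<close>, divided by \<open>\<alpha> ^ m H\<close>, are constant multiples of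
  powers of one form \<open>\<beta>\<close>. The element with the lower power serves to make the other value
  divisible by \<open>\<alpha>\<close>, and is then multiplied by \<open>\<alpha>\<close>.\<close>

lemma block_basis_step:
  assumes basis: "block_basis m \<theta> d" and H: "H \<in> A"
  shows "\<exists>\<theta> d. block_basis (m(H := Suc (m H))) \<theta> d"
proof -
  let ?\<alpha> = "lin_form n (a H)" and ?k = "m H"
  define M where "M = log_vecs n A a m"
  define M' where "M' = log_vecs n A a (m(H := Suc ?k))"
  have M': "v \<in> M' \<longleftrightarrow> v \<in> M \<and> ?\<alpha> ^ Suc ?k dvd eval_form n (a H) v" for v
  proof
    assume v: "v \<in> M'"
    have "lin_form n (a H') ^ m H' dvd eval_form n (a H') v" if "H' \<in> A" for H'
    proof -
      have "lin_form n (a H') ^ (m(H := Suc ?k)) H' dvd eval_form n (a H') v"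
        using v that by (simp add: M'_def log_vecs_def del: fun_upd_apply)
      then show ?thesis by (rule power_le_dvd) simp
    qed
    moreover have "?\<alpha> ^ (m(H := Suc ?k)) H dvd eval_form n (a H) v"
      using v H by (simp add: M'_def log_vecs_def del: fun_upd_apply)
    ultimately show "v \<in> M \<and> ?\<alpha> ^ Suc ?k dvd eval_form n (a H) v"
      using v by (simp add: M_def M'_def log_vecs_def)
  next
    assume "v \<in> M \<and> ?\<alpha> ^ Suc ?k dvd eval_form n (a H) v"
    then show "v \<in> M'" by (simp add: M_def M'_def log_vecs_def)
  qed
  have \<theta>: "vec_basis n M \<theta>"
    and coord0: "\<And>j k. j < n \<Longrightarrow> k < n \<Longrightarrow> k \<noteq> j \<Longrightarrow> k \<noteq> \<pi> j \<Longrightarrow> coord (\<theta> j) k = 0"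
    and coord: "\<And>j k. j < n \<Longrightarrow> k < n \<Longrightarrow> k = j \<or> k = \<pi> j \<Longrightarrow>
      coord (\<theta> j) k \<in> binary_forms (P j) (P (\<pi> j)) (d j)"
    using basis unfolding block_basis_def M_def by (metis singletonD)+
  have \<theta>M: "\<theta> j \<in> M" if "j < n" for j using \<theta> that by (simp add: vec_basis_def)
  have prime: "prime_elem ?\<alpha>" using nonzero[OF H] lin_form_prime by blast
  then have \<alpha>0: "?\<alpha> \<noteq> 0" by (auto simp: prime_elem_def)
  obtain j where j: "j < n" and "\<forall>k<n. k \<noteq> j \<longrightarrow> k \<noteq> \<pi> j \<longrightarrow> pairing n (a H) (D k) = 0"
    and x0: "pairing n (a H) (D j) \<noteq> 0"
  proof -
    obtain j where j: "j < n" "\<forall>k<n. k \<noteq> j \<longrightarrow> k \<noteq> \<pi> j \<longrightarrow> pairing n (a H) (D k) = 0"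
      using block[OF H] by blast
    obtain w where "pairing n (a H) w \<noteq> 0" using nonzero[OF H] by blast
    then obtain k where k: "k < n" "pairing n (a H) (D k) \<noteq> 0"
      unfolding pairing_expand[of "a H" w] by (elim sum.not_neutral_contains_not_neutral) auto
    then have "k = j \<or> k = \<pi> j" using j by blast
    then show thesis using that[of k] k j \<pi> by metis
  qed
  then have off: "pairing n (a H) (D k) = 0" if "k < n" "k \<noteq> j" "k \<noteq> \<pi> j" for k
    using that by blast
  define x y where "x = pairing n (a H) (D j)"
    and "y = (if \<pi> j = j then 0 else pairing n (a H) (D (\<pi> j)))"
  have ev: "eval_form n (a H) v = mconst x * coord v j + mconst y * coord v (\<pi> j)" for v
  proof -
    have "eval_form n (a H) v = (\<Sum>k<n. (if k = j then mconst x * coord v j else 0)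
        + (if k = \<pi> j then mconst y * coord v (\<pi> j) else 0))"
      unfolding eval_form_expand[of "a H" v]
      by (rule sum.cong) (auto simp: x_def y_def off)
    then show ?thesis using j \<pi> by (simp add: sum.distrib)
  qed
  have "x \<noteq> 0" using x0 by (simp add: x_def)
  (* If the block of j has one element, all values are multiples of powers of \<alpha>; this is the case
     of binary forms in \<alpha> and 0. *)
  define \<beta> where "\<beta> = (if \<pi> j = j then 0 else P (\<pi> j))"
  have \<beta>: "\<beta> = 0 \<or> \<not> ?\<alpha> dvd \<beta>"
  proof (cases "\<pi> j = j")
    case False
    let ?w = "\<lambda>i. y * D j i - x * D (\<pi> j) i"
    have pw: "pairing n c ?w = y * pairing n c (D j) - x * pairing n c (D (\<pi> j))" for c
      by (simp add: pairing_def right_diff_distrib sum_subtractf sum_distrib_left ac_simps)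
    have w1: "pairing n (a H) ?w = 0" unfolding pw using False by (simp add: x_def y_def)
    have w2: "pairing n (b (\<pi> j)) ?w \<noteq> 0" using False j \<pi> \<open>x \<noteq> 0\<close> by (simp add: pw dual)
    show ?thesis using lin_form_not_dvd[OF w1 w2] False by (simp add: \<beta>_def)
  qed (simp add: \<beta>_def)
  have Pj: "P j = mconst (1 / x) * ?\<alpha> + mconst (- y / x) * \<beta>"
  proof -
    have "mconst (1 / x) * ?\<alpha> = mconst (1 / x) * mconst x * P j + mconst (y / x) * \<beta>"
      unfolding ev by (simp add: \<beta>_def y_def ring_distribs mult.assoc flip: mconst_mult)
        (simp add: mconst_mult[of "1 / x"] mconst_mult[of "y"] flip: mult.assoc mconst_mult)
    then show ?thesis using mconst_inverse[OF \<open>x \<noteq> 0\<close>] by (simp add: mconst_uminus)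
  qed
  have P\<pi>j: "\<exists>z w. P (\<pi> j) = mconst z * ?\<alpha> + mconst w * \<beta>"
  proof (cases "\<pi> j = j")
    case True
    then show ?thesis using Pj by metis
  next
    case False
    then show ?thesis by (intro exI[of _ 0] exI[of _ 1]) (simp add: \<beta>_def)
  qed
  have to_\<alpha>\<beta>: "f \<in> binary_forms ?\<alpha> \<beta> e" if "f \<in> binary_forms (P l) (P (\<pi> l)) e" "l = j \<or> l = \<pi> j" for f l e
  proof -
    have "f \<in> binary_forms (P j) (P (\<pi> j)) e"
      using that \<pi>(2)[OF j] binary_forms_commute by metis
    then show ?thesis using binary_forms_change Pj P\<pi>j by blast
  qed
  have in_block: "l = j \<or> l = \<pi> j" if "l < n" "eval_form n (a H) (\<theta> l) \<noteq> 0" for l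
  proof (rule ccontr)
    assume l: "\<not> ?thesis"
    then have "j \<noteq> l" "j \<noteq> \<pi> l" "\<pi> j \<noteq> l" "\<pi> j \<noteq> \<pi> l" using \<pi>(2)[OF j] \<pi>(2)[OF that(1)] by metis+
    then have "coord (\<theta> l) j = 0" "coord (\<theta> l) (\<pi> j) = 0"
      using coord0 that(1) j \<pi>(1)[OF j] by simp_all
    then show False using that(2) by (simp add: ev)
  qed
  have quot: "\<exists>c g. eval_form n (a H) (\<theta> l) = ?\<alpha> ^ ?k * (mconst c * \<beta> ^ (d l - ?k) + ?\<alpha> * g) \<and>
      (d l < ?k \<longrightarrow> c = 0)" if l: "l < n" for l
  proof (cases "l = j \<or> l = \<pi> j")
    case True
    then have "j = l \<or> j = \<pi> l" "\<pi> j = l \<or> \<pi> j = \<pi> l" using \<pi>(2)[OF j] by auto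
    then have "coord (\<theta> l) j \<in> binary_forms (P l) (P (\<pi> l)) (d l)"
      "coord (\<theta> l) (\<pi> j) \<in> binary_forms (P l) (P (\<pi> l)) (d l)"
      using coord l j \<pi>(1)[OF j] by simp_all
    then have "eval_form n (a H) (\<theta> l) \<in> binary_forms (P l) (P (\<pi> l)) (d l)"
      unfolding ev by (intro binary_forms_add binary_forms_scale)
    moreover have "?\<alpha> ^ ?k dvd eval_form n (a H) (\<theta> l)"
      using \<theta>M[OF l] H by (auto simp: M_def log_vecs_def)
    ultimately show ?thesis using binary_forms_quotient[OF prime \<beta>] to_\<alpha>\<beta> True by blast
  next
    case False
    then have "eval_form n (a H) (\<theta> l) = 0" using in_block l by blast
    then show ?thesis by (intro exI[of _ 0]) auto
  qed
  from quot have "\<forall>l. \<exists>cg. l < n \<longrightarrow> eval_form n (a H) (\<theta> l) =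
      ?\<alpha> ^ ?k * (mconst (fst cg) * \<beta> ^ (d l - ?k) + ?\<alpha> * snd cg) \<and> (d l < ?k \<longrightarrow> fst cg = 0)"
    by fastforce
  from choice[OF this] obtain cg where cg: "\<And>l. l < n \<Longrightarrow> eval_form n (a H) (\<theta> l) =
      ?\<alpha> ^ ?k * (mconst (fst (cg l)) * \<beta> ^ (d l - ?k) + ?\<alpha> * snd (cg l)) \<and>
        (d l < ?k \<longrightarrow> fst (cg l) = 0)"
    by blast
  define c g where "c = (\<lambda>l. fst (cg l))" and "g = (\<lambda>l. snd (cg l))"
  define r where "r = (\<lambda>l. mconst (c l) * \<beta> ^ (d l - ?k))"
  have val: "eval_form n (a H) (\<theta> l) = ?\<alpha> ^ ?k * (r l + ?\<alpha> * g l)" if "l < n" for l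
    using cg[OF that] by (simp add: c_def g_def r_def)
  have c_deg: "?k \<le> d l" if "l < n" "c l \<noteq> 0" for l
    using cg[OF that(1)] that(2) by (auto simp: c_def)
  have r_block: "l = j \<or> l = \<pi> j" if "l < n" "r l \<noteq> 0" for l
  proof (rule in_block[OF that(1)], rule notI)
    assume "eval_form n (a H) (\<theta> l) = 0"
    then have "r l = ?\<alpha> * (- g l)" using val[OF that(1)] \<alpha>0 by (simp add: eq_neg_iff_add_eq_0)
    then have "?\<alpha> dvd r l" by (rule dvdI)
    then show False
      using prime_dvd_const_power[OF prime \<beta>] that(2) unfolding r_def by blast
  qed
  show ?thesis
  proof (cases "\<exists>l<n. r l \<noteq> 0")
    case False
    have "M = M'"
    proof (intro equalityI subsetI)
      fix v assume v: "v \<in> M"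
      then obtain u where u: "v = (\<lambda>i. \<Sum>l<n. u l * \<theta> l i)" using \<theta> unfolding vec_basis_def by blast
      have "?\<alpha> ^ Suc ?k dvd eval_form n (a H) (\<theta> l)" if "l < n" for l
        using val[OF that] False that by (auto simp: mult.left_commute)
      then have "?\<alpha> ^ Suc ?k dvd eval_form n (a H) v"
        unfolding u eval_form_comb by (intro dvd_sum dvd_mult) auto
      then show "v \<in> M'" using v M' by blast
    qed (use M' in blast)
    then have "block_basis (m(H := Suc ?k)) \<theta> d"
      using basis unfolding block_basis_def M_def M'_def by simp
    then show ?thesis by blast
  next
    case True
    let ?S = "{l. l < n \<and> r l \<noteq> 0}"
    define l0 where "l0 = arg_min_on d ?S"
    have S: "finite ?S" "?S \<noteq> {}" using True by auto
    have l0: "l0 < n" "r l0 \<noteq> 0"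
      using arg_min_if_finite(1)[OF S, of d] unfolding l0_def by auto
    have l0_min: "d l0 \<le> d l" if "l < n" "r l \<noteq> 0" for l
      using arg_min_least[OF S, of l d] that unfolding l0_def by simp
    have \<alpha>r: "\<not> ?\<alpha> dvd r l0"
      using prime_dvd_const_power[OF prime \<beta>] l0(2) unfolding r_def by blast
    define l1 where "l1 = \<pi> l0"
    have l1: "l1 < n" "\<pi> l1 = l0" using \<pi> l0(1) by (simp_all add: l1_def)
    have blk: "l0 = j \<and> l1 = \<pi> j \<or> l0 = \<pi> j \<and> l1 = j"
      using r_block[OF l0] \<pi>(2)[OF j] by (auto simp: l1_def)
    define h where "h = (if l1 \<noteq> l0 \<and> r l1 \<noteq> 0
      then mconst (c l1 / c l0) * \<beta> ^ (d l1 - d l0) else 0)"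
    define \<theta>1 where "\<theta>1 = (if l1 = l0 then \<theta> else \<theta>(l1 := \<lambda>x. \<theta> l1 x - h * \<theta> l0 x))"
    have c0: "c l0 \<noteq> 0" using l0(2) by (auto simp: r_def)
    have h_polys: "h \<in> polys n" by (auto simp: h_def \<beta>_def)
    have hr: "l1 \<noteq> l0 \<Longrightarrow> r l1 = h * r l0"
    proof (cases "r l1 = 0")
      case False
      assume "l1 \<noteq> l0"
      have "c l1 \<noteq> 0" using False by (auto simp: r_def)
      then have "?k \<le> d l0" "?k \<le> d l1" "d l0 \<le> d l1"
        using c_deg l0 l1 c0 l0_min False by auto
      then have "d l1 - ?k = (d l1 - d l0) + (d l0 - ?k)" by simp
      moreover have "mconst (c l1) = mconst (c l1 / c l0) * mconst (c l0)"
        using c0 by (simp flip: mconst_mult)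
      ultimately show ?thesis using False \<open>l1 \<noteq> l0\<close> by (simp add: r_def h_def power_add ac_simps)
    qed (simp add: h_def)
    have \<theta>1_basis: "vec_basis n M \<theta>1"
    proof (cases "l1 = l0")
      case False
      have "(\<lambda>x. \<theta> l1 x + (- h) * \<theta> l0 x) \<in> M"
        using \<theta>M[OF l1(1)] \<theta>M[OF l0(1)] h_polys unfolding M_def
        by (intro log_vecs_add log_vecs_mult) auto
      then have "(\<lambda>x. \<theta> l1 x - h * \<theta> l0 x) \<in> M" by simp
      from vec_basis_shear[OF \<theta> l1(1) l0(1) False this] show ?thesis
        using False by (simp add: \<theta>1_def)
    qed (simp add: \<theta>1_def \<theta>)
    have \<theta>1_l0: "\<theta>1 l0 = \<theta> l0" by (simp add: \<theta>1_def)
    have ev_shear: "eval_form n e (\<lambda>x. \<theta> l1 x - h * \<theta> l0 x) =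
        eval_form n e (\<theta> l1) - h * eval_form n e (\<theta> l0)" for e
      using eval_form_add[of n e "\<theta> l1" "\<lambda>x. (- h) * \<theta> l0 x"] eval_form_mult[of n e "- h" "\<theta> l0"]
      by simp
    have \<theta>1_dvd: "?\<alpha> ^ Suc ?k dvd eval_form n (a H) (\<theta>1 l)" if l: "l < n" "l \<noteq> l0" for l
    proof (cases "l = l1")
      case True
      then have "eval_form n (a H) (\<theta>1 l) = ?\<alpha> ^ Suc ?k * (g l1 - h * g l0)"
        using l hr val[OF l1(1)] val[OF l0(1)]
        by (simp add: \<theta>1_def ev_shear algebra_simps)
      then show ?thesis by simp
    next
      case False
      then have "r l = 0" using r_block[of l] l blk by metis
      then show ?thesis using val[OF l(1)] False by (auto simp: \<theta>1_def mult.left_commute)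
    qed
    have \<theta>1M: "\<theta>1 l \<in> M" if "l < n" for l using \<theta>1_basis that by (simp add: vec_basis_def)
    have dvd: "?\<alpha> dvd u l0" if "(\<lambda>i. \<Sum>l<n. u l * \<theta>1 l i) \<in> M'" for u
    proof -
      have "?\<alpha> ^ Suc ?k dvd (\<Sum>l<n. u l * eval_form n (a H) (\<theta>1 l))"
        using that unfolding M' eval_form_comb by blast
      also have "(\<Sum>l<n. u l * eval_form n (a H) (\<theta>1 l)) = u l0 * eval_form n (a H) (\<theta>1 l0)
          + (\<Sum>l\<in>{..<n} - {l0}. u l * eval_form n (a H) (\<theta>1 l))"
        using l0(1) by (intro sum.remove) auto
      finally have "?\<alpha> ^ Suc ?k dvd u l0 * eval_form n (a H) (\<theta>1 l0)"
        by (subst (asm) dvd_add_left_iff) (auto intro!: dvd_sum dvd_mult \<theta>1_dvd simp del: power_Suc)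
      then have "?\<alpha> ^ ?k * ?\<alpha> dvd ?\<alpha> ^ ?k * (u l0 * r l0 + ?\<alpha> * (u l0 * g l0))"
        using val[OF l0(1)] by (simp add: \<theta>1_l0 algebra_simps)
      then have "?\<alpha> dvd u l0 * r l0 + ?\<alpha> * (u l0 * g l0)" using \<alpha>0 by simp
      then have "?\<alpha> dvd u l0 * r l0" by (simp add: dvd_add_left_iff)
      then show ?thesis using prime_elem_dvd_multD[OF prime] \<alpha>r by blast
    qed
    have scaled: "(\<lambda>i. ?\<alpha> * \<theta>1 l0 i) \<in> M'"
    proof -
      have "?\<alpha> \<in> polys n" by simp
      then have "(\<lambda>i. ?\<alpha> * \<theta>1 l0 i) \<in> M" using \<theta>1M[OF l0(1)] unfolding M_def by (rule log_vecs_mult)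
      moreover have "?\<alpha> ^ Suc ?k dvd ?\<alpha> * eval_form n (a H) (\<theta>1 l0)"
        using val[OF l0(1)] by (simp add: \<theta>1_l0)
      ultimately show ?thesis by (simp add: M' eval_form_mult)
    qed
    define \<theta>2 where "\<theta>2 = \<theta>1(l0 := \<lambda>i. ?\<alpha> * \<theta>1 l0 i)"
    define d2 where "d2 = d(l0 := Suc (d l0))"
    have "vec_basis n M' \<theta>2"
      unfolding \<theta>2_def
    proof (rule vec_basis_scale[where M = M and p = "?\<alpha>"])
      show "?\<alpha> dvd u l0" if "(\<lambda>i. \<Sum>l<n. u l * \<theta>1 l i) \<in> M'" for u by (rule dvd[OF that])
      show "M' \<subseteq> M" using M' by blast
      show "\<theta>1 l \<in> M'" if "l < n" "l \<noteq> l0" for l using M' \<theta>1M \<theta>1_dvd that by blast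
    qed (use \<theta>1_basis l0(1) scaled \<alpha>0 in auto)
    moreover have "coord (\<theta>2 l) k \<in>
        (if k = l \<or> k = \<pi> l then binary_forms (P l) (P (\<pi> l)) (d2 l) else {0})"
      if l: "l < n" and k: "k < n" for l k
    proof -
      have inblk: "l0 = j \<or> l0 = \<pi> j" using blk by blast
      consider "l = l0" | "l = l1" "l1 \<noteq> l0" | "l \<noteq> l0" "l \<noteq> l1" by blast
      then show ?thesis
      proof cases
        case 1
        have co: "coord (\<theta>2 l) k = ?\<alpha> * coord (\<theta> l0) k"
          by (simp add: 1 \<theta>2_def \<theta>1_l0 eval_form_mult)
        have \<alpha>P: "\<exists>z w. ?\<alpha> = mconst z * P l0 + mconst w * P (\<pi> l0)"
          using blk unfolding ev l1_def by (metis add.commute)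
        show ?thesis
        proof (cases "k = l0 \<or> k = \<pi> l0")
          case True
          then have "coord (\<theta> l0) k \<in> binary_forms (P l0) (P (\<pi> l0)) (d l0)"
            using coord l0(1) k by blast
          then show ?thesis using co \<alpha>P True binary_forms_linear_mult by (auto simp: 1 d2_def)
        next
          case False
          then show ?thesis using co coord0[OF l0(1) k] by (auto simp: 1)
        qed
      next
        case 2
        have co: "coord (\<theta>2 l) k = coord (\<theta> l1) k - h * coord (\<theta> l0) k"
          using 2 by (simp add: \<theta>2_def \<theta>1_def ev_shear)
        show ?thesis
        proof (cases "k = l0 \<or> k = l1")
          case True
          have in1: "coord (\<theta> l1) k \<in> binary_forms (P l1) (P (\<pi> l1)) (d l1)"
            using coord[OF l1(1) k] True l1(2) by blast
          have "coord (\<theta> l0) k \<in> binary_forms (P l0) (P (\<pi> l0)) (d l0)"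
            using coord[OF l0(1) k] True by (auto simp: l1_def)
          then have in0: "coord (\<theta> l0) k \<in> binary_forms (P l1) (P (\<pi> l1)) (d l0)"
            using binary_forms_commute l1(2) unfolding l1_def[symmetric] by simp
          have "(- h) * coord (\<theta> l0) k \<in> binary_forms (P l1) (P (\<pi> l1)) (d l1)"
          proof (cases "r l1 = 0")
            case True
            then show ?thesis by (simp add: h_def binary_forms_0)
          next
            case False
            then have "d l0 \<le> d l1" using l0_min l1(1) by simp
            have "\<beta> = P (\<pi> j)" using 2 blk by (auto simp: \<beta>_def)
            then have "\<beta> = P l0 \<or> \<beta> = P l1" using blk by auto
            then have "\<beta> ^ (d l1 - d l0) * coord (\<theta> l0) k
                \<in> binary_forms (P l1) (P (\<pi> l1)) (d l1 - d l0 + d l0)"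
              using in0 binary_forms_power_mult binary_forms_commute l1(2) by metis
            then have "mconst (- (c l1 / c l0)) * (\<beta> ^ (d l1 - d l0) * coord (\<theta> l0) k)
                \<in> binary_forms (P l1) (P (\<pi> l1)) (d l1)"
              using \<open>d l0 \<le> d l1\<close> by (intro binary_forms_scale) simp
            then show ?thesis using False 2 by (simp add: h_def mconst_uminus mult.assoc)
          qed
          from binary_forms_add[OF in1 this]
          have "coord (\<theta>2 l) k \<in> binary_forms (P l1) (P (\<pi> l1)) (d l1)" by (simp add: co)
          then show ?thesis using True 2 l1(2) by (auto simp: d2_def)
        next
          case False
          then show ?thesis
            using co coord0[OF l0(1) k] coord0[OF l1(1) k] l1(2) 2 by (auto simp: l1_def)
        qed
      next
        case 3
        then have "\<theta>2 l = \<theta> l" "d2 l = d l" by (simp_all add: \<theta>2_def \<theta>1_def d2_def)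
        then show ?thesis using coord[OF l k] coord0[OF l k] by simp
      qed
    qed
    ultimately have "block_basis (m(H := Suc ?k)) \<theta>2 d2"
      unfolding block_basis_def M'_def by blast
    then show ?thesis by blast
  qed
qed

lemma block_basis_exists: "\<exists>\<theta> d. block_basis m \<theta> d"
proof (induction "\<Sum>H\<in>A. m H" arbitrary: m)
  case 0
  then have "log_vecs n A a m = poly_vecs n" using finite_A by (auto simp: log_vecs_def)
  moreover have "coord (\<lambda>i. mconst (D j i)) k = mconst (if j = k then 1 else 0)"
    if "j < n" "k < n" for j k
    using dual[OF that(2,1)] eval_form_const[of n "b k" "D j" 1] by auto
  ultimately have "block_basis m (\<lambda>j i. mconst (D j i)) (\<lambda>_. 0)"
    using constant_basis unfolding block_basis_def by (auto intro: binary_forms_const)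
  then show ?case by blast
next
  case (Suc s)
  then obtain H where H: "H \<in> A" "m H > 0"
    by (metis not_gr_zero sum.neutral Zero_neq_Suc)
  define m' where "m' = m(H := m H - 1)"
  have "Suc (\<Sum>H\<in>A. m' H) = (\<Sum>H\<in>A. m H)"
    using H finite_A by (simp add: m'_def sum.remove[of A H])
  then have "\<exists>\<theta> d. block_basis m' \<theta> d" using Suc by simp
  moreover have "m'(H := Suc (m' H)) = m" using H by (auto simp: m'_def)
  ultimately show ?case using block_basis_step[OF _ H(1)] by metis
qed

lemma block_arrangement_free: "free_module (polys n) (der_of n ` log_vecs n A a m)"
  using block_basis_exists[of m] free_module_if_vec_basis log_vecs_subset
  unfolding block_basis_def by blast

end

section \<open>Linear forms and hyperplanes\<close>

locale based_space = vector_space scale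
  for scale :: "'k::field \<Rightarrow> 'v::ab_group_add \<Rightarrow> 'v" (infixr \<open>*s\<close> 75) +
  fixes V :: "'v set" and bs :: "'v list"
  assumes basis: "ordered_basis scale V bs"
begin

abbreviation n :: nat where "n \<equiv> length bs"

lemma distinct_bs: "distinct bs" and independent_bs: "independent (set bs)"
  and span_bs: "span (set bs) = V"
  using basis by (simp_all add: ordered_basis_def)

lemma subspace_V: "subspace V" using span_bs by (metis subspace_span)

lemma bs_in_V: "i < n \<Longrightarrow> bs ! i \<in> V"
  using span_bs span_base by fastforce

lemma finite_independent: "independent B \<Longrightarrow> B \<subseteq> V \<Longrightarrow> finite B"
  using independent_span_bound[of "set bs" B] span_bs by simp

lemma card_basis: "independent B \<Longrightarrow> span B = V \<Longrightarrow> card B = n"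
  using dim_eq_card[of B "set bs"] dim_eq_card[of "set bs" "set bs"] independent_bs span_bs
    distinct_card[OF distinct_bs] by simp

abbreviation linear_form :: "('v \<Rightarrow> 'k) \<Rightarrow> bool" where "linear_form \<equiv> linear_form_on scale V"

lemma linear_form_add: "linear_form \<alpha> \<Longrightarrow> x \<in> V \<Longrightarrow> y \<in> V \<Longrightarrow> \<alpha> (x + y) = \<alpha> x + \<alpha> y"
  and linear_form_scale: "linear_form \<alpha> \<Longrightarrow> x \<in> V \<Longrightarrow> \<alpha> (c *s x) = c * \<alpha> x"
  by (simp_all add: linear_form_on_def)

lemma linear_form_0: "linear_form \<alpha> \<Longrightarrow> \<alpha> 0 = 0"
  using linear_form_scale[of \<alpha> 0 0] subspace_0[OF subspace_V] by simp

lemma linear_form_diff: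
  assumes "linear_form \<alpha>" "x \<in> V" "y \<in> V" shows "\<alpha> (x - y) = \<alpha> x - \<alpha> y"
proof -
  have "x - y \<in> V" using assms subspace_V subspace_diff by blast
  from linear_form_add[OF assms(1) this assms(3)] show ?thesis by simp
qed

lemma linear_form_sum:
  assumes "linear_form \<alpha>" "\<And>i. i \<in> I \<Longrightarrow> v i \<in> V"
  shows "\<alpha> (\<Sum>i\<in>I. c i *s v i) = (\<Sum>i\<in>I. c i * \<alpha> (v i))"
  using assms(2)
proof (induction I rule: infinite_finite_induct)
  case (insert i I)
  have "c i *s v i \<in> V" "(\<Sum>i\<in>I. c i *s v i) \<in> V"
    using insert subspace_V by (auto intro!: subspace_scale subspace_sum)
  then show ?case using insert assms(1) by (simp add: linear_form_add linear_form_scale)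
qed (simp_all add: linear_form_0[OF assms(1)])

lemma linear_form_representation:
  assumes "independent B" "span B = V" shows "linear_form (\<lambda>v. representation B v b)"
  using assms by (auto simp: linear_form_on_def representation_add representation_scale)

lemma linear_form_if_hyperplane:
  assumes H: "hyperplane_of scale V H"
  shows "\<exists>\<alpha>. linear_form \<alpha> \<and> {x \<in> V. \<alpha> x = 0} = H"
proof -
  have sub: "subspace H" "H \<subseteq> V" "dim V = dim H + 1"
    using H by (simp_all add: hyperplane_of_def)
  obtain B0 where B0: "B0 \<subseteq> H" "independent B0" "H \<subseteq> span B0" "card B0 = dim H"
    by (rule basis_exists)
  have span_B0: "span B0 = H" using B0 sub(1) by (intro span_subspace)
  obtain B where B: "B0 \<subseteq> B" "B \<subseteq> V" "independent B" "V \<subseteq> span B"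
    using maximal_independent_subset_extend[of B0 V] B0 sub(2) by blast
  have span_B: "span B = V" using B subspace_V by (intro span_subspace)
  have fin: "finite B" using finite_independent B by blast
  have "card B = card B0 + 1" using basis_card_eq_dim[OF B(2,4,3)] sub(3) B0(4) by simp
  then have "card (B - B0) = 1" using card_Diff_subset[of B0 B] fin B(1) finite_subset by fastforce
  then obtain d where d: "B - B0 = {d}" by (rule card_1_singletonE)
  then have Bd: "B = insert d B0" "d \<notin> B0" using B(1) by auto
  let ?\<alpha> = "\<lambda>v. representation B v d"
  have "{x \<in> V. ?\<alpha> x = 0} = H"
  proof (intro equalityI subsetI)
    fix x assume x: "x \<in> {x \<in> V. ?\<alpha> x = 0}"
    then have "x = (\<Sum>b\<in>B. representation B x b *s b)"
      using sum_representation_eq[of B x B] B(3) fin span_B by simp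
    also have "\<dots> = (\<Sum>b\<in>B0. representation B x b *s b)"
      using x Bd fin by simp
    also have "\<dots> \<in> H" using B0(1) sub(1) by (auto intro!: subspace_sum subspace_scale)
    finally show "x \<in> H" .
  next
    fix x assume x: "x \<in> H"
    then have "representation B x = representation B0 x"
      using B(1,3) span_B0 by (intro representation_extend) auto
    then have "?\<alpha> x = 0" using representation_ne_zero[of B0 x d] Bd(2) by auto
    then show "x \<in> {x \<in> V. ?\<alpha> x = 0}" using x sub(2) by auto
  qed
  then show ?thesis using linear_form_representation[OF B(3) span_B] by blast
qed

lemma hyperplane_if_linear_form:
  assumes \<alpha>: "linear_form \<alpha>" and v: "v \<in> V" "\<alpha> v \<noteq> 0"
  shows "hyperplane_of scale V {x \<in> V. \<alpha> x = 0}"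
proof -
  let ?H = "{x \<in> V. \<alpha> x = 0}"
  have sub: "subspace ?H"
    using subspace_V linear_form_0[OF \<alpha>]
    by (auto simp: subspace_def linear_form_add[OF \<alpha>] linear_form_scale[OF \<alpha>])
  obtain B0 where B0: "B0 \<subseteq> ?H" "independent B0" "?H \<subseteq> span B0" "card B0 = dim ?H"
    by (rule basis_exists)
  have span_B0: "span B0 = ?H" using B0 sub by (intro span_subspace)
  have v_notin: "v \<notin> span B0" using v span_B0 by simp
  then have "v \<notin> B0" using span_base by blast
  have ind: "independent (insert v B0)" using B0(2) v_notin by (intro independent_insertI)
  have "V \<subseteq> span (insert v B0)"
  proof
    fix x assume x: "x \<in> V"
    have "x - (\<alpha> x / \<alpha> v) *s v \<in> ?H"
      using x v subspace_V by (auto simp: linear_form_diff[OF \<alpha>] linear_form_scale[OF \<alpha>]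
        subspace_diff subspace_scale)
    then have "x - (\<alpha> x / \<alpha> v) *s v \<in> span B0" using span_B0 by blast
    then show "x \<in> span (insert v B0)" using span_breakdown_eq by blast
  qed
  moreover have "insert v B0 \<subseteq> V" using v(1) B0(1) by auto
  ultimately have "dim V = card (insert v B0)" using basis_card_eq_dim ind by metis
  moreover have "finite B0" using finite_independent[OF B0(2)] B0(1) by auto
  ultimately have "dim V = dim ?H + 1" using \<open>v \<notin> B0\<close> B0(4) by simp
  with sub show ?thesis by (auto simp: hyperplane_of_def)
qed

lemma ex_not_in_hyperplane:
  assumes "hyperplane_of scale V H" obtains v where "v \<in> V" "v \<notin> H"
proof -
  have "H \<noteq> V" using assms by (auto simp: hyperplane_of_def)
  then show thesis using assms that by (auto simp: hyperplane_of_def)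
qed

lemma hyperplane_subset_imp_eq:
  assumes "hyperplane_of scale V H" "hyperplane_of scale V H'" "H \<subseteq> H'" shows "H = H'"
proof -
  obtain \<alpha> \<beta> where \<alpha>: "linear_form \<alpha>" "{x \<in> V. \<alpha> x = 0} = H"
    and \<beta>: "linear_form \<beta>" "{x \<in> V. \<beta> x = 0} = H'"
    using linear_form_if_hyperplane assms by metis
  obtain v where v: "v \<in> V" "v \<notin> H'" using ex_not_in_hyperplane[OF assms(2)] .
  then have nz: "\<alpha> v \<noteq> 0" "\<beta> v \<noteq> 0" using \<alpha>(2) \<beta>(2) assms(3) by auto
  have "x \<in> H" if "x \<in> H'" for x
  proof -
    have x: "x \<in> V" "\<beta> x = 0" using that \<beta>(2) by auto
    have y: "x - (\<alpha> x / \<alpha> v) *s v \<in> V"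
      using x v subspace_V by (simp add: subspace_diff subspace_scale)
    have "\<alpha> (x - (\<alpha> x / \<alpha> v) *s v) = 0"
      using x v nz subspace_V by (simp add: linear_form_diff[OF \<alpha>(1)] linear_form_scale[OF \<alpha>(1)] subspace_scale)
    then have "\<beta> (x - (\<alpha> x / \<alpha> v) *s v) = 0" using y \<alpha>(2) \<beta>(2) assms(3) by blast
    then have "\<alpha> x = 0"
      using x v nz subspace_V by (simp add: linear_form_diff[OF \<beta>(1)] linear_form_scale[OF \<beta>(1)] subspace_scale)
    then show "x \<in> H" using x \<alpha>(2) by blast
  qed
  then show ?thesis using assms(3) by blast
qed

abbreviation form :: "'v set \<Rightarrow> 'v \<Rightarrow> 'k" where "form \<equiv> defining_form scale V"

lemma form:
  assumes "hyperplane_of scale V H"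
  shows "linear_form (form H)" "\<And>x. x \<in> V \<Longrightarrow> form H x = 0 \<longleftrightarrow> x \<in> H"
  using someI_ex[OF linear_form_if_hyperplane[OF assms]] unfolding defining_form_def by blast+

section \<open>Coordinates\<close>

definition coords :: "'v \<Rightarrow> nat \<Rightarrow> 'k"
  where "coords v i = (if i < n then representation (set bs) v (bs ! i) else 0)"

abbreviation eqn :: "'v set \<Rightarrow> nat \<Rightarrow> 'k" where "eqn H i \<equiv> form H (bs ! i)"

lemma sum_coords: "v \<in> V \<Longrightarrow> (\<Sum>i<n. coords v i *s (bs ! i)) = v"
  using sum_representation_eq[of "set bs" v "set bs"] independent_bs span_bs
    sum.reindex_bij_betw[OF bij_betw_nth[OF distinct_bs refl refl],
      of "\<lambda>b. representation (set bs) v b *s b"]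
  by (simp add: coords_def)

lemma pairing_coords:
  assumes "linear_form \<alpha>" "v \<in> V" shows "pairing n (\<lambda>i. \<alpha> (bs ! i)) (coords v) = \<alpha> v"
proof -
  have "\<alpha> v = \<alpha> (\<Sum>i<n. coords v i *s (bs ! i))" using sum_coords[OF assms(2)] by simp
  also have "\<dots> = (\<Sum>i<n. coords v i * \<alpha> (bs ! i))"
    using assms(1) bs_in_V by (intro linear_form_sum) auto
  finally show ?thesis by (simp add: pairing_def mult.commute)
qed

lemma free_multiarrangement_iff:
  "free_multiarrangement scale V bs A m \<longleftrightarrow> free_module (polys n) (der_of n ` log_vecs n A eqn m)"
  by (simp add: free_multiarrangement_def log_derivations_eq)

end

section \<open>Split arrangements\<close>

text \<open>The product decomposition into factors of rank at most two, in terms of a basis \<open>B\<close>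
  adapted to it: the involution \<open>\<pi>\<close> divides \<open>B\<close> into blocks, and each hyperplane contains all
  basis vectors outside some block.\<close>

definition splits :: "('k::field \<Rightarrow> 'v::ab_group_add \<Rightarrow> 'v) \<Rightarrow> 'v set \<Rightarrow> 'v set set \<Rightarrow> bool"
  where "splits s V A \<longleftrightarrow> (\<exists>B \<pi>. \<not> module.dependent s B \<and> module.span s B = V \<and>
    (\<forall>x\<in>B. \<pi> x \<in> B \<and> \<pi> (\<pi> x) = x) \<and> (\<forall>H\<in>A. \<exists>x\<in>B. B - {x, \<pi> x} \<subseteq> H))"

lemma splits_subset:
  assumes "splits s V A" "A' \<subseteq> A" shows "splits s V A'"
proof -
  obtain B \<pi> where "\<not> module.dependent s B" "module.span s B = V"
    "\<forall>x\<in>B. \<pi> x \<in> B \<and> \<pi> (\<pi> x) = x" "\<forall>H\<in>A. \<exists>x\<in>B. B - {x, \<pi> x} \<subseteq> H"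
    using assms(1) unfolding splits_def by (elim exE conjE)
  then show ?thesis
    unfolding splits_def using assms(2) by (intro exI[of _ B] exI[of _ \<pi>]) auto
qed

context based_space
begin

lemma free_if_splits:
  assumes splits: "splits scale V A" and A: "central_arrangement scale V A"
  shows "free_multiarrangement scale V bs A m"
proof -
  obtain B \<pi> where B: "independent B" "span B = V"
    and \<pi>: "\<And>x. x \<in> B \<Longrightarrow> \<pi> x \<in> B \<and> \<pi> (\<pi> x) = x"
    and block: "\<And>H. H \<in> A \<Longrightarrow> \<exists>x\<in>B. B - {x, \<pi> x} \<subseteq> H"
    using splits unfolding splits_def by blast
  have B_V: "B \<subseteq> V" using B(2) span_superset by blast
  obtain ds where ds: "set ds = B" "distinct ds"
    using finite_distinct_list[OF finite_independent[OF B(1) B_V]] by blast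
  have len: "length ds = n" using card_basis[OF B] distinct_card[OF ds(2)] ds(1) by simp
  have ds_B: "ds ! j \<in> B" if "j < n" for j using that len ds(1) by auto
  have ds_eq: "ds ! j = ds ! k \<longleftrightarrow> j = k" if "j < n" "k < n" for j k
    using that len nth_eq_iff_index_eq[OF ds(2)] by simp
  define idx where "idx x = (THE j. j < n \<and> ds ! j = x)" for x
  have idx: "idx (ds ! j) = j" if "j < n" for j
    unfolding idx_def using that ds_eq by (intro the_equality) auto
  have idx': "idx x < n \<and> ds ! idx x = x" if "x \<in> B" for x
    using that idx ds(1) len by (metis in_set_conv_nth)
  let ?rep = "representation B"
  interpret block_arrangement n A eqn "\<lambda>j. coords (ds ! j)" "\<lambda>j i. ?rep (bs ! i) (ds ! j)"
    "\<lambda>j. idx (\<pi> (ds ! j))"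
  proof
    show "finite A" using A by (simp add: central_arrangement_def)
    show "pairing n (\<lambda>i. ?rep (bs ! i) (ds ! j)) (coords (ds ! k)) = (if j = k then 1 else 0)"
      if "j < n" "k < n" for j k
    proof -
      have "pairing n (\<lambda>i. ?rep (bs ! i) (ds ! j)) (coords (ds ! k)) = ?rep (ds ! k) (ds ! j)"
        using ds_B that B_V by (intro pairing_coords linear_form_representation B) auto
      then show ?thesis using representation_basis[OF B(1) ds_B[OF that(2)]] ds_eq that by simp
    qed
    show "(\<Sum>j<n. coords (ds ! j) i * ?rep (bs ! i') (ds ! j)) = (if i = i' then 1 else 0)"
      if i: "i < n" "i' < n" for i i'
    proof -
      let ?\<alpha> = "\<lambda>v. representation (set bs) v (bs ! i)"
      have \<alpha>: "linear_form ?\<alpha>" by (intro linear_form_representation independent_bs span_bs)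
      have "bs ! i' = (\<Sum>b\<in>B. ?rep (bs ! i') b *s b)"
        using sum_representation_eq[of B "bs ! i'" B] B bs_in_V[OF i(2)] finite_independent[OF B(1) B_V]
        by simp
      then have "?\<alpha> (bs ! i') = ?\<alpha> (\<Sum>b\<in>B. ?rep (bs ! i') b *s b)" by simp
      also have "\<dots> = (\<Sum>b\<in>B. ?rep (bs ! i') b * ?\<alpha> b)"
        using B_V by (intro linear_form_sum \<alpha>) auto
      also have "\<dots> = (\<Sum>j<n. ?rep (bs ! i') (ds ! j) * ?\<alpha> (ds ! j))"
        using sum.reindex_bij_betw[OF bij_betw_nth[OF ds(2) refl refl],
          of "\<lambda>b. ?rep (bs ! i') b * ?\<alpha> b"] by (simp add: len ds(1))
      also have "?\<alpha> (bs ! i') = (if i = i' then 1 else 0)"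
        using representation_basis[OF independent_bs, of "bs ! i'"] i
          nth_eq_iff_index_eq[OF distinct_bs i] by auto
      finally show ?thesis using i by (simp add: coords_def mult.commute)
    qed
    show "coords (ds ! j) i = 0" if "n \<le> i" for i j using that by (simp add: coords_def)
    show "idx (\<pi> (ds ! j)) < n" "idx (\<pi> (ds ! idx (\<pi> (ds ! j)))) = j" if "j < n" for j
      using \<pi>[OF ds_B[OF that]] idx' idx[OF that] by auto
    fix H assume H: "H \<in> A"
    then have hyp: "hyperplane_of scale V H" using A by (simp add: central_arrangement_def)
    have pair: "pairing n (eqn H) (coords v) = form H v" if "v \<in> V" for v
      by (rule pairing_coords[OF form(1)[OF hyp] that])
    obtain x where x: "x \<in> B" "B - {x, \<pi> x} \<subseteq> H" using block[OF H] by blast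
    show "\<exists>j<n. \<forall>k<n. k \<noteq> j \<longrightarrow> k \<noteq> idx (\<pi> (ds ! j)) \<longrightarrow> pairing n (eqn H) (coords (ds ! k)) = 0"
    proof (intro exI[of _ "idx x"] conjI allI impI)
      show "idx x < n" using idx' x by blast
      fix k assume k: "k < n" "k \<noteq> idx x" "k \<noteq> idx (\<pi> (ds ! idx x))"
      then have "ds ! k \<noteq> x" "ds ! k \<noteq> \<pi> x" using idx[OF k(1)] idx' x(1) by auto
      then have "ds ! k \<in> H" using x(2) ds_B[OF k(1)] by blast
      then show "pairing n (eqn H) (coords (ds ! k)) = 0"
        using pair form(2)[OF hyp] ds_B[OF k(1)] B_V by auto
    qed
    obtain v where "v \<in> V" "v \<notin> H" using ex_not_in_hyperplane[OF hyp] .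
    then show "\<exists>w. pairing n (eqn H) w \<noteq> 0"
      using pair form(2)[OF hyp] by (intro exI[of _ "coords v"]) simp
  qed
  show ?thesis unfolding free_multiarrangement_iff by (rule block_arrangement_free)
qed

end

section \<open>Totally free arrangements split\<close>

lemma (in based_space) linear_form_diff_scale:
  "linear_form \<alpha> \<Longrightarrow> x \<in> V \<Longrightarrow> y \<in> V \<Longrightarrow> \<alpha> (x - c *s y) = \<alpha> x - c * \<alpha> y"
  using subspace_V by (simp add: linear_form_diff linear_form_scale subspace_scale)

locale based_arrangement = based_space +
  fixes A :: "'b set set"
  assumes arrangement: "central_arrangement scale V A"
begin

lemma finite_A: "finite A" and hyperplane: "H \<in> A \<Longrightarrow> hyperplane_of scale V H"
  using arrangement by (simp_all add: central_arrangement_def)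

lemmas linear = form(1)[OF hyperplane] and kernel = form(2)[OF hyperplane]

lemma pairing_eqn: "H \<in> A \<Longrightarrow> v \<in> V \<Longrightarrow> pairing n (eqn H) (coords v) = form H v"
  by (rule pairing_coords[OF linear])

lemma hyperplane_equations: "hyperplane_equations n A eqn"
proof
  fix H assume H: "H \<in> A"
  obtain v where "v \<in> V" "v \<notin> H" using ex_not_in_hyperplane[OF hyperplane[OF H]] .
  then show "\<exists>w. pairing n (eqn H) w \<noteq> 0"
    using H by (intro exI[of _ "coords v"]) (simp add: pairing_eqn kernel)
  fix H' assume H': "H' \<in> A" "H \<noteq> H'"
  then obtain v where v: "v \<in> H" "v \<notin> H'"
    using hyperplane_subset_imp_eq[OF hyperplane[OF H] hyperplane[OF H'(1)]] by blast
  moreover have "v \<in> V" using v hyperplane[OF H] by (auto simp: hyperplane_of_def)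
  ultimately show "\<exists>w. pairing n (eqn H) w = 0 \<and> pairing n (eqn H') w \<noteq> 0"
    using H H' by (intro exI[of _ "coords v"]) (simp add: pairing_eqn kernel)
qed (rule finite_A)

text \<open>The hyperplanes in \<open>T\<close> have independent equations, and their number is maximal by the last
  condition: an equation that does not vanish on the common zeros of \<open>T\<close> is independent of those
  of \<open>T\<close>.\<close>

definition dual_system :: "'b set set \<Rightarrow> ('b set \<Rightarrow> 'b) \<Rightarrow> bool"
  where "dual_system T d \<longleftrightarrow> T \<subseteq> A \<and> (\<forall>t\<in>T. d t \<in> V) \<and>
    (\<forall>t\<in>T. \<forall>u\<in>T. form t (d u) = (if t = u then 1 else 0)) \<and>
    (\<forall>H\<in>A. \<forall>v\<in>V. (\<forall>t\<in>T. form t v = 0) \<longrightarrow> form H v = 0)"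

lemma dual_system_exists: obtains T d where "dual_system T d"
proof -
  define D where "D = {T. T \<subseteq> A \<and> (\<exists>d. (\<forall>t\<in>T. d t \<in> V) \<and>
    (\<forall>t\<in>T. \<forall>u\<in>T. form t (d u) = (if t = u then 1 else 0)))}"
  have "D \<subseteq> Pow A" by (auto simp: D_def)
  then have "finite D" using finite_A by (simp add: finite_subset)
  moreover have "{} \<in> D" by (simp add: D_def)
  then have "D \<noteq> {}" by blast
  ultimately have "\<exists>T\<in>D. \<forall>S\<in>D. T \<subseteq> S \<longrightarrow> T = S" by (rule finite_has_maximal)
  then obtain T where T: "T \<in> D" "\<forall>S\<in>D. T \<subseteq> S \<longrightarrow> T = S" by (elim bexE)
  have TA: "T \<subseteq> A" using T(1) by (simp add: D_def)
  obtain d where d_all: "\<forall>t\<in>T. d t \<in> V"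
    "\<forall>t\<in>T. \<forall>u\<in>T. form t (d u) = (if t = u then 1 else 0)"
    using T(1) unfolding D_def by (elim CollectE conjE exE)
  then have d: "\<And>t. t \<in> T \<Longrightarrow> d t \<in> V"
    "\<And>t u. t \<in> T \<Longrightarrow> u \<in> T \<Longrightarrow> form t (d u) = (if t = u then 1 else 0)" by auto
  have "form H v = 0" if H: "H \<in> A" and v: "v \<in> V" "\<forall>t\<in>T. form t v = 0" for H v
  proof (rule ccontr)
    assume nz: "form H v \<noteq> 0"
    then have "H \<notin> T" using v by blast
    let ?d = "\<lambda>u. if u = H then (1 / form H v) *s v else d u - (form H (d u) / form H v) *s v"
    have dV: "?d u \<in> V" if "u \<in> insert H T" for u
      using that d v subspace_V by (auto intro: subspace_diff subspace_scale)
    have "form t (?d u) = (if t = u then 1 else 0)" if tu: "t \<in> insert H T" "u \<in> insert H T" for t u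
    proof -
      have t: "t \<in> A" using tu TA H by blast
      have "form t (?d u) = (if u = H then 1 / form H v * form t v
          else form t (d u) - form H (d u) / form H v * form t v)"
        using tu d(1)[of u] v(1)
        by (cases "u = H")
          (simp_all add: linear_form_scale[OF linear[OF t]] linear_form_diff_scale[OF linear[OF t]])
      then show ?thesis
        using tu d(2)[of t u] v(2) nz by (cases "u = H"; cases "t = H") simp_all
    qed
    then have "insert H T \<in> D"
      unfolding D_def using TA H dV by (intro CollectI conjI exI[of _ ?d]) auto
    then show False using T(2) \<open>H \<notin> T\<close> by blast
  qed
  then have "dual_system T d" unfolding dual_system_def using TA d by auto
  then show thesis by (rule that)
qed

definition supp_of :: "'b set set \<Rightarrow> ('b set \<Rightarrow> 'b) \<Rightarrow> 'b set \<Rightarrow> 'b set set"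
  where "supp_of T d H = {t \<in> T. form H (d t) \<noteq> 0}"

context
  fixes T d assumes dual: "dual_system T d"
begin

lemma T_subset: "T \<subseteq> A" and d_in_V: "t \<in> T \<Longrightarrow> d t \<in> V"
  and form_d: "t \<in> T \<Longrightarrow> u \<in> T \<Longrightarrow> form t (d u) = (if t = u then 1 else 0)"
  and form_0: "H \<in> A \<Longrightarrow> v \<in> V \<Longrightarrow> (\<And>t. t \<in> T \<Longrightarrow> form t v = 0) \<Longrightarrow> form H v = 0"
  using dual unfolding dual_system_def by blast+

lemma finite_T: "finite T" using T_subset finite_A finite_subset by blast

lemma dual_remainder:
  assumes v: "v \<in> V"
  shows "v - (\<Sum>t\<in>T. form t v *s d t) \<in> V"
    and "u \<in> T \<Longrightarrow> form u (v - (\<Sum>t\<in>T. form t v *s d t)) = 0"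
proof -
  have sum: "(\<Sum>t\<in>T. form t v *s d t) \<in> V"
    using d_in_V subspace_V by (intro subspace_sum subspace_scale)
  show "v - (\<Sum>t\<in>T. form t v *s d t) \<in> V" using v sum subspace_V by (simp add: subspace_diff)
  assume u: "u \<in> T"
  then have lin: "linear_form (form u)" using T_subset linear by blast
  have "form u (\<Sum>t\<in>T. form t v *s d t) = (\<Sum>t\<in>T. form t v * form u (d t))"
    using d_in_V by (rule linear_form_sum[OF lin])
  also have "\<dots> = (\<Sum>t\<in>T. if t = u then form u v else 0)"
    using u form_d by (intro sum.cong) auto
  also have "\<dots> = form u v" using u finite_T by simp
  finally show "form u (v - (\<Sum>t\<in>T. form t v *s d t)) = 0"
    using v sum by (simp add: linear_form_diff[OF lin])
qed

lemma form_expand: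
  assumes H: "H \<in> A" and v: "v \<in> V"
  shows "form H v = (\<Sum>t\<in>T. form H (d t) * form t v)"
proof -
  have sum: "(\<Sum>t\<in>T. form t v *s d t) \<in> V"
    using d_in_V subspace_V by (intro subspace_sum subspace_scale)
  have "form H (v - (\<Sum>t\<in>T. form t v *s d t)) = 0"
    using form_0[OF H] dual_remainder[OF v] by blast
  then have "form H v = form H (\<Sum>t\<in>T. form t v *s d t)"
    using v sum by (simp add: linear_form_diff[OF linear[OF H]])
  also have "\<dots> = (\<Sum>t\<in>T. form t v * form H (d t))"
    using d_in_V by (rule linear_form_sum[OF linear[OF H]])
  finally show ?thesis by (simp add: mult.commute)
qed

lemma supp_of_nonempty:
  assumes H: "H \<in> A" shows "supp_of T d H \<noteq> {}"
proof
  assume empty: "supp_of T d H = {}"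
  obtain v where v: "v \<in> V" "v \<notin> H" using ex_not_in_hyperplane[OF hyperplane[OF H]] .
  have "form H v = 0" using form_expand[OF H v(1)] empty by (simp add: supp_of_def)
  then show False using v kernel[OF H] by blast
qed

lemma supp_of_T: "t \<in> T \<Longrightarrow> supp_of T d t = {t}"
  by (auto simp: supp_of_def form_d split: if_splits)

text \<open>This is the exchange step of linear algebra: \<open>H'\<close> may replace each hyperplane in its
  support.\<close>

lemma dual_system_exchange:
  assumes H': "H' \<in> A" and t2: "t2 \<in> T" "form H' (d t2) \<noteq> 0"
  shows "dual_system (insert H' (T - {t2})) (\<lambda>t. if t = H' then (1 / form H' (d t2)) *s d t2
    else d t - (form H' (d t) / form H' (d t2)) *s d t2)"
    (is "dual_system ?T ?d")
proof -
  have lin: "linear_form (form t)" if "t \<in> ?T" for t using that T_subset H' linear by blast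
  have dV: "?d t \<in> V" if "t \<in> ?T" for t
    using that d_in_V t2 subspace_V by (auto intro: subspace_diff subspace_scale)
  have eval: "form t (?d u) = (if u = H' then 1 / form H' (d t2) * form t (d t2)
      else form t (d u) - form H' (d u) / form H' (d t2) * form t (d t2))"
    if "t \<in> ?T" "u \<in> ?T" for t u
    using that d_in_V[of u] d_in_V[OF t2(1)]
    by (cases "u = H'") (simp_all add: linear_form_scale[OF lin] linear_form_diff_scale[OF lin])
  have "form t (?d u) = (if t = u then 1 else 0)" if tu: "t \<in> ?T" "u \<in> ?T" for t u
  proof (cases "t = H'")
    case True
    then show ?thesis using eval[OF tu] t2 by auto
  next
    case False
    then have "t \<in> T" "form t (d t2) = 0" using tu t2 form_d by auto
    then show ?thesis
      using eval[OF tu] tu False form_d[of t u] by (cases "u = H'") simp_all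
  qed
  moreover have "form H v = 0" if "H \<in> A" "v \<in> V" "\<forall>t\<in>?T. form t v = 0" for H v
  proof (rule form_0[OF that(1,2)])
    have "0 = (\<Sum>t\<in>T. form H' (d t) * form t v)" using form_expand[OF H' that(2)] that(3) by simp
    also have "\<dots> = form H' (d t2) * form t2 v + (\<Sum>t\<in>T - {t2}. form H' (d t) * form t v)"
      using finite_T t2(1) by (rule sum.remove)
    also have "\<dots> = form H' (d t2) * form t2 v" using that(3) by simp
    finally have "form t2 v = 0" using t2 by simp
    then show "form t v = 0" if "t \<in> T" for t
      using that \<open>\<forall>t\<in>?T. form t v = 0\<close> by (cases "t = t2") auto
  qed
  moreover have "?T \<subseteq> A" using H' T_subset by blast
  ultimately show ?thesis
    unfolding dual_system_def using dV by (intro conjI ballI impI)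
qed

end

context
  assumes totally_free: "totally_free scale V bs A"
begin

text \<open>An equation that depends on three coordinates would complete a circuit of length at least
  four.\<close>

lemma supp_of_le_2:
  assumes dual: "dual_system T d" and H: "H \<in> A"
    and t: "t1 \<in> supp_of T d H" "t2 \<in> supp_of T d H" "t3 \<in> supp_of T d H"
      "t1 \<noteq> t2" "t1 \<noteq> t3" "t2 \<noteq> t3"
  shows False
proof -
  interpret hyperplane_equations n A eqn by (rule hyperplane_equations)
  note TA = T_subset[OF dual] and dV = d_in_V[OF dual] and fd = form_d[OF dual]
  let ?c = "\<lambda>t. form H (d t)"
  have T: "t1 \<in> T" "t2 \<in> T" "t3 \<in> T" and c: "?c t1 \<noteq> 0" "?c t2 \<noteq> 0" "?c t3 \<noteq> 0"
    using t by (simp_all add: supp_of_def)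
  define h where "h = (\<lambda>s::nat. if s = 0 then H else if s = 1 then t1 else t2)"
  define u where "u = (\<lambda>s::nat. if s = 0 then (1 / ?c t3) *s d t3
    else if s = 1 then d t1 - (?c t1 / ?c t3) *s d t3 else d t2 - (?c t2 / ?c t3) *s d t3)"
  have uV: "u s \<in> V" for s
    unfolding u_def using dV T subspace_V by (auto intro: subspace_diff subspace_scale)
  have lin: "linear_form (form t)" if "t \<in> T" for t using that TA linear by blast
  have less_3: "s < 3 \<longleftrightarrow> s = 0 \<or> s = 1 \<or> s = 2" for s :: nat by auto
  have hA: "h s \<in> A" for s using H T TA by (auto simp: h_def)
  show False
  proof (rule no_long_circuit[where h = h and w = "\<lambda>s. coords (u s)" and T = "T - {t1, t2}"
        and ?c1.0 = "?c t1" and ?c2.0 = "?c t2" and c = ?c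
        and ?e1.0 = "coords (d t1)" and ?e2.0 = "coords (d t2)"])
    show "free_module (polys n) (der_of n ` log_vecs n A eqn m)" if "\<forall>H\<in>A. m H > 0" for m
      using totally_free that unfolding totally_free_def free_multiarrangement_iff by blast
    show "h s \<in> A" for s by (rule hA)
    show "T - {t1, t2} \<subseteq> A" using TA by blast
    show "pairing n (eqn (h s)) (coords (u s')) = (if s = s' then 1 else 0)" if "s < 3" "s' < 3" for s s'
    proof -
      have "form (h s) (u s') = (if s = s' then 1 else 0)"
        using that unfolding less_3
        by (elim disjE) (simp_all add: h_def u_def linear H T dV fd c t(4-6) t(4-6)[symmetric]
            linear_form_diff[OF lin] linear_form_scale[OF lin] linear_form_diff[OF linear]
            linear_form_scale[OF linear] subspace_scale[OF subspace_V])
      then show ?thesis using pairing_eqn[OF hA uV] by simp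
    qed
    show "eqn (h 0) i = ?c t1 * eqn (h 1) i + ?c t2 * eqn (h 2) i
        + (\<Sum>t\<in>T - {t1, t2}. ?c t * eqn t i)" if "i < n" for i
    proof -
      have "T = insert t1 (insert t2 (T - {t1, t2}))" using T by blast
      then have "(\<Sum>t\<in>T. ?c t * eqn t i) =
          (\<Sum>t\<in>insert t1 (insert t2 (T - {t1, t2})). ?c t * eqn t i)" by (rule arg_cong)
      also have "\<dots> = ?c t1 * eqn t1 i + ?c t2 * eqn t2 i + (\<Sum>t\<in>T - {t1, t2}. ?c t * eqn t i)"
        using t(4) finite_T[OF dual] by (simp add: add.assoc)
      finally show ?thesis
        using form_expand[OF dual H bs_in_V[OF that]] by (simp add: h_def)
    qed
    show "pairing n (eqn (h 1)) (coords (d t1)) = 1" "pairing n (eqn (h 2)) (coords (d t1)) = 0"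
      "pairing n (eqn (h 1)) (coords (d t2)) = 0" "pairing n (eqn (h 2)) (coords (d t2)) = 1"
      using T TA dV fd t(4) t(4)[symmetric] by (simp_all add: h_def pairing_eqn subset_iff)
    show "pairing n (eqn t) (coords (d t1)) = 0" "pairing n (eqn t) (coords (d t2)) = 0"
      if "t \<in> T - {t1, t2}" for t
      using that T TA dV fd by (simp_all add: pairing_eqn subset_iff)
  qed (use c in auto)
qed

text \<open>Two equations with the supports \<open>{t1, t2}\<close> and \<open>{t2, t3}\<close> also yield a circuit of
  length four. It becomes an equation with a support of size three when the second one replaces
  \<open>t2\<close> in the dual system.\<close>

lemma supp_of_disjoint:
  assumes dual: "dual_system T d" and H: "H \<in> A" "H' \<in> A"
    and supp: "supp_of T d H = {t1, t2}" "supp_of T d H' = {t2, t3}" "t1 \<noteq> t2" "t2 \<noteq> t3"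
  shows "t1 = t3"
proof (rule ccontr)
  assume "t1 \<noteq> t3"
  let ?c = "\<lambda>t. form H (d t)" and ?c' = "\<lambda>t. form H' (d t)"
  have T: "t1 \<in> T" "t2 \<in> T" "t3 \<in> T" and c: "?c t1 \<noteq> 0" "?c t2 \<noteq> 0" "?c' t2 \<noteq> 0" "?c' t3 \<noteq> 0"
    using supp(1,2) by (auto simp: supp_of_def)
  have c0: "?c t3 = 0" "?c' t1 = 0"
    using supp T \<open>t1 \<noteq> t3\<close> unfolding supp_of_def by blast+
  have "H' \<notin> T"
  proof
    assume "H' \<in> T"
    then have "{H'} = {t2, t3}" using supp(2) supp_of_T[OF dual] by simp
    then show False using supp(4) by auto
  qed
  define d' where "d' = (\<lambda>t. if t = H' then (1 / ?c' t2) *s d t2 else d t - (?c' t / ?c' t2) *s d t2)"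
  let ?T = "insert H' (T - {t2})"
  have dual': "dual_system ?T d'"
    unfolding d'_def by (rule dual_system_exchange[OF dual H(2) T(2) c(3)])
  have dV: "d t \<in> V" if "t \<in> T" for t using d_in_V[OF dual that] .
  have "form H (d' H') = 1 / ?c' t2 * ?c t2"
    using T dV by (simp add: d'_def linear_form_scale[OF linear[OF H(1)]])
  moreover have "form H (d' t) = ?c t - ?c' t / ?c' t2 * ?c t2" if "t \<in> T" for t
    using that T dV subspace_V \<open>H' \<notin> T\<close>
    by (auto simp: d'_def linear_form_diff[OF linear[OF H(1)]] linear_form_scale[OF linear[OF H(1)]]
        subspace_scale)
  ultimately have "H' \<in> supp_of ?T d' H" "t1 \<in> supp_of ?T d' H" "t3 \<in> supp_of ?T d' H"
    using T c c0 supp(3,4) by (auto simp: supp_of_def)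
  then show False
    using supp_of_le_2[OF dual' H(1), of H' t1 t3] \<open>H' \<notin> T\<close> T \<open>t1 \<noteq> t3\<close> by auto
qed

lemma splits_if_totally_free: "splits scale V A"
proof -
  obtain T d where dual: "dual_system T d" by (rule dual_system_exists)
  note TA = T_subset[OF dual] and dV = d_in_V[OF dual] and fd = form_d[OF dual]
  let ?W = "{v \<in> V. \<forall>t\<in>T. form t v = 0}"
  have lin: "linear_form (form t)" if "t \<in> T" for t using that TA linear by blast
  have W: "subspace ?W"
    using subspace_V by (auto simp: subspace_def linear_form_0[OF lin] linear_form_add[OF lin]
        linear_form_scale[OF lin])
  obtain C where C: "C \<subseteq> ?W" "independent C" "?W \<subseteq> span C" by (rule basis_exists)
  have span_C: "span C = ?W" by (rule span_subspace[OF C(1,3) W])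
  have inj: "inj_on d T"
  proof (rule inj_onI)
    fix t u assume "t \<in> T" "u \<in> T" "d t = d u"
    then show "t = u" using fd[of t t] fd[of t u] by (auto split: if_splits)
  qed
  have ind: "independent (d ` S \<union> C)" if "S \<subseteq> T" for S
    using finite_subset[OF that finite_T[OF dual]] that
  proof (induction S)
    case (insert t S)
    have t: "t \<in> T" "t \<notin> S" "S \<subseteq> T" using insert by auto
    have "form t v = 0" if "v \<in> d ` S \<union> C" for v
      using that t fd C(1) by auto
    moreover have sub: "subspace {v \<in> V. form t v = 0}"
      using subspace_V t by (auto simp: subspace_def linear_form_0[OF lin] linear_form_add[OF lin]
          linear_form_scale[OF lin])
    moreover have "d ` S \<union> C \<subseteq> V" using t dV C(1) by auto
    ultimately have "span (d ` S \<union> C) \<subseteq> {v \<in> V. form t v = 0}"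
      by (intro span_minimal) auto
    then have "d t \<notin> span (d ` S \<union> C)" using fd[OF t(1) t(1)] by auto
    then show ?case using insert.IH t(3) by (simp add: independent_insertI)
  qed (simp add: C(2))
  let ?B = "d ` T \<union> C"
  have B_V: "?B \<subseteq> V" using dV C(1) by auto
  have "V \<subseteq> span ?B"
  proof
    fix v assume v: "v \<in> V"
    have "v - (\<Sum>t\<in>T. form t v *s d t) \<in> span C"
      using dual_remainder[OF dual v] span_C by auto
    then have "v - (\<Sum>t\<in>T. form t v *s d t) \<in> span ?B" using span_mono[of C ?B] by blast
    moreover have "(\<Sum>t\<in>T. form t v *s d t) \<in> span ?B"
      by (intro span_sum span_scale span_base) auto
    ultimately have "(v - (\<Sum>t\<in>T. form t v *s d t)) + (\<Sum>t\<in>T. form t v *s d t) \<in> span ?B"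
      by (rule span_add)
    then show "v \<in> span ?B" by simp
  qed
  then have span_B: "span ?B = V" using B_V subspace_V by (intro span_subspace)
  define linked where "linked t u \<longleftrightarrow> t \<noteq> u \<and> (\<exists>H\<in>A. supp_of T d H = {t, u})" for t u
  have linked_sym: "linked t u \<Longrightarrow> linked u t" for t u
    unfolding linked_def by (metis insert_commute)
  have linked_unique: "u = u'" if "linked t u" "linked t u'" for t u u'
    using that supp_of_disjoint[OF dual, of _ _ u t u'] unfolding linked_def
    by (metis insert_commute)
  define p where "p t = (if \<exists>u. linked t u then THE u. linked t u else t)" for t
  have p: "p t = u" if "linked t u" for t u
  proof -
    have "(THE u. linked t u) = u" using that linked_unique by (intro the_equality)
    then show ?thesis using that unfolding p_def by metis
  qed
  have p': "p t = t" if "\<nexists>u. linked t u" for t using that by (simp add: p_def)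
  have linked_T: "linked t u \<Longrightarrow> u \<in> T" for t u
    unfolding linked_def supp_of_def by blast
  have pp: "p t \<in> T \<and> p (p t) = t" if "t \<in> T" for t
    using that p p' linked_sym linked_T by metis
  define \<pi> where "\<pi> x = (if x \<in> d ` T then d (p (the_inv_into T d x)) else x)" for x
  have \<pi>_d: "\<pi> (d t) = d (p t)" if "t \<in> T" for t
    using that by (simp add: \<pi>_def the_inv_into_f_f[OF inj])
  have \<pi>: "\<pi> x \<in> ?B \<and> \<pi> (\<pi> x) = x" if "x \<in> ?B" for x
  proof (cases "x \<in> d ` T")
    case True
    then show ?thesis using \<pi>_d pp by auto
  qed (use that in \<open>auto simp: \<pi>_def\<close>)
  have block: "\<exists>x\<in>?B. ?B - {x, \<pi> x} \<subseteq> H" if H: "H \<in> A" for H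
  proof -
    obtain t where t: "t \<in> supp_of T d H" using supp_of_nonempty[OF dual H] by blast
    then have tT: "t \<in> T" by (simp add: supp_of_def)
    have sub: "supp_of T d H \<subseteq> {t, p t}"
    proof
      fix u assume u: "u \<in> supp_of T d H"
      show "u \<in> {t, p t}"
      proof (cases "u = t")
        case False
        then have "supp_of T d H = {t, u}"
          using supp_of_le_2[OF dual H, of t u] t u by blast
        then have "linked t u" using False H by (auto simp: linked_def)
        then show ?thesis using p by simp
      qed simp
    qed
    have "v \<in> H" if v: "v \<in> ?B - {d t, \<pi> (d t)}" for v
    proof -
      have "form H v = 0"
      proof (cases "v \<in> C")
        case True
        then show ?thesis using C(1) form_0[OF dual H] by auto
      next
        case False
        then obtain u where u: "u \<in> T" "v = d u" using v by blast
        then have "u \<notin> {t, p t}" using v \<pi>_d[OF tT] by auto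
        then show ?thesis using sub u by (auto simp: supp_of_def)
      qed
      then show ?thesis using kernel[OF H] v B_V by blast
    qed
    then show ?thesis using tT by (intro bexI[of _ "d t"]) auto
  qed
  show ?thesis
    unfolding splits_def
    by (intro exI[of _ ?B] exI[of _ \<pi>] conjI ballI ind[OF subset_refl] span_B block) (use \<pi> in auto)
qed

end

end

section \<open>Restrictions\<close>

context based_space
begin

lemma hyperplane_has_basis:
  assumes "hyperplane_of scale V H" obtains cs where "ordered_basis scale H cs"
proof -
  have H: "subspace H" "H \<subseteq> V" using assms by (simp_all add: hyperplane_of_def)
  obtain B where B: "B \<subseteq> H" "independent B" "H \<subseteq> span B" by (rule basis_exists)
  obtain cs where "set cs = B" "distinct cs"
    using finite_distinct_list[OF finite_independent[OF B(2)]] B(1) H(2) by blast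
  then show thesis
    using that[of cs] B span_subspace[OF B(1,3) H(1)] by (simp add: ordered_basis_def)
qed

end

context based_arrangement
begin

lemma restriction_central:
  assumes H0: "H0 \<in> A" shows "central_arrangement scale H0 (restriction A H0)"
proof -
  obtain cs where cs: "ordered_basis scale H0 cs"
    using hyperplane_has_basis[OF hyperplane[OF H0]] .
  interpret H0: based_space scale H0 cs by unfold_locales (rule cs)
  have H0_V: "H0 \<subseteq> V" using hyperplane[OF H0] by (simp add: hyperplane_of_def)
  have "hyperplane_of scale H0 (H0 \<inter> H)" if H: "H \<in> A" "H \<noteq> H0" for H
  proof -
    have "linear_form_on scale H0 (form H)"
      using linear[OF H(1)] H0_V by (simp add: linear_form_on_def subset_iff)
    moreover obtain v where "v \<in> H0" "v \<notin> H"
      using hyperplane_subset_imp_eq[OF hyperplane[OF H0] hyperplane[OF H(1)]] H(2) by blast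
    ultimately have "hyperplane_of scale H0 {x \<in> H0. form H x = 0}"
      using kernel[OF H(1)] H0_V by (intro H0.hyperplane_if_linear_form) auto
    moreover have "{x \<in> H0. form H x = 0} = H0 \<inter> H" using kernel[OF H(1)] H0_V by auto
    ultimately show ?thesis by simp
  qed
  then show ?thesis
    using finite_A by (auto simp: central_arrangement_def restriction_def)
qed

text \<open>The span of the block of \<open>H0\<close> meets \<open>H0\<close> in a space of dimension at most one. A basis
  vector \<open>w\<close> of this space, if there is one, replaces the block, and all other blocks are kept.\<close>

lemma restriction_splits:
  assumes splits: "splits scale V A" and H0: "H0 \<in> A"
  shows "splits scale H0 (restriction A H0)"
proof -
  obtain B \<pi> where B: "independent B" "span B = V"
    and \<pi>: "\<And>x. x \<in> B \<Longrightarrow> \<pi> x \<in> B \<and> \<pi> (\<pi> x) = x"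
    and block: "\<And>H. H \<in> A \<Longrightarrow> \<exists>x\<in>B. B - {x, \<pi> x} \<subseteq> H"
    using splits unfolding splits_def by blast
  have B_V: "B \<subseteq> V" using B(2) span_superset by blast
  have H0_V: "H0 \<subseteq> V" and sub_H0: "subspace H0" using hyperplane[OF H0] by (simp_all add: hyperplane_of_def)
  let ?\<alpha> = "form H0"
  note lin = linear[OF H0]
  obtain x where x: "x \<in> B" "B - {x, \<pi> x} \<subseteq> H0" "?\<alpha> x \<noteq> 0"
  proof -
    obtain x where x: "x \<in> B" "B - {x, \<pi> x} \<subseteq> H0" using block[OF H0] by blast
    have "?\<alpha> x \<noteq> 0 \<or> ?\<alpha> (\<pi> x) \<noteq> 0"
    proof (rule ccontr)
      assume "\<not> ?thesis"
      then have "B \<subseteq> H0" using x \<pi>[OF x(1)] kernel[OF H0] B_V by blast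
      then have "V \<subseteq> H0" using span_minimal[OF _ sub_H0] B(2) by blast
      then show False using ex_not_in_hyperplane[OF hyperplane[OF H0]] by blast
    qed
    then show thesis using that[of x] that[of "\<pi> x"] x \<pi>[OF x(1)] by (auto simp: insert_commute)
  qed
  define y where "y = \<pi> x"
  have y: "y \<in> B" "\<pi> y = x" using \<pi>[OF x(1)] by (simp_all add: y_def)
  have xV: "x \<in> V" "y \<in> V" using x y B_V by auto
  define w where "w = y - (?\<alpha> y / ?\<alpha> x) *s x"
  define R where "R = B - {x, y}"
  have R_H0: "R \<subseteq> H0" using x(2) by (simp add: R_def y_def)
  have w_H0: "w \<in> H0"
  proof -
    have "w \<in> V" unfolding w_def using xV subspace_V by (simp add: subspace_diff subspace_scale)
    moreover have "?\<alpha> w = 0"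
      unfolding w_def using xV x(3) subspace_V
      by (simp add: linear_form_diff[OF lin] linear_form_scale[OF lin] subspace_scale)
    ultimately show ?thesis using kernel[OF H0] by blast
  qed
  define C where "C = (if y = x then R else insert w R)"
  have C_H0: "C \<subseteq> H0" using R_H0 w_H0 by (simp add: C_def)
  have ind_R: "independent R" using B(1) by (rule independent_mono) (auto simp: R_def)
  have w_notin: "w \<notin> span R" if "y \<noteq> x"
  proof
    assume "w \<in> span R"
    then have "w \<in> span (B - {y})" using span_mono[of R "B - {y}"] by (auto simp: R_def)
    moreover have "(?\<alpha> y / ?\<alpha> x) *s x \<in> span (B - {y})"
      using x(1) that by (intro span_scale span_base) auto
    ultimately have "w + (?\<alpha> y / ?\<alpha> x) *s x \<in> span (B - {y})" by (rule span_add)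
    then have "y \<in> span (B - {y})" by (simp add: w_def)
    then show False using B(1) y(1) unfolding dependent_def by blast
  qed
  have ind_C: "independent C"
    using ind_R w_notin by (cases "y = x") (simp_all add: C_def independent_insertI)
  have "H0 \<subseteq> span C"
  proof
    fix v assume v: "v \<in> H0"
    have "V \<subseteq> span (insert x C)"
    proof -
      have "B \<subseteq> span (insert x C)"
      proof
        fix b assume b: "b \<in> B"
        consider "b = x" | "b \<in> R" | "b = y" "y \<noteq> x" using b by (auto simp: R_def)
        then show "b \<in> span (insert x C)"
        proof cases
          case 3
          have "w + (?\<alpha> y / ?\<alpha> x) *s x \<in> span (insert x C)"
            using 3 by (intro span_add span_scale span_base) (auto simp: C_def)
          then show ?thesis using 3 by (simp add: w_def)
        qed (auto simp: C_def intro: span_base)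
      qed
      then show ?thesis using span_minimal[OF _ subspace_span] B(2) by blast
    qed
    then have "v \<in> span (insert x C)" using v H0_V by blast
    then obtain k where k: "v - k *s x \<in> span C" using span_breakdown_eq by blast
    then have "v - k *s x \<in> H0" using span_minimal[OF C_H0 sub_H0] by blast
    then have "?\<alpha> (v - k *s x) = 0" using kernel[OF H0] H0_V by blast
    moreover have "?\<alpha> v = 0" using v kernel[OF H0] H0_V by blast
    ultimately have "k = 0"
      using x(3) xV v H0_V subspace_V
      by (auto simp: linear_form_diff[OF lin] linear_form_scale[OF lin] subspace_scale subset_iff)
    then show "v \<in> span C" using k by simp
  qed
  then have span_C: "span C = H0" using C_H0 sub_H0 by (intro span_subspace)
  define \<rho> where "\<rho> z = (if z \<in> R then \<pi> z else z)" for z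
  have \<pi>_R: "\<pi> z \<in> R" if "z \<in> R" for z
    using that \<pi>[of z] y x(1) unfolding R_def y_def by auto
  have w_notin_R: "w \<notin> R" if "y \<noteq> x" using w_notin[OF that] span_base by blast
  have \<rho>: "\<rho> z \<in> C \<and> \<rho> (\<rho> z) = z" if "z \<in> C" for z
    using that \<pi>_R \<pi>[of z] by (auto simp: \<rho>_def C_def R_def split: if_splits)
  have "\<exists>z\<in>C. C - {z, \<rho> z} \<subseteq> H0 \<inter> H" if H: "H \<in> A" "H \<noteq> H0" for H
  proof -
    have subH: "subspace H" using hyperplane[OF H(1)] by (simp add: hyperplane_of_def)
    obtain b where b: "b \<in> B" "B - {b, \<pi> b} \<subseteq> H" using block[OF H(1)] by blast
    show ?thesis
    proof (cases "b \<in> R")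
      case True
      then have "x \<notin> {b, \<pi> b}" "y \<notin> {b, \<pi> b}" using \<pi>_R[OF True] by (auto simp: R_def)
      then have "x \<in> H" "y \<in> H" using b(2) x(1) y(1) by auto
      then have "w \<in> H" unfolding w_def using subH by (simp add: subspace_diff subspace_scale)
      moreover have "R - {b, \<pi> b} \<subseteq> H" using b(2) by (auto simp: R_def)
      ultimately have "C - {b, \<rho> b} \<subseteq> H0 \<inter> H" using C_H0 True by (auto simp: C_def \<rho>_def split: if_splits)
      then show ?thesis using True by (intro bexI[of _ b]) (auto simp: C_def)
    next
      case False
      then have "{b, \<pi> b} = {x, y}" using b(1) y by (auto simp: R_def y_def)
      then have R_H: "R \<subseteq> H" using b(2) by (simp add: R_def)
      have "y \<noteq> x"
      proof
        assume "y = x"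
        then have "H0 \<subseteq> H" using span_minimal[OF R_H subH] span_C by (simp add: C_def)
        then show False
          using hyperplane_subset_imp_eq[OF hyperplane[OF H0] hyperplane[OF H(1)]] H(2) by blast
      qed
      then show ?thesis using R_H R_H0 by (intro bexI[of _ w]) (auto simp: C_def)
    qed
  qed
  then have "\<forall>H\<in>restriction A H0. \<exists>z\<in>C. C - {z, \<rho> z} \<subseteq> H" by (auto simp: restriction_def)
  then show ?thesis
    unfolding splits_def using ind_C span_C \<rho> by (intro exI[of _ C] exI[of _ \<rho>]) auto
qed

end

theorem corollary1p4:
  fixes scale :: "'k::field \<Rightarrow> 'v::ab_group_add \<Rightarrow> 'v"
    and V :: "'v set" and bs :: "'v list" and \<A> :: "'v set set" and l :: nat
  assumes "vector_space scale"
    and "ordered_basis scale V bs"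
    and "vector_space.dim scale V = l" and "l \<ge> 1"
    and "central_arrangement scale V \<A>"
    and "totally_free scale V bs \<A>"
  shows "(\<forall>\<B> \<subseteq> \<A>. central_arrangement scale V \<B> \<and>
            totally_free scale V bs \<B>) \<and>
         (\<forall>H0 \<in> \<A>. central_arrangement scale H0 (restriction \<A> H0) \<and>
            (\<forall>cs. ordered_basis scale H0 cs \<longrightarrow>
              totally_free scale H0 cs (restriction \<A> H0)))"
proof -
  interpret vector_space scale by (rule assms(1))
  interpret based_arrangement scale V bs \<A>
    by unfold_locales (rule assms)+
  have splits: "splits scale V \<A>" by (rule splits_if_totally_free[OF assms(6)])
  show ?thesis
  proof (intro conjI allI impI ballI)
    fix \<B> assume \<B>: "\<B> \<subseteq> \<A>"
    then show "central_arrangement scale V \<B>"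
      using arrangement finite_subset unfolding central_arrangement_def by blast
    then show "totally_free scale V bs \<B>"
      unfolding totally_free_def using free_if_splits[OF splits_subset[OF splits \<B>]] by blast
  next
    fix H0 assume H0: "H0 \<in> \<A>"
    then show central: "central_arrangement scale H0 (restriction \<A> H0)"
      by (rule restriction_central)
    fix cs assume "ordered_basis scale H0 cs"
    then interpret H0: based_space scale H0 cs by unfold_locales
    show "totally_free scale H0 cs (restriction \<A> H0)"
      unfolding totally_free_def
      using H0.free_if_splits[OF restriction_splits[OF splits H0] central] by blast
  qed
qed

end
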